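(* Let $K$ be a totally real number field with squarefree discriminant. Then \[\mathrm{Aut}\big((O_K,\mathrm{tr}_{K/\mathbb{Q}})\big) \cong \begin{cases} \mathbb{Z}/2\mathbb{Z}\times\mathbb{Z}/2\mathbb{Z} & \text{if } [K:\mathbb{Q}]=2,\\ \mathbb{Z}/2\mathbb{Z} & \text{otherwise.}\end{cases}\]
   Context: $(O_K,\mathrm{tr}_{K/\mathbb{Q}})$ denotes the $\mathbb{Z}$-lattice $O_K$ (ring of integers of $K$) with the bilinear form $(x,y)\mapsto\mathrm{Tr}_{K/\mathbb{Q}}(xy)$, and $\mathrm{Aut}$ of it is the group of $\mathbb{Z}$-linear bijections $O_K\to O_K$ preserving this form. *)

theory Defs
  imports
    "HOL-Algebra.Algebra"
    "HOL-Computational_Algebra.Computational_Algebra"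
    "Jordan_Normal_Form.Determinant"
begin

global_interpretation rat_vs: vector_space "\<lambda>q (x :: 'a :: field_char_0). of_rat q * x"
  defines rat_span = rat_vs.span
    and rat_dependent = rat_vs.dependent
    and rat_representation = rat_vs.representation
    and rat_dim = rat_vs.dim
  by unfold_locales (simp_all add: algebra_simps of_rat_add of_rat_mult)

class number_field = field_char_0 +
  assumes finite_over_rat: "\<exists>B :: 'a set. finite B \<and> (\<forall>x. \<exists>c :: 'a \<Rightarrow> rat. x = (\<Sum>b\<in>B. of_rat (c b) * b))"

definition field_degree :: "'k :: number_field itself \<Rightarrow> nat" where
  "field_degree _ = rat_dim (UNIV :: 'k set)"

definition totally_real :: "'k :: number_field itself \<Rightarrow> bool" where
  "totally_real _ \<longleftrightarrow>
    (\<forall>\<sigma> :: 'k \<Rightarrow> complex.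
      \<sigma> 1 = 1 \<and> (\<forall>x y. \<sigma> (x + y) = \<sigma> x + \<sigma> y) \<and> (\<forall>x y. \<sigma> (x * y) = \<sigma> x * \<sigma> y)
        \<longrightarrow> range \<sigma> \<subseteq> \<real>)"

definition ring_of_integers :: "'k :: number_field set" where
  "ring_of_integers = {x. algebraic_int x}"

text \<open>
  The trace of \<open>x\<close> is the trace of the \<open>\<rat>\<close>-linear map \<open>y \<mapsto> x * y\<close>: the sum of the diagonal
  entries of its matrix in a basis. The result does not depend on the basis that is chosen.
\<close>

definition rat_basis :: "'k :: number_field set \<Rightarrow> bool" where
  "rat_basis B \<longleftrightarrow> \<not> rat_dependent B \<and> rat_span B = UNIV"

definition field_trace :: "'k :: number_field \<Rightarrow> rat" where
  "field_trace x =
    (let B = (SOME B. rat_basis B) in \<Sum>b\<in>B. rat_representation B (x * b) b)"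

definition integral_basis :: "'k :: number_field list \<Rightarrow> bool" where
  "integral_basis bs \<longleftrightarrow>
    set bs \<subseteq> ring_of_integers \<and>
    (\<forall>x\<in>ring_of_integers. \<exists>!cs :: int list.
      length cs = length bs \<and> x = (\<Sum>i<length bs. of_int (cs ! i) * bs ! i))"

text \<open>
  The determinant below is the same integer for every integral basis, and integral bases exist,
  so the description is proper.
\<close>

definition field_discriminant :: "'k :: number_field itself \<Rightarrow> int" where
  "field_discriminant _ =
    (THE d. \<exists>bs :: 'k list. integral_basis bs \<and>
      of_int d = det (mat (length bs) (length bs) (\<lambda>(i, j). field_trace (bs ! i * bs ! j))))"

text \<open>
  As in \<^const>\<open>BijGroup\<close>, automorphisms of \<open>L\<close> are represented by functions that are
  \<^const>\<open>undefined\<close> outside \<open>L\<close>, so that each of them occurs only once.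
\<close>

definition lattice_aut :: "'a :: ring_1 set \<Rightarrow> ('a \<Rightarrow> 'a \<Rightarrow> 'b) \<Rightarrow> ('a \<Rightarrow> 'a) monoid" where
  "lattice_aut L b = BijGroup L \<lparr>carrier :=
    {f \<in> Bij L.
      (\<forall>x\<in>L. \<forall>y\<in>L. f (x + y) = f x + f y) \<and>
      (\<forall>m :: int. \<forall>x\<in>L. f (of_int m * x) = of_int m * f x) \<and>
      (\<forall>x\<in>L. \<forall>y\<in>L. b (f x) (f y) = b x y)}\<rparr>"

definition trace_form :: "'k :: number_field \<Rightarrow> 'k \<Rightarrow> rat" where
  "trace_form x y = field_trace (x * y)"

end

(*
Let f be an isometry of O_K, and let U be its matrix in the coordinates given by the real
embeddings; U is orthogonal, and its entries are the values of an element of K (x) K at pairs of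
embeddings. If p divides the discriminant d exactly once, then the radical of the trace form modulo
p is a line spanned by some r with r^2 in p O_K, and f acts on this line by a sign. Hence d U is
congruent to a multiple of r (x) r modulo p, and since r (x) r / p is integral over O_K (x) O_K, the
entries of U are algebraic integers. Their 2m-th powers sum to an integer that decreases with m, so
all entries are 0, 1 or -1, and f is a field automorphism up to a sign.

If an automorphism f fixes r modulo p, comparing the idempotents of f and of the identity in K (x) K
shows that f = id. So any f satisfies f^2 = id, and d divides the norm of f x - x for every
x in O_K. If f is not the identity, Minkowski's theorem on linear forms yields a nonzero x that
contradicts this unless K is quadratic. The case d = 1 is excluded by Minkowski's theorem as well.
*)
theory Submission
  imports Defs "Jordan_Normal_Form.Char_Poly" "HOL-Analysis.Change_Of_Vars"
    "HOL-Library.Function_Algebras" "HOL-Computational_Algebra.Field_as_Ring"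
begin

hide_const (open) Finite_Cartesian_Product.mat Finite_Cartesian_Product.vec Finite_Cartesian_Product.row
  Finite_Cartesian_Product.transpose Determinants.det Divisibility.prime

section \<open>Determinants\<close>

text \<open>Neither K \<otimes> K nor ideals are constructed. An element of K \<otimes> K is handled
  through its values at pairs of embeddings, and localisation at p is replaced by congruences modulo
  p between elements of O_K. One prime is treated at a time: squarefreeness makes the radical at p
  one-dimensional, and it also lets divisibility by each single p be glued to divisibility by d.

  The prime 2 is the obstacle: modulo 2 the signs 1 and -1 coincide, and the comparison of the two
  idempotents carries a factor 2. It is excluded by a congruence modulo 4 for tr (r * r).

  That d divides the norm of f x - x comes from the different: x acts on the line of r modulo p by
  an integer, and f x acts by the same integer. In Minkowski's theorem each orbit {i, \<sigma> i} of
  embeddings contributes one embedding and one difference, which keeps the forms unimodular. Only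
  the difference for the orbit of 0 gets the bound sqrt d, which is the covolume; it bounds f x - x
  at both embeddings of this orbit, so the norm of f x - x stays below d.\<close>

definition detf :: "nat \<Rightarrow> (nat \<Rightarrow> nat \<Rightarrow> 'a :: comm_ring_1) \<Rightarrow> 'a" where
  "detf n A = Determinant.det (Matrix.mat n n (\<lambda>(i, j). A i j))"

lemma detf_cong:
  assumes "\<And>i j. i < n \<Longrightarrow> j < n \<Longrightarrow> A i j = B i j"
  shows "detf n A = detf n B"
  unfolding detf_def using assms by (intro arg_cong[of _ _ Determinant.det] eq_matI) auto

lemma mat_mult_sum:
  "Matrix.mat n n (\<lambda>(i, j). A i j) * Matrix.mat n n (\<lambda>(i, j). B i j) =
   Matrix.mat n n (\<lambda>(i, j). \<Sum>k<n. A i k * (B k j :: 'a :: comm_ring_1))"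
  by (intro eq_matI) (auto simp: scalar_prod_def atLeast0LessThan intro!: sum.cong)

lemma detf_mult:
  "detf n (\<lambda>i j. \<Sum>k<n. A i k * B k j) = detf n A * detf n B"
  unfolding detf_def mat_mult_sum[symmetric] by (rule det_mult) auto

lemma detf_transpose: "detf n (\<lambda>i j. A j i) = detf n A"
proof -
  have "Matrix.mat n n (\<lambda>(i, j). A j i) = transpose_mat (Matrix.mat n n (\<lambda>(i, j). A i j))"
    by (intro eq_matI) auto
  then show ?thesis
    unfolding detf_def by (simp add: Determinant.det_transpose[of _ n])
qed

lemma detf_eq_sum:
  "detf n A = (\<Sum>p | p permutes {..<n}. of_int (sign p) * (\<Prod>i<n. A i (p i)))"
proof -
  have "detf n A = (\<Sum>p | p permutes {0..<n}. signof p * (\<Prod>i = 0..<n. Matrix.mat n n (\<lambda>(i, j). A i j) $$ (i, p i)))"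
    unfolding detf_def by (rule det_def'[of _ n]) simp
  also have "\<dots> = (\<Sum>p | p permutes {0..<n}. signof p * (\<Prod>i = 0..<n. A i (p i)))"
  proof (intro sum.cong refl arg_cong2[of _ _ _ _ times] prod.cong)
    fix p i assume "p \<in> {p. p permutes {0..<n}}" "i \<in> {0..<n}"
    then have "i < n" "p i < n" using permutes_in_image[of p "{0..<n}" i] by auto
    then show "Matrix.mat n n (\<lambda>(i, j). A i j) $$ (i, p i) = A i (p i)" by simp
  qed
  finally have "detf n A = (\<Sum>p | p permutes {0..<n}. signof p * (\<Prod>i = 0..<n. A i (p i)))" .
  then show ?thesis by (simp add: atLeast0LessThan)
qed

lemma detf_of_int: "detf n (\<lambda>i j. of_int (A i j)) = of_int (detf n A)"
  unfolding detf_eq_sum by simp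

lemma detf_scale:
  "detf n (\<lambda>i j. c i * A i j) = (\<Prod>i<n. c i) * detf n A"
  unfolding detf_eq_sum by (simp add: prod.distrib sum_distrib_left mult_ac)

text \<open>Cramer's rule without division, so that it applies to integer matrices.\<close>

lemma detf_replace_col:
  assumes "k < n"
  shows "detf n (\<lambda>i j. if j = k then \<Sum>l<n. A i l * c l else A i j) = c k * detf n A"
proof -
  let ?A = "Matrix.mat n n (\<lambda>(i, j). A i j)" and ?c = "Matrix.vec n c"
  have "Matrix.mat n n (\<lambda>(i, j). if j = k then \<Sum>l<n. A i l * c l else A i j)
      = replace_col ?A (?A *\<^sub>v ?c) k"
    by (intro eq_matI) (auto simp: replace_col_def scalar_prod_def atLeast0LessThan intro!: sum.cong)
  then show ?thesis
    unfolding detf_def using cramer_lemma_mat[of ?A n ?c k] assms by simp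
qed

lemma detf_replace_row:
  assumes "k < n"
  shows "detf n (\<lambda>i j. if i = k then \<Sum>l<n. c l * A l j else A i j) = c k * detf n A"
proof -
  have "detf n (\<lambda>i j. if i = k then \<Sum>l<n. c l * A l j else A i j) =
      detf n (\<lambda>i j. if j = k then \<Sum>l<n. A l i * c l else A j i)"
    by (subst detf_transpose[symmetric]) (intro detf_cong, simp add: mult.commute)
  also have "\<dots> = c k * detf n (\<lambda>i j. A j i)"
    by (rule detf_replace_col[OF assms])
  finally show ?thesis unfolding detf_transpose[of n A] .
qed

text \<open>Over a commutative ring, so the adjugate R of an integer matrix is again integral. This
  later provides integral multiples of the dual basis.\<close>

lemma detf_adjugate:
  obtains R :: "nat \<Rightarrow> nat \<Rightarrow> 'a :: comm_ring_1"
  where "\<And>i j. i < n \<Longrightarrow> j < n \<Longrightarrow> (\<Sum>k<n. A i k * R k j) = (if i = j then detf n A else 0)"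
    and "\<And>i j. i < n \<Longrightarrow> j < n \<Longrightarrow> (\<Sum>k<n. R i k * A k j) = (if i = j then detf n A else 0)"
proof
  let ?A = "Matrix.mat n n (\<lambda>(i, j). A i j)"
  define R where "R i j = adj_mat ?A $$ (i, j)" for i j
  have A: "?A \<in> carrier_mat n n" by simp
  have R: "adj_mat ?A = Matrix.mat n n (\<lambda>(i, j). R i j)"
    using adj_mat(1)[OF A] unfolding R_def by (intro eq_matI) auto
  note * = adj_mat(2,3)[OF A, unfolded R mat_mult_sum]
  show "(\<Sum>k<n. A i k * R k j) = (if i = j then detf n A else 0)" if "i < n" "j < n" for i j
    using arg_cong[OF *(1), of "\<lambda>M. M $$ (i, j)"] that by (simp add: detf_def)
  show "(\<Sum>k<n. R i k * A k j) = (if i = j then detf n A else 0)" if "i < n" "j < n" for i j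
    using arg_cong[OF *(2), of "\<lambda>M. M $$ (i, j)"] that by (simp add: detf_def)
qed

lemma matrix_left_right_inverse:
  fixes A B :: "nat \<Rightarrow> nat \<Rightarrow> 'a :: field"
  assumes "\<And>i j. i < n \<Longrightarrow> j < n \<Longrightarrow> (\<Sum>k<n. A i k * B k j) = (if i = j then 1 else 0)"
    and "i < n" "j < n"
  shows "(\<Sum>k<n. B i k * A k j) = (if i = j then 1 else 0)"
proof -
  let ?A = "Matrix.mat n n (\<lambda>(i, j). A i j)" and ?B = "Matrix.mat n n (\<lambda>(i, j). B i j)"
  have "?A * ?B = 1\<^sub>m n"
    unfolding mat_mult_sum using assms(1) by (intro eq_matI) auto
  then have "?B * ?A = 1\<^sub>m n"
    by (intro mat_mult_left_right_inverse[of ?A n ?B]) auto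
  from arg_cong[OF this[unfolded mat_mult_sum], of "\<lambda>M. M $$ (i, j)"] assms(2,3)
  show ?thesis by simp
qed

lemma detf_lower_unitriangular:
  fixes A :: "nat \<Rightarrow> nat \<Rightarrow> 'a :: comm_ring_1"
  assumes "\<And>i j. i < j \<Longrightarrow> j < n \<Longrightarrow> A i j = 0" "\<And>i. i < n \<Longrightarrow> A i i = 1"
  shows "detf n A = 1"
proof -
  have "detf n A = prod_list (diag_mat (Matrix.mat n n (\<lambda>(i, j). A i j)))"
    unfolding detf_def by (rule det_lower_triangular[where n = n]) (use assms in auto)
  also have "diag_mat (Matrix.mat n n (\<lambda>(i, j). A i j)) = map (\<lambda>_. 1) [0..<n]"
    using assms(2) by (auto simp: diag_mat_def)
  finally show ?thesis by (simp add: map_replicate_const)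
qed

lemma detf_one: "detf n (\<lambda>i j. if i = j then 1 else 0) = 1"
  by (rule detf_lower_unitriangular) auto

section \<open>Algebraic integers\<close>

interpretation zmod: Modules.module "\<lambda>(c :: int) (x :: 'a :: field_char_0). of_int c * x"
  by unfold_locales (simp_all add: algebra_simps)

text \<open>The determinant trick: multiplication by z, written in the generators S, is an integer
  matrix that has the tuple of generators as an eigenvector, nonzero because of \<open>s0\<close>.
  Its characteristic polynomial is monic.\<close>

lemma algebraic_int_of_stable_module:
  fixes z :: "'a :: field_char_0"
  assumes "finite S" "s0 \<in> S" "s0 \<noteq> 0" and "\<And>s. s \<in> S \<Longrightarrow> z * s \<in> zmod.span S"
  shows "algebraic_int z"
proof -
  define n where "n = card S"
  from ex_bij_betw_nat_finite[OF assms(1)] obtain v where v: "bij_betw v {0..<n} S"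
    unfolding n_def by blast
  have "\<exists>c :: 'a \<Rightarrow> int. z * s = (\<Sum>t\<in>S. of_int (c t) * t)" if "s \<in> S" for s
    using assms(4)[OF that] unfolding zmod.span_finite[OF assms(1)] by auto
  then obtain c :: "'a \<Rightarrow> 'a \<Rightarrow> int" where c: "\<And>s. s \<in> S \<Longrightarrow> z * s = (\<Sum>t\<in>S. of_int (c s t) * t)"
    by metis
  define M where "M = Matrix.mat n n (\<lambda>(i, j). c (v i) (v j))"
  let ?M = "map_mat of_int M :: 'a mat"
  have M: "M \<in> carrier_mat n n" "?M \<in> carrier_mat n n" by (auto simp: M_def)
  have vS: "v i \<in> S" if "i < n" for i using v that by (auto simp: bij_betw_def)
  have "?M *\<^sub>v Matrix.vec n v = z \<cdot>\<^sub>v Matrix.vec n v"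
  proof (intro eq_vecI)
    fix i assume "i < dim_vec (z \<cdot>\<^sub>v Matrix.vec n v)"
    then have i: "i < n" by simp
    have "(\<Sum>t\<in>S. of_int (c (v i) t) * t) = (\<Sum>j\<in>{0..<n}. of_int (c (v i) (v j)) * v j)"
      by (rule sum.reindex_bij_betw[OF v, symmetric])
    then show "vec_index (?M *\<^sub>v Matrix.vec n v) i = vec_index (z \<cdot>\<^sub>v Matrix.vec n v) i"
      using i c[OF vS[OF i]] by (simp add: M_def scalar_prod_def)
  qed (simp add: M_def)
  moreover obtain i0 where "i0 < n" "v i0 = s0"
    using assms(2) v by (force simp: bij_betw_def)
  then have "Matrix.vec n v \<noteq> 0\<^sub>v n"
    using assms(3) by (metis index_vec index_zero_vec(1))
  ultimately have "eigenvalue ?M z"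
    using M unfolding eigenvalue_def eigenvector_def by (intro exI[of _ "Matrix.vec n v"]) auto
  then have "poly (char_poly ?M) z = 0"
    using eigenvalue_root_char_poly[OF M(2)] by simp
  then have "poly (map_poly of_int (char_poly M)) z = 0"
    by (simp add: of_int_hom.char_poly_hom[OF M(1)])
  moreover have "lead_coeff (char_poly M) = 1"
    using degree_monic_char_poly[OF M(1)] by simp
  ultimately show ?thesis
    unfolding algebraic_int_altdef_ipoly by blast
qed

lemma algebraic_int_power_in_span:
  fixes x :: "'a :: field_char_0"
  assumes "algebraic_int x"
  obtains m where "m > 0" "x ^ m \<in> zmod.span ((\<lambda>i. x ^ i) ` {..<m})"
proof -
  from assms obtain p where p: "poly (map_poly of_int p) x = 0" "lead_coeff p = 1"
    unfolding algebraic_int_altdef_ipoly by auto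
  define m where "m = degree p"
  have "m > 0"
  proof (rule ccontr)
    assume "\<not> m > 0"
    then have "degree p = 0" by (simp add: m_def)
    then obtain c where "p = [:c:]" by (auto elim: degree_eq_zeroE)
    with p show False by simp
  qed
  have deg: "degree (map_poly of_int p :: 'a poly) = m"
    by (simp add: m_def)
  have cf: "coeff p m = 1" using p by (simp add: m_def)
  have "0 = (\<Sum>i\<le>m. of_int (coeff p i) * x ^ i)"
    using p(1) unfolding poly_altdef deg by simp
  also have "\<dots> = (\<Sum>i<m. of_int (coeff p i) * x ^ i) + x ^ m"
    by (simp add: lessThan_Suc_atMost[symmetric] cf)
  finally have "x ^ m = (\<Sum>i<m. of_int (- coeff p i) * x ^ i)"
    by (simp add: sum_negf eq_neg_iff_add_eq_0 add.commute)
  also have "\<dots> \<in> zmod.span ((\<lambda>i. x ^ i) ` {..<m})"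
    by (intro zmod.span_sum zmod.span_scale zmod.span_base) auto
  finally show ?thesis using that \<open>m > 0\<close> by blast
qed

lemma power_Suc_in_span:
  fixes x :: "'a :: field_char_0"
  assumes "x ^ m \<in> zmod.span ((\<lambda>i. x ^ i) ` {..<m})" "i < m"
  shows "x ^ Suc i \<in> zmod.span ((\<lambda>i. x ^ i) ` {..<m})"
proof (cases "Suc i < m")
  case True
  then show ?thesis by (intro zmod.span_base) (auto simp del: power_Suc)
next
  case False
  then have "Suc i = m" using assms(2) by simp
  then show ?thesis using assms(1) by simp
qed

text \<open>The monomials \<open>x ^ i * y ^ j\<close> with i < m and j < l span a module that is
  stable under multiplication by x and by y, hence by x + y and x * y.\<close>

lemma
  fixes x y :: "'a :: field_char_0"
  assumes "algebraic_int x" "algebraic_int y"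
  shows algebraic_int_add: "algebraic_int (x + y)"
    and algebraic_int_mult: "algebraic_int (x * y)"
proof -
  obtain m where m: "m > 0" "x ^ m \<in> zmod.span ((\<lambda>i. x ^ i) ` {..<m})"
    using algebraic_int_power_in_span[OF assms(1)] .
  obtain l where l: "l > 0" "y ^ l \<in> zmod.span ((\<lambda>i. y ^ i) ` {..<l})"
    using algebraic_int_power_in_span[OF assms(2)] .
  define S where "S = (\<lambda>(i, j). x ^ i * y ^ j) ` ({..<m} \<times> {..<l})"
  have S: "finite S" "1 \<in> S"
    using m(1) l(1) by (auto simp: S_def image_iff intro!: bexI[of _ 0])
  have inS: "x ^ i * y ^ j \<in> S" if "i < m" "j < l" for i j
    using that by (auto simp: S_def)
  have mono_x: "a * y ^ j \<in> zmod.span S" if "a \<in> zmod.span ((\<lambda>i. x ^ i) ` {..<m})" "j < l" for a j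
    using that(1)
  proof (induction rule: zmod.span_induct_alt)
    case (step c a b)
    then have "of_int c * (a * y ^ j) + b * y ^ j \<in> zmod.span S"
      using that(2) inS by (intro zmod.span_add zmod.span_scale, intro zmod.span_base) auto
    then show ?case by (simp add: distrib_right mult.assoc)
  qed (simp add: zmod.span_zero)
  have mono_y: "x ^ i * b \<in> zmod.span S" if "b \<in> zmod.span ((\<lambda>i. y ^ i) ` {..<l})" "i < m" for b i
    using that(1)
  proof (induction rule: zmod.span_induct_alt)
    case (step c a b)
    then have "of_int c * (x ^ i * a) + x ^ i * b \<in> zmod.span S"
      using that(2) inS by (intro zmod.span_add zmod.span_scale, intro zmod.span_base) auto
    then show ?case by (simp add: distrib_left mult.left_commute[of "x ^ i"])
  qed (simp add: zmod.span_zero)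
  have stab: "z * s \<in> zmod.span S" if "\<And>s. s \<in> S \<Longrightarrow> z * s \<in> zmod.span S" "s \<in> zmod.span S" for z s
    using that(2)
  proof (induction rule: zmod.span_induct_alt)
    case (step c a b)
    then have "of_int c * (z * a) + z * b \<in> zmod.span S"
      using that(1) by (intro zmod.span_add zmod.span_scale) auto
    then show ?case by (simp add: distrib_left mult.left_commute[of z])
  qed (simp add: zmod.span_zero)
  have x: "x * s \<in> zmod.span S" if "s \<in> S" for s
  proof -
    from that obtain i j where ij: "s = x ^ i * y ^ j" "i < m" "j < l" by (auto simp: S_def)
    from mono_x[OF power_Suc_in_span[OF m(2) ij(2)] ij(3)] show ?thesis by (simp add: ij mult_ac)
  qed
  have y: "y * s \<in> zmod.span S" if "s \<in> S" for s
  proof -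
    from that obtain i j where ij: "s = x ^ i * y ^ j" "i < m" "j < l" by (auto simp: S_def)
    from mono_y[OF power_Suc_in_span[OF l(2) ij(3)] ij(2)] show ?thesis by (simp add: ij mult_ac)
  qed
  show "algebraic_int (x + y)"
    by (rule algebraic_int_of_stable_module[OF S]) (auto simp: distrib_right intro!: zmod.span_add x y)
  show "algebraic_int (x * y)"
    by (rule algebraic_int_of_stable_module[OF S]) (auto simp: mult.assoc intro!: stab[OF x] y)
qed

lemma algebraic_int_of_int [simp]: "algebraic_int (of_int m :: 'a :: field_char_0)"
  by (rule int_imp_algebraic_int) auto

lemma algebraic_int_diff:
  "algebraic_int x \<Longrightarrow> algebraic_int y \<Longrightarrow> algebraic_int (x - y :: 'a :: field_char_0)"
  using algebraic_int_add[of x "- y"] by auto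

lemma algebraic_int_sum:
  "(\<And>i. i \<in> I \<Longrightarrow> algebraic_int (f i :: 'a :: field_char_0)) \<Longrightarrow> algebraic_int (sum f I)"
  by (induction I rule: infinite_finite_induct) (auto intro: algebraic_int_add)

lemma algebraic_int_power: "algebraic_int (x :: 'a :: field_char_0) \<Longrightarrow> algebraic_int (x ^ k)"
  by (induction k) (auto intro: algebraic_int_mult)

lemma algebraic_int_power2D: "algebraic_int ((x :: 'a :: field_char_0) ^ 2) \<Longrightarrow> algebraic_int x"
  using algebraic_int_root[of "x ^ 2" "monom 1 2" x] by (simp add: poly_monom degree_monom_eq)

text \<open>The set of integers \<open>m\<close> with \<open>m * z \<in> I\<close> is an ideal, and \<open>d\<close> and the \<open>d / p\<close> generate the
  unit ideal.\<close>

lemma squarefree_quotients_generate: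
  fixes d :: int and I :: "'a :: ring_1 set"
  assumes "squarefree d"
    and add: "\<And>x y. x \<in> I \<Longrightarrow> y \<in> I \<Longrightarrow> x + y \<in> I"
    and mult: "\<And>m x. x \<in> I \<Longrightarrow> of_int m * x \<in> I"
    and "of_int d * z \<in> I"
    and "\<And>p k. prime p \<Longrightarrow> d = p * k \<Longrightarrow> of_int k * z \<in> I"
  shows "z \<in> I"
proof -
  have "d \<noteq> 0" using assms(1) by auto
  define J where "J = {m :: int. of_int m * z \<in> I}"
  have J_add: "a + b \<in> J" if "a \<in> J" "b \<in> J" for a b
    using that add by (auto simp: J_def distrib_right)
  have J_mult: "a * b \<in> J" if "b \<in> J" for a b
    using that mult[of "of_int b * z" a] by (auto simp: J_def mult.assoc)
  have dJ: "d \<in> J" using assms(4) by (simp add: J_def)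
  define g where "g = (LEAST g. g > 0 \<and> int g \<in> J)"
  have "int (nat \<bar>d\<bar>) \<in> J"
    using dJ J_mult[OF dJ, of "-1"] by (cases "d \<ge> 0") auto
  then have ex: "nat \<bar>d\<bar> > 0 \<and> int (nat \<bar>d\<bar>) \<in> J"
    using \<open>d \<noteq> 0\<close> by simp
  have g: "g > 0" "int g \<in> J"
    using LeastI[of "\<lambda>g. g > 0 \<and> int g \<in> J", OF ex] unfolding g_def by auto
  have least: "g \<le> h" if "h > 0" "int h \<in> J" for h
    unfolding g_def by (rule Least_le) (use that in simp)
  have dvd: "int g dvd a" if "a \<in> J" for a
  proof -
    have "a mod int g = a + (- (a div int g)) * int g"
      by (simp add: minus_div_mult_eq_mod[symmetric])
    also have "\<dots> \<in> J" by (rule J_add[OF that J_mult[OF g(2)]])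
    finally have "a mod int g \<in> J" .
    moreover have "0 \<le> a mod int g" "a mod int g < int g" using g(1) by auto
    ultimately have "a mod int g = 0"
      using least[of "nat (a mod int g)"] by (cases "a mod int g = 0") auto
    then show ?thesis by (simp add: dvd_eq_mod_eq_0)
  qed
  have "g = 1"
  proof (rule ccontr)
    assume "g \<noteq> 1"
    then obtain q where q: "prime q" "q dvd g" using prime_factor_nat by blast
    then have q': "prime (int q)" "int q dvd int g" by auto
    then obtain k where k: "d = int q * k" using dvd[OF dJ] by (meson dvdE dvd_trans)
    then have "k \<in> J" using assms(5)[OF q'(1) k] by (simp add: J_def)
    from dvd[OF this] q'(2) have "int q dvd k" by (meson dvd_trans)
    then have "int q ^ 2 dvd d" unfolding k power2_eq_square by (rule mult_dvd_mono[OF dvd_refl])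
    then have "int q dvd 1" using assms(1) unfolding squarefree_def by blast
    then show False using q'(1) not_prime_unit by blast
  qed
  with g(2) show ?thesis by (simp add: J_def)
qed

section \<open>Embeddings and the trace\<close>

lemma common_denominator:
  assumes "finite Q"
  shows "\<exists>m > 0. \<forall>q\<in>Q. \<exists>k. of_int m * (q :: rat) = of_int k"
  using assms
proof induction
  case (insert q Q)
  then obtain m where m: "m > 0" "\<forall>q\<in>Q. \<exists>k. of_int m * q = of_int k" by blast
  obtain a b where ab: "quotient_of q = (a, b)" by fastforce
  have b: "b > 0" "q = of_int a / of_int b"
    using quotient_of_denom_pos[OF ab] quotient_of_div[OF ab] by auto
  show ?case
  proof (rule exI[of _ "m * b"], rule conjI)
    show "m * b > 0" using m b by simp
    show "\<forall>r\<in>insert q Q. \<exists>k. of_int (m * b) * r = of_int k"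
    proof
    fix r assume "r \<in> insert q Q"
    then consider "r = q" | k where "of_int m * r = of_int k" using m(2) by blast
    then show "\<exists>k. of_int (m * b) * r = of_int k"
    proof cases
      case 1
      then show ?thesis using b by (intro exI[of _ "m * a"]) auto
    next
      case (2 k)
      then show ?thesis by (intro exI[of _ "k * b"]) (auto simp: mult_ac)
    qed
    qed
  qed
qed (auto intro: exI[of _ 1])

text \<open>If m clears the denominators of the products x * s, expanded in a finite rational
  spanning set, then m * x maps the \<int>-span of this set into itself.\<close>

lemma algebraic_int_multiple:
  fixes x :: "'k :: number_field"
  obtains m :: int where "m > 0" "algebraic_int (of_int m * x)"
proof -
  obtain B :: "'k set" where B: "finite B" "\<And>x. \<exists>c :: 'k \<Rightarrow> rat. x = (\<Sum>b\<in>B. of_rat (c b) * b)"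
    using finite_over_rat by blast
  obtain c :: "'k \<Rightarrow> 'k \<Rightarrow> rat" where c: "\<And>y. y = (\<Sum>b\<in>B. of_rat (c y b) * b)"
    using B(2) by metis
  obtain m where m: "m > 0" "\<And>q. q \<in> (\<lambda>(s, b). c (x * s) b) ` (B \<times> B) \<Longrightarrow> \<exists>k. of_int m * q = of_int k"
    using common_denominator[of "(\<lambda>(s, b). c (x * s) b) ` (B \<times> B)"] B(1) by (metis finite_cartesian_product finite_imageI)
  have "\<exists>s\<in>B. s \<noteq> 0"
  proof (rule ccontr)
    assume "\<not> ?thesis"
    then have "(1 :: 'k) = 0" using c[of 1] by (metis (mono_tags, lifting) mult_zero_right sum.neutral)
    then show False by simp
  qed
  then obtain s0 where "s0 \<in> B" "s0 \<noteq> 0" by blast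
  then have "algebraic_int (of_int m * x)"
  proof (rule algebraic_int_of_stable_module[OF B(1)])
    fix s assume s: "s \<in> B"
    have "\<exists>k. of_int m * c (x * s) b = of_int k" if "b \<in> B" for b
      using m(2) s that by auto
    then obtain k where k: "\<And>b. b \<in> B \<Longrightarrow> of_int m * c (x * s) b = of_int (k b)" by metis
    have "of_int m * x * s = (\<Sum>b\<in>B. of_int m * (of_rat (c (x * s) b) * b))"
      using arg_cong[OF c[of "x * s"], of "\<lambda>y. of_int m * y"] unfolding sum_distrib_left by (simp only: mult.assoc)
    also have "\<dots> = (\<Sum>b\<in>B. of_int (k b) * b)"
    proof (intro sum.cong refl)
      fix b assume "b \<in> B"
      then have "of_rat (of_int m * c (x * s) b) = (of_rat (of_int (k b)) :: 'k)" using k by simp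
      then have "of_int m * of_rat (c (x * s) b) = (of_int (k b) :: 'k)" by (simp only: of_rat_mult of_rat_of_int_eq)
      then show "of_int m * (of_rat (c (x * s) b) * b) = of_int (k b) * b" by (metis mult.assoc)
    qed
    also have "\<dots> \<in> zmod.span B" by (intro zmod.span_sum zmod.span_scale zmod.span_base)
    finally show "of_int m * x * s \<in> zmod.span B" .
  qed
  then show ?thesis using that m(1) by blast
qed

section \<open>Annihilating polynomials with simple complex roots\<close>

abbreviation rpoly :: "rat poly \<Rightarrow> 'a :: field_char_0 poly" where
  "rpoly \<equiv> map_poly of_rat"

lemma rpoly_mult: "rpoly (p * q) = (rpoly p * rpoly q :: 'a :: field_char_0 poly)"
proof -
  interpret R: map_poly_comm_ring_hom "of_rat :: rat \<Rightarrow> 'a" ..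
  show ?thesis by (rule R.hom_mult)
qed

lemma rpoly_add: "rpoly (p + q) = (rpoly p + rpoly q :: 'a :: field_char_0 poly)"
proof -
  interpret R: map_poly_comm_ring_hom "of_rat :: rat \<Rightarrow> 'a" ..
  show ?thesis by (rule R.hom_add)
qed

text \<open>The monic equation of an integral multiple m * x, with m times the variable
  substituted.\<close>

lemma annihilating_polynomial:
  fixes x :: "'k :: number_field"
  shows "\<exists>p. p \<noteq> 0 \<and> poly (rpoly p) x = 0"
proof -
  obtain m :: int where m: "m > 0" "algebraic_int (of_int m * x)"
    by (rule algebraic_int_multiple)
  then obtain p where p: "poly (map_poly of_int p) (of_int m * x) = 0" "lead_coeff p = 1"
    unfolding algebraic_int_altdef_ipoly by blast
  define q where "q = map_poly (of_int :: int \<Rightarrow> rat) p"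
  have rq: "rpoly q = (map_poly of_int p :: 'k poly)"
    unfolding q_def by (subst map_poly_map_poly) (auto simp: o_def)
  have rp: "rpoly [:a:] = ([:of_rat a:] :: 'k poly)" "rpoly [:0, a:] = ([:0, of_rat a:] :: 'k poly)" for a
    by (rule poly_eqI, simp add: coeff_map_poly coeff_pCons split: nat.splits)+
  have eval: "poly (rpoly (pcompose q [:0, of_int m:])) x = poly (rpoly q) (of_int m * x)"
  proof (induction q)
    case (pCons a q)
    then show ?case
      unfolding pcompose_pCons rpoly_add rpoly_mult poly_add poly_mult rp by (simp add: map_poly_pCons)
  qed simp
  have "coeff q (degree p) = 1" using p(2) by (simp add: q_def coeff_map_poly)
  then have "q \<noteq> 0" by auto
  moreover have "pcompose q [:0, of_int m:] = 0 \<longleftrightarrow> q = 0"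
    using m(1) by (intro pcompose_eq_0_iff) auto
  ultimately show ?thesis using eval p(1) rq by (metis)
qed

text \<open>Let p be an annihilator of least degree and g the gcd of p and its derivative. By
  minimality g does not vanish at x, so p / g does, and minimality again makes g constant. A Bezout
  identity then excludes a common complex root of p and its derivative.\<close>

lemma simple_rooted_annihilator:
  fixes x :: "'k :: number_field"
  obtains p where "p \<noteq> 0" "poly (rpoly p) x = 0" "rsquarefree (rpoly p :: complex poly)"
proof -
  define Q where "Q p \<longleftrightarrow> p \<noteq> 0 \<and> poly (rpoly p) x = 0" for p
  obtain p where p: "Q p" and least: "\<And>q. Q q \<Longrightarrow> degree p \<le> degree q"
    using ex_has_least_nat[of Q _ degree] annihilating_polynomial[of x] unfolding Q_def by blast
  have "degree p > 0"
  proof (rule ccontr)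
    assume "\<not> ?thesis"
    then obtain c where "p = [:c:]" by (auto elim: degree_eq_zeroE)
    then show False using p by (auto simp: Q_def map_poly_pCons)
  qed
  then have dp: "pderiv p \<noteq> 0" "degree (pderiv p) < degree p"
    by (auto simp: pderiv_eq_0_iff degree_pderiv)
  define g where "g = gcd p (pderiv p)"
  obtain h where h: "p = g * h" unfolding g_def by (meson dvdE gcd_dvd1)
  have nz: "g \<noteq> 0" "h \<noteq> 0" using h p by (auto simp: Q_def)
  have "degree g < degree p"
    using dp by (metis g_def dvd_imp_degree_le gcd_dvd2 le_less_trans)
  then have "\<not> Q g" using least leD by blast
  then have "poly (rpoly h) x = 0"
    using p nz unfolding Q_def h by (auto simp: rpoly_mult)
  then have "degree p \<le> degree h" using least nz unfolding Q_def by blast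
  then have "degree g = 0" using nz unfolding h by (simp add: degree_mult_eq)
  then obtain c where c: "g = [:c:]" by (auto elim: degree_eq_zeroE)
  obtain a b where ab: "a * p + b * pderiv p = g"
    using bezout_coefficients_fst_snd[of p "pderiv p"] unfolding g_def by metis
  have "rsquarefree (rpoly p :: complex poly)"
    unfolding rsquarefree_roots
  proof (intro allI notI)
    fix z :: complex
    assume z: "poly (rpoly p) z = 0 \<and> poly (pderiv (rpoly p)) z = 0"
    have "pderiv (rpoly p :: complex poly) = rpoly (pderiv p)"
      by (intro poly_eqI) (simp add: coeff_pderiv coeff_map_poly of_rat_mult of_rat_add)
    then have "poly (rpoly g) z = 0"
      using z unfolding ab[symmetric] by (simp add: rpoly_add rpoly_mult)
    then show False using c nz by (simp add: map_poly_pCons)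
  qed
  then show ?thesis using that p by (auto simp: Q_def)
qed

text \<open>The codomain stays open: it is complex while embeddings are counted and real once the
  field is totally real.\<close>

definition field_emb :: "('k :: number_field \<Rightarrow> 'a :: field_char_0) \<Rightarrow> bool" where
  "field_emb \<sigma> \<longleftrightarrow> \<sigma> 1 = 1 \<and> (\<forall>x y. \<sigma> (x + y) = \<sigma> x + \<sigma> y) \<and> (\<forall>x y. \<sigma> (x * y) = \<sigma> x * \<sigma> y)"

context
  fixes \<sigma> :: "'k :: number_field \<Rightarrow> 'a :: field_char_0"
  assumes \<sigma>: "field_emb \<sigma>"
begin

lemma field_emb_one: "\<sigma> 1 = 1"
  and field_emb_add: "\<sigma> (x + y) = \<sigma> x + \<sigma> y"
  and field_emb_mult: "\<sigma> (x * y) = \<sigma> x * \<sigma> y"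
  using \<sigma> by (auto simp: field_emb_def)

lemma field_emb_zero: "\<sigma> 0 = 0"
  using field_emb_add[of 0 0] by simp

lemma field_emb_minus: "\<sigma> (- x) = - \<sigma> x"
  using field_emb_add[of x "- x"] by (simp add: field_emb_zero eq_neg_iff_add_eq_0 add.commute)

lemma field_emb_diff: "\<sigma> (x - y) = \<sigma> x - \<sigma> y"
  using field_emb_add[of x "- y"] by (simp add: field_emb_minus)

lemma field_emb_sum: "\<sigma> (sum f I) = (\<Sum>i\<in>I. \<sigma> (f i))"
  by (induction I rule: infinite_finite_induct) (auto simp: field_emb_zero field_emb_add)

lemma field_emb_of_int: "\<sigma> (of_int k) = of_int k"
proof -
  have nat: "\<sigma> (of_nat m) = of_nat m" for m
    by (induction m) (auto simp: field_emb_zero field_emb_one field_emb_add)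
  show ?thesis by (cases k rule: int_cases2) (auto simp: nat field_emb_minus)
qed

lemma field_emb_of_rat: "\<sigma> (of_rat q) = of_rat q"
proof -
  obtain a b where ab: "quotient_of q = (a, b)" by fastforce
  have b: "b > 0" "q = of_int a / of_int b"
    using quotient_of_denom_pos[OF ab] quotient_of_div[OF ab] by auto
  have "\<sigma> (of_rat q) * \<sigma> (of_int b) = \<sigma> (of_int a)"
    unfolding field_emb_mult[symmetric] using b by (simp add: of_rat_divide)
  then have "\<sigma> (of_rat q) = of_int a / of_int b"
    using b(1) by (simp add: field_emb_of_int nonzero_eq_divide_eq)
  then show ?thesis using b by (simp add: of_rat_divide)
qed

lemma field_emb_eq_iff: "\<sigma> x = \<sigma> y \<longleftrightarrow> x = y"
proof
  assume "\<sigma> x = \<sigma> y"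
  then have 0: "\<sigma> (x - y) = 0" by (simp add: field_emb_diff)
  show "x = y"
  proof (rule ccontr)
    assume "x \<noteq> y"
    then have "\<sigma> (x - y) * \<sigma> (inverse (x - y)) = 1"
      unfolding field_emb_mult[symmetric] by (simp add: field_emb_one)
    then show False by (simp add: 0)
  qed
qed simp

lemma field_emb_algebraic_int_iff: "algebraic_int (\<sigma> x) \<longleftrightarrow> algebraic_int x"
proof -
  have "\<sigma> (poly (map_poly of_int p) x) = poly (map_poly of_int p) (\<sigma> x)" for p
    by (induction p) (auto simp: field_emb_zero field_emb_add field_emb_mult field_emb_of_int map_poly_pCons)
  then show ?thesis
    unfolding algebraic_int_altdef_ipoly by (metis field_emb_eq_iff field_emb_zero)
qed

end

text \<open>Artin's elimination: the relation at z * x minus \<tau> z times the relation at x loses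
  its \<tau> term. It keeps a nonzero multiple of the coefficient of \<sigma> because z separates
  \<sigma> from \<tau>.\<close>

lemma dedekind_independence:
  assumes "finite S" "\<And>\<sigma>. \<sigma> \<in> S \<Longrightarrow> field_emb \<sigma>" "\<And>x. (\<Sum>\<sigma>\<in>S. a \<sigma> * \<sigma> x) = 0" "\<sigma> \<in> S"
  shows "a \<sigma> = 0"
  using assms
proof (induction S arbitrary: a \<sigma> rule: finite_induct)
  case (insert \<tau> S)
  have eq: "a \<tau> * \<tau> x + (\<Sum>\<sigma>\<in>S. a \<sigma> * \<sigma> x) = 0" for x
    using insert.prems(2)[of x] insert.hyps by simp
  have 1: "a \<sigma> = 0" if "\<sigma> \<in> S" for \<sigma>
  proof -
    from that insert.hyps have "\<sigma> \<noteq> \<tau>" by auto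
    then obtain z where z: "\<sigma> z \<noteq> \<tau> z" by blast
    have "(\<Sum>\<sigma>\<in>S. (a \<sigma> * (\<sigma> z - \<tau> z)) * \<sigma> x) = 0" for x
    proof -
      have "(\<Sum>\<sigma>\<in>S. (a \<sigma> * (\<sigma> z - \<tau> z)) * \<sigma> x) = (\<Sum>\<sigma>\<in>S. a \<sigma> * \<sigma> (z * x)) - \<tau> z * (\<Sum>\<sigma>\<in>S. a \<sigma> * \<sigma> x)"
        unfolding sum_distrib_left sum_subtractf[symmetric]
        by (intro sum.cong refl) (use insert.prems(1) in \<open>auto simp: field_emb_def algebra_simps\<close>)
      also have "\<dots> = (a \<tau> * \<tau> (z * x) + (\<Sum>\<sigma>\<in>S. a \<sigma> * \<sigma> (z * x))) - \<tau> z * (a \<tau> * \<tau> x + (\<Sum>\<sigma>\<in>S. a \<sigma> * \<sigma> x))"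
        using insert.prems(1)[of \<tau>] by (simp add: field_emb_def algebra_simps)
      finally show ?thesis by (simp add: eq)
    qed
    from insert.IH[OF _ this that] insert.prems(1) z show ?thesis by simp
  qed
  have "a \<tau> = 0"
    using eq[of 1] 1 insert.prems(1)[of \<tau>] by (simp add: field_emb_def)
  with 1 insert.prems(3) show ?case by auto
qed simp

section \<open>Rational-linear functionals as combinations of embeddings\<close>

interpretation cfun: vector_space "\<lambda>(c :: complex) (f :: 'a \<Rightarrow> complex) x. c * f x"
  by unfold_locales (auto simp: fun_eq_iff algebra_simps)

text \<open>Common eigenvectors, among the \<rat>-linear functionals, of the operators dual to
  multiplication by the elements of U. For empty U these are all \<rat>-linear functionals.\<close>

definition eigenfuns :: "'k :: number_field set \<Rightarrow> ('k \<Rightarrow> complex) set" where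
  "eigenfuns U = {\<psi>. (\<forall>x y. \<psi> (x + y) = \<psi> x + \<psi> y) \<and> (\<forall>q x. \<psi> (of_rat q * x) = of_rat q * \<psi> x) \<and>
     (\<forall>x\<in>U. \<exists>c. \<forall>y. \<psi> (x * y) = c * \<psi> y)}"

lemma eigenfuns_sum:
  assumes "\<psi> \<in> eigenfuns U"
  shows "\<psi> (\<Sum>i\<in>I. of_rat (q i) * f i) = (\<Sum>i\<in>I. of_rat (q i) * \<psi> (f i))"
proof -
  have "\<psi> 0 = 0" using assms unfolding eigenfuns_def by (metis (mono_tags, lifting) add_cancel_right_right mem_Collect_eq)
  then show ?thesis
    using assms by (induction I rule: infinite_finite_induct) (auto simp: eigenfuns_def)
qed

text \<open>The polynomial q evaluated at the operator dual to multiplication by x, applied to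
  \<phi>. It is written out coefficientwise because complex scalars act on the functionals and not
  on the field.\<close>

definition polyact :: "'k :: number_field \<Rightarrow> complex poly \<Rightarrow> ('k \<Rightarrow> complex) \<Rightarrow> 'k \<Rightarrow> complex" where
  "polyact x q \<phi> y = (\<Sum>i\<le>degree q. coeff q i * \<phi> (x ^ i * y))"

lemma polyact_eq:
  assumes "degree q \<le> N"
  shows "polyact x q \<phi> y = (\<Sum>i\<le>N. coeff q i * \<phi> (x ^ i * y))"
  unfolding polyact_def by (rule sum.mono_neutral_left) (use assms in \<open>auto simp: coeff_eq_0\<close>)

lemma polyact_add: "polyact x (p + q) \<phi> y = polyact x p \<phi> y + polyact x q \<phi> y"
proof -
  let ?N = "max (degree p) (degree q)"
  have "polyact x (p + q) \<phi> y = (\<Sum>i\<le>?N. coeff (p + q) i * \<phi> (x ^ i * y))"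
    by (rule polyact_eq) (rule degree_add_le_max)
  also have "\<dots> = (\<Sum>i\<le>?N. coeff p i * \<phi> (x ^ i * y)) + (\<Sum>i\<le>?N. coeff q i * \<phi> (x ^ i * y))"
    by (simp add: distrib_right sum.distrib)
  finally show ?thesis by (simp add: polyact_eq[of _ ?N])
qed

lemma polyact_smult: "polyact x (smult c p) \<phi> y = c * polyact x p \<phi> y"
  by (subst polyact_eq[of _ "degree p"]) (auto simp: polyact_def sum_distrib_left mult.assoc)

lemma polyact_sum: "polyact x (\<Sum>i\<in>I. f i) \<phi> y = (\<Sum>i\<in>I. polyact x (f i) \<phi> y)"
  by (induction I rule: infinite_finite_induct) (auto simp: polyact_add, simp_all add: polyact_def)

lemma polyact_linear_factor:
  "polyact x ([:- a, 1:] * q) \<phi> y = polyact x q \<phi> (x * y) - a * polyact x q \<phi> y"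
proof -
  have "[:- a, 1:] * q = pCons 0 q + smult (- a) q" by simp
  moreover have "polyact x (pCons 0 q) \<phi> y = polyact x q \<phi> (x * y)"
    by (subst polyact_eq[of _ "Suc (degree q)"])
       (auto simp: degree_pCons_le sum.atMost_Suc_shift polyact_def mult_ac simp del: sum.atMost_Suc)
  ultimately show ?thesis by (simp only: polyact_add polyact_smult) simp
qed

lemma polyact_eigenfuns:
  assumes "\<phi> \<in> eigenfuns U"
  shows "polyact x q \<phi> \<in> eigenfuns U"
proof -
  have 1: "polyact x q \<phi> (y + z) = polyact x q \<phi> y + polyact x q \<phi> z" for y z
    using assms by (simp add: polyact_def eigenfuns_def distrib_left sum.distrib)
  have 2: "polyact x q \<phi> (of_rat r * y) = of_rat r * polyact x q \<phi> y" for r y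
    using assms by (simp add: polyact_def eigenfuns_def sum_distrib_left mult.left_commute[of _ "of_rat r"])
  have 3: "\<exists>c. \<forall>y. polyact x q \<phi> (u * y) = c * polyact x q \<phi> y" if "u \<in> U" for u
  proof -
    from assms that have "\<exists>c. \<forall>y. \<phi> (u * y) = c * \<phi> y" by (auto simp: eigenfuns_def)
    then obtain c where "\<And>y. \<phi> (u * y) = c * \<phi> y" by blast
    then have "polyact x q \<phi> (u * y) = c * polyact x q \<phi> y" for y
      by (simp add: polyact_def sum_distrib_left mult.left_commute[of _ u] mult.left_commute[of _ c])
    then show ?thesis by blast
  qed
  show ?thesis using 1 2 3 by (auto simp: eigenfuns_def)
qed

lemma sum_fun_apply: "sum f I x = (\<Sum>i\<in>I. f i x)" for f :: "'i \<Rightarrow> 'a \<Rightarrow> 'b :: comm_monoid_add"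
  by (induction I rule: infinite_finite_induct) auto

text \<open>Multiplication by \<open>x\<close> acts on the functionals \<open>\<phi>\<close> and is annihilated by a polynomial with
  simple complex roots, so Lagrange interpolation splits \<open>\<phi>\<close> into eigenvectors. A common eigenvector
  of all elements of the field is a multiple of an embedding.\<close>

lemma eigenfuns_decompose:
  assumes "\<phi> \<in> eigenfuns U"
  shows "\<phi> \<in> cfun.span (eigenfuns (insert x U))"
proof -
  obtain p where p: "p \<noteq> 0" "poly (rpoly p) x = 0" "rsquarefree (rpoly p :: complex poly)"
    by (rule simple_rooted_annihilator)
  define P where "P = (rpoly p :: complex poly)"
  define Z where "Z = {z. poly P z = 0}"
  \<comment> \<open>The cofactor of the linear factor at a: applied to \<phi> it gives an
    eigenvector with eigenvalue a.\<close>
  define q where "q a = (\<Prod>z\<in>Z - {a}. [:- z, 1:])" for a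
  have "P \<noteq> 0" using p(1) by (simp add: P_def)
  then have Z: "finite Z" by (simp add: Z_def poly_roots_finite)
  have degP: "degree P > 0"
  proof (rule ccontr)
    assume "\<not> ?thesis"
    then have "degree p = 0" by (simp add: P_def)
    then obtain c where "p = [:c:]" by (auto elim: degree_eq_zeroE)
    then show False using p by (auto simp: map_poly_pCons)
  qed
  have Zne: "Z \<noteq> {}"
    using fundamental_theorem_of_algebra[of P] degP by (auto simp: Z_def constant_degree)
  have P: "P = smult (lead_coeff P) (\<Prod>z\<in>Z. [:- z, 1:])"
    using complex_poly_decompose_rsquarefree[of P] p(3) by (simp add: P_def Z_def)
  have actP: "polyact x P \<phi> y = 0" for y
  proof -
    have "polyact x P \<phi> y = (\<Sum>i\<le>degree p. of_rat (coeff p i) * \<phi> (x ^ i * y))"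
      by (simp add: polyact_def P_def coeff_map_poly)
    also have "\<dots> = \<phi> (\<Sum>i\<le>degree p. of_rat (coeff p i) * (x ^ i * y))"
      by (rule eigenfuns_sum[OF assms, symmetric])
    also have "(\<Sum>i\<le>degree p. of_rat (coeff p i) * (x ^ i * y)) = poly (rpoly p) x * y"
      by (simp add: poly_altdef sum_distrib_right mult.assoc coeff_map_poly)
    also have "\<phi> \<dots> = 0" using eigenfuns_sum[OF assms, of undefined undefined "{}"] p(2) by simp
    finally show ?thesis .
  qed
  have eig: "polyact x (q a) \<phi> \<in> eigenfuns (insert x U)" if "a \<in> Z" for a
  proof -
    have "P = smult (lead_coeff P) ([:- a, 1:] * q a)"
      using P Z that by (simp add: q_def prod.remove)
    then have "lead_coeff P * polyact x ([:- a, 1:] * q a) \<phi> y = 0" for y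
      using actP[of y] polyact_smult by metis
    then have "polyact x ([:- a, 1:] * q a) \<phi> y = 0" for y using \<open>P \<noteq> 0\<close> by simp
    then have "polyact x (q a) \<phi> (x * y) = a * polyact x (q a) \<phi> y" for y
      unfolding polyact_linear_factor by simp
    moreover have "polyact x (q a) \<phi> \<in> eigenfuns U" by (rule polyact_eigenfuns[OF assms])
    ultimately show ?thesis by (auto simp: eigenfuns_def)
  qed
  have qz: "poly (q a) z = (\<Prod>w\<in>Z - {a}. z - w)" for a z
    by (simp add: q_def poly_prod algebra_simps)
  have deg: "degree (q a) < card Z" if "a \<in> Z" for a
  proof -
    have "degree (q a) = card (Z - {a})" unfolding q_def by (subst degree_prod_eq_sum_degree) auto
    then show ?thesis using Z that by (metis card_Diff1_less)
  qed
  \<comment> \<open>Lagrange interpolation of the constant 1 at the roots; it is exact because both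
    degrees are below the number of roots.\<close>
  define L where "L = (\<Sum>a\<in>Z. smult (1 / poly (q a) a) (q a))"
  have "L = 1"
  proof (rule poly_eqI_degree[of Z])
    fix z assume z: "z \<in> Z"
    have "poly L z = (\<Sum>a\<in>Z. if a = z then 1 else 0)"
      unfolding L_def poly_sum
    proof (intro sum.cong refl)
      fix a assume a: "a \<in> Z"
      show "poly (smult (1 / poly (q a) a) (q a)) z = (if a = z then 1 else 0)"
        using z a Z by (auto simp: qz)
    qed
    then show "poly L z = poly 1 z" using z Z by simp
  next
    show "degree L < card Z"
      unfolding L_def using Zne Z deg by (intro degree_sum_less) (auto simp: card_gt_0_iff)
    show "degree (1 :: complex poly) < card Z" using Zne Z by (simp add: card_gt_0_iff)
  qed
  have "\<phi> = (\<lambda>y. polyact x L \<phi> y)" by (simp add: \<open>L = 1\<close> polyact_def)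
  also have "\<dots> = (\<Sum>a\<in>Z. (\<lambda>y. (1 / poly (q a) a) * polyact x (q a) \<phi> y))"
    by (simp add: L_def polyact_sum polyact_smult fun_eq_iff sum_fun_apply)
  also have "\<dots> \<in> cfun.span (eigenfuns (insert x U))"
    by (intro cfun.span_sum cfun.span_scale cfun.span_base eig)
  finally show ?thesis .
qed

text \<open>Splitting once for each member of a finite spanning set leaves functionals \<psi> that
  are eigenvectors for multiplication by the whole field. The eigenvalue as a function of x is
  \<psi> / \<psi> 1, and it is an embedding; if \<psi> 1 = 0, then \<psi> = 0.\<close>

lemma linear_functional_in_span_homs:
  fixes \<phi> :: "'k :: number_field \<Rightarrow> complex"
  assumes "\<phi> \<in> eigenfuns {}"
  shows "\<phi> \<in> cfun.span {\<sigma>. field_emb \<sigma>}"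
proof -
  obtain B :: "'k set" where B: "finite B" "\<And>x. \<exists>c :: 'k \<Rightarrow> rat. x = (\<Sum>b\<in>B. of_rat (c b) * b)"
    using finite_over_rat by blast
  from B(1) have "\<phi> \<in> cfun.span (eigenfuns B)"
  proof induction
    case empty
    show ?case using assms by (rule cfun.span_base)
  next
    case (insert x U)
    have "cfun.span (eigenfuns U) \<subseteq> cfun.span (eigenfuns (insert x U))"
      by (intro cfun.span_minimal cfun.subspace_span subsetI eigenfuns_decompose)
    with insert.IH show ?case by blast
  qed
  moreover have "eigenfuns B \<subseteq> cfun.span {\<sigma>. field_emb \<sigma>}"
  proof
    fix \<psi> assume \<psi>: "\<psi> \<in> eigenfuns B"
    then have "\<forall>b\<in>B. \<exists>c. \<forall>y. \<psi> (b * y) = c * \<psi> y" by (simp add: eigenfuns_def)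
    then obtain l where l: "\<And>b y. b \<in> B \<Longrightarrow> \<psi> (b * y) = l b * \<psi> y" by metis
    have "\<exists>c. \<forall>y. \<psi> (x * y) = c * \<psi> y" for x
    proof -
      obtain c where c: "x = (\<Sum>b\<in>B. of_rat (c b) * b)" using B(2) by blast
      have "\<psi> (x * y) = (\<Sum>b\<in>B. of_rat (c b) * l b) * \<psi> y" for y
      proof -
        have "\<psi> (x * y) = \<psi> (\<Sum>b\<in>B. of_rat (c b) * (b * y))" by (simp add: c sum_distrib_right mult.assoc)
        also have "\<dots> = (\<Sum>b\<in>B. of_rat (c b) * \<psi> (b * y))" by (rule eigenfuns_sum[OF \<psi>])
        finally show ?thesis by (simp add: l sum_distrib_right mult.assoc)
      qed
      then show ?thesis by blast
    qed
    then obtain \<mu> where \<mu>: "\<And>x y. \<psi> (x * y) = \<mu> x * \<psi> y" by metis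
    show "\<psi> \<in> cfun.span {\<sigma>. field_emb \<sigma>}"
    proof (cases "\<psi> 1 = 0")
      case True
      then have "\<psi> = 0" using \<mu>[of _ 1] by (auto simp: fun_eq_iff)
      then show ?thesis by (simp add: cfun.span_zero)
    next
      case False
      have \<mu>': "\<mu> x = \<psi> x / \<psi> 1" for x using \<mu>[of x 1] False by simp
      have "field_emb \<mu>"
        unfolding field_emb_def
      proof (intro conjI allI)
        show "\<mu> 1 = 1" using False by (simp add: \<mu>')
        show "\<mu> (x + y) = \<mu> x + \<mu> y" for x y
          using \<psi> by (simp add: \<mu>' eigenfuns_def add_divide_distrib)
        show "\<mu> (x * y) = \<mu> x * \<mu> y" for x y
          by (metis \<mu> \<mu>' times_divide_eq_right)
      qed
      then have "(\<lambda>x. \<psi> 1 * \<mu> x) \<in> cfun.span {\<sigma>. field_emb \<sigma>}"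
        by (intro cfun.span_scale cfun.span_base) simp
      also have "(\<lambda>x. \<psi> 1 * \<mu> x) = \<psi>" using False by (simp add: \<mu>')
      finally show ?thesis .
    qed
  qed
  then have "cfun.span (eigenfuns B) \<subseteq> cfun.span {\<sigma>. field_emb \<sigma>}"
    by (intro cfun.span_minimal) auto
  ultimately show ?thesis by blast
qed

section \<open>The number of embeddings and the trace as a sum over them\<close>

lemma rat_basis_exists: "\<exists>B :: 'k :: number_field set. rat_basis B"
  using rat_vs.basis_exists[of UNIV] unfolding rat_basis_def
  by (metis UNIV_I top.extremum_uniqueI subset_antisym)

lemma rat_basis_finite:
  assumes "rat_basis (B :: 'k :: number_field set)"
  shows "finite B" "card B = field_degree TYPE('k)"
proof -
  obtain B0 :: "'k set" where B0: "finite B0" "\<And>x. \<exists>c :: 'k \<Rightarrow> rat. x = (\<Sum>b\<in>B0. of_rat (c b) * b)"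
    using finite_over_rat by blast
  have "UNIV \<subseteq> rat_span B0"
  proof
    fix x :: 'k
    obtain c where "x = (\<Sum>b\<in>B0. of_rat (c b) * b)" using B0(2) by blast
    moreover have "(\<Sum>b\<in>B0. of_rat (c b) * b) \<in> rat_span B0"
      by (intro rat_vs.span_sum rat_vs.span_scale rat_vs.span_base)
    ultimately show "x \<in> rat_span B0" by simp
  qed
  then show "finite B"
    using rat_vs.independent_span_bound[OF B0(1), of B] assms by (auto simp: rat_basis_def)
  show "card B = field_degree TYPE('k)"
    unfolding field_degree_def using rat_vs.basis_card_eq_dim[of B UNIV] assms by (auto simp: rat_basis_def)
qed

text \<open>The coordinate functionals of a rational basis B are combinations of finitely many
  embeddings, collected in S. By Dedekind independence S contains all embeddings, and the
  coefficients c form the inverse of the matrix of values of the embeddings on B. This turns the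
  matrix trace into the sum over embeddings, and the trace of 1 compares the two
  cardinalities.\<close>

theorem
  shows finite_field_embs: "finite {\<sigma> :: 'k :: number_field \<Rightarrow> complex. field_emb \<sigma>}"
    and card_field_embs: "card {\<sigma> :: 'k \<Rightarrow> complex. field_emb \<sigma>} = field_degree TYPE('k)"
    and field_trace_eq_sum_homs: "of_rat (field_trace x) = (\<Sum>\<sigma> | field_emb \<sigma>. \<sigma> (x :: 'k) :: complex)"
proof -
  define B where "B = (SOME B :: 'k set. rat_basis B)"
  obtain B' :: "'k set" where "rat_basis B'" using rat_basis_exists by blast
  then have B: "rat_basis B" unfolding B_def by (rule someI)
  note fin = rat_basis_finite[OF B]
  define \<phi> where "\<phi> b x = (of_rat (rat_representation B x b) :: complex)" for b x
  have indep: "\<not> rat_dependent B" and span: "\<And>x. x \<in> rat_span B" using B by (auto simp: rat_basis_def)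
  have "\<phi> b \<in> eigenfuns {}" for b
    unfolding eigenfuns_def \<phi>_def
    by (auto simp: rat_vs.representation_add[OF indep span span] rat_vs.representation_scale[OF indep span]
        of_rat_add of_rat_mult)
  then have "\<phi> b \<in> cfun.span {\<sigma>. field_emb \<sigma>}" for b by (rule linear_functional_in_span_homs)
  then have "\<exists>S c. finite S \<and> S \<subseteq> {\<sigma>. field_emb \<sigma>} \<and> \<phi> b = (\<Sum>\<sigma>\<in>S. (\<lambda>x. c \<sigma> * \<sigma> x))" for b
    unfolding cfun.span_explicit by fastforce
  then have "\<forall>b. \<exists>S c. finite S \<and> S \<subseteq> {\<sigma>. field_emb \<sigma>} \<and> \<phi> b = (\<Sum>\<sigma>\<in>S. (\<lambda>x. c \<sigma> * \<sigma> x))" by blast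
  from choice[OF this] obtain S0
    where "\<forall>b. \<exists>c. finite (S0 b) \<and> S0 b \<subseteq> {\<sigma>. field_emb \<sigma>} \<and> \<phi> b = (\<Sum>\<sigma>\<in>S0 b. (\<lambda>x. c \<sigma> * \<sigma> x))"
    by blast
  from choice[OF this] obtain c0
    where "\<forall>b. finite (S0 b) \<and> S0 b \<subseteq> {\<sigma>. field_emb \<sigma>} \<and> \<phi> b = (\<Sum>\<sigma>\<in>S0 b. (\<lambda>x. c0 b \<sigma> * \<sigma> x))"
    by blast
  then have S0: "\<And>b. finite (S0 b)" "\<And>b. S0 b \<subseteq> {\<sigma>. field_emb \<sigma>}"
    "\<And>b. \<phi> b = (\<Sum>\<sigma>\<in>S0 b. (\<lambda>x. c0 b \<sigma> * \<sigma> x))" by blast+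
  define S where "S = (\<Union>b\<in>B. S0 b)"
  define c where "c b \<sigma> = (if \<sigma> \<in> S0 b then c0 b \<sigma> else 0)" for b \<sigma>
  have S: "finite S" "S \<subseteq> {\<sigma>. field_emb \<sigma>}" using S0 fin by (auto simp: S_def)
  have \<phi>: "\<phi> b x = (\<Sum>\<sigma>\<in>S. c b \<sigma> * \<sigma> x)" if "b \<in> B" for b x
  proof -
    have "\<phi> b x = (\<Sum>\<sigma>\<in>S0 b. c0 b \<sigma> * \<sigma> x)" by (simp add: S0(3) sum_fun_apply)
    also have "\<dots> = (\<Sum>\<sigma>\<in>S. c b \<sigma> * \<sigma> x)"
      by (rule sum.mono_neutral_cong_left) (use S that in \<open>auto simp: c_def S_def\<close>)
    finally show ?thesis .
  qed
  have hom_expand: "\<tau> x = (\<Sum>\<sigma>\<in>S. (\<Sum>b\<in>B. c b \<sigma> * \<tau> b) * \<sigma> x)" if "field_emb \<tau>" for \<tau> x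
  proof -
    have "x = (\<Sum>b\<in>B. of_rat (rat_representation B x b) * b)"
      using rat_vs.sum_representation_eq[OF indep span fin(1) order_refl, of x] by simp
    moreover have "\<tau> (\<Sum>b\<in>B. of_rat (rat_representation B x b) * b) = (\<Sum>b\<in>B. \<phi> b x * \<tau> b)"
      by (simp add: field_emb_sum[OF that] field_emb_mult[OF that] field_emb_of_rat[OF that] \<phi>_def)
    ultimately have "\<tau> x = (\<Sum>b\<in>B. \<phi> b x * \<tau> b)" by metis
    also have "\<dots> = (\<Sum>b\<in>B. \<Sum>\<sigma>\<in>S. c b \<sigma> * \<tau> b * \<sigma> x)"
      by (intro sum.cong refl) (simp add: \<phi> sum_distrib_left mult_ac)
    also have "\<dots> = (\<Sum>\<sigma>\<in>S. \<Sum>b\<in>B. c b \<sigma> * \<tau> b * \<sigma> x)" by (rule sum.swap)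
    finally show ?thesis by (simp add: sum_distrib_right)
  qed
  have "\<tau> \<in> S" if "field_emb \<tau>" for \<tau>
  proof (rule ccontr)
    assume "\<tau> \<notin> S"
    \<comment> \<open>An embedding outside S would enter a vanishing relation with coefficient
      -1.\<close>
    define a where "a \<sigma> = (if \<sigma> = \<tau> then -1 else (\<Sum>b\<in>B. c b \<sigma> * \<tau> b))" for \<sigma>
    have "(\<Sum>\<sigma>\<in>insert \<tau> S. a \<sigma> * \<sigma> x) = 0" for x
    proof -
      have "(\<Sum>\<sigma>\<in>S. a \<sigma> * \<sigma> x) = (\<Sum>\<sigma>\<in>S. (\<Sum>b\<in>B. c b \<sigma> * \<tau> b) * \<sigma> x)"
        using \<open>\<tau> \<notin> S\<close> by (intro sum.cong) (auto simp: a_def)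
      then show ?thesis using hom_expand[OF that, of x] \<open>\<tau> \<notin> S\<close> S(1) by (simp add: a_def)
    qed
    from dedekind_independence[OF _ _ this, of \<tau>] S that have "a \<tau> = 0" by auto
    then show False by (simp add: a_def)
  qed
  with S have Seq: "{\<sigma>. field_emb \<sigma>} = S" by auto
  with S show "finite {\<sigma> :: 'k \<Rightarrow> complex. field_emb \<sigma>}" by simp
  have delta: "(\<Sum>b\<in>B. c b \<sigma> * \<tau> b) = (if \<sigma> = \<tau> then 1 else 0)" if "\<sigma> \<in> S" "\<tau> \<in> S" for \<sigma> \<tau>
  proof -
    define a where "a \<sigma> = (\<Sum>b\<in>B. c b \<sigma> * \<tau> b) - (if \<sigma> = \<tau> then 1 else 0)" for \<sigma>
    have "(\<Sum>\<sigma>\<in>S. a \<sigma> * \<sigma> x) = 0" for x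
    proof -
      have "(\<Sum>\<sigma>\<in>S. a \<sigma> * \<sigma> x) = (\<Sum>\<sigma>\<in>S. (\<Sum>b\<in>B. c b \<sigma> * \<tau> b) * \<sigma> x) - (\<Sum>\<sigma>\<in>S. if \<sigma> = \<tau> then \<sigma> x else 0)"
        unfolding sum_subtractf[symmetric] by (intro sum.cong) (auto simp: a_def left_diff_distrib)
      then show ?thesis using hom_expand[of \<tau> x] that S by auto
    qed
    from dedekind_independence[OF S(1) _ this that(1)] S(2) have "a \<sigma> = 0" by blast
    then show ?thesis by (simp add: a_def)
  qed
  have trace: "(\<Sum>b\<in>B. \<phi> b (x * b)) = (\<Sum>\<sigma>\<in>S. \<sigma> x)" for x
  proof -
    have "(\<Sum>b\<in>B. \<phi> b (x * b)) = (\<Sum>b\<in>B. \<Sum>\<sigma>\<in>S. \<sigma> x * (c b \<sigma> * \<sigma> b))"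
      using S(2) by (intro sum.cong refl) (auto simp: \<phi> field_emb_def mult_ac intro!: sum.cong)
    also have "\<dots> = (\<Sum>\<sigma>\<in>S. \<sigma> x * (\<Sum>b\<in>B. c b \<sigma> * \<sigma> b))"
      by (subst sum.swap) (simp add: sum_distrib_left)
    also have "\<dots> = (\<Sum>\<sigma>\<in>S. \<sigma> x)" by (intro sum.cong refl) (simp add: delta)
    finally show ?thesis .
  qed
  show "of_rat (field_trace x) = (\<Sum>\<sigma> | field_emb \<sigma>. \<sigma> (x :: 'k) :: complex)"
    using trace[of x] unfolding Seq field_trace_def Let_def B_def[symmetric] by (simp add: \<phi>_def of_rat_sum)
  have "(\<Sum>b\<in>B. \<phi> b (1 * b)) = of_nat (card B)"
    by (simp add: \<phi>_def rat_vs.representation_basis[OF indep])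
  moreover have "(\<Sum>\<sigma>\<in>S. \<sigma> (1 :: 'k)) = (of_nat (card S) :: complex)"
    using S(2) by (subst sum.cong[OF refl, of _ _ "\<lambda>_. 1"]) (auto simp: field_emb_def)
  ultimately have "(of_nat (card B) :: complex) = of_nat (card S)" using trace[of 1] by simp
  then have "card B = card S" by (simp only: of_nat_eq_iff)
  then show "card {\<sigma> :: 'k \<Rightarrow> complex. field_emb \<sigma>} = field_degree TYPE('k)"
    using fin Seq by simp
qed

section \<open>Integral bases and the discriminant\<close>

lemma sum_assoc_matrix:
  fixes f :: "'j \<Rightarrow> 'a :: comm_semiring_0"
  shows "(\<Sum>k\<in>K. (\<Sum>j\<in>J. f j * g j k) * h k) = (\<Sum>j\<in>J. f j * (\<Sum>k\<in>K. g j k * h k))"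
proof -
  have "(\<Sum>k\<in>K. (\<Sum>j\<in>J. f j * g j k) * h k) = (\<Sum>k\<in>K. \<Sum>j\<in>J. f j * (g j k * h k))"
    by (simp only: sum_distrib_right mult.assoc)
  also have "\<dots> = (\<Sum>j\<in>J. \<Sum>k\<in>K. f j * (g j k * h k))" by (rule sum.swap)
  finally show ?thesis by (simp only: sum_distrib_left)
qed

lemma field_trace_add: "field_trace (x + y :: 'k :: number_field) = field_trace x + field_trace y"
proof -
  have "(of_rat (field_trace (x + y)) :: complex) = of_rat (field_trace x + field_trace y)"
    unfolding of_rat_add field_trace_eq_sum_homs sum.distrib[symmetric]
    by (intro sum.cong refl) (simp add: field_emb_add)
  then show ?thesis by simp
qed

lemma field_trace_scale: "field_trace (of_rat q * x :: 'k :: number_field) = q * field_trace x"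
proof -
  have "(of_rat (field_trace (of_rat q * x)) :: complex) = of_rat (q * field_trace x)"
    unfolding of_rat_mult field_trace_eq_sum_homs sum_distrib_left
    by (intro sum.cong refl) (simp add: field_emb_mult field_emb_of_rat)
  then show ?thesis by simp
qed

lemma field_trace_sum: "field_trace (sum f I :: 'k :: number_field) = (\<Sum>i\<in>I. field_trace (f i))"
proof -
  have "field_trace (0 :: 'k) = 0" using field_trace_scale[of 0 "0 :: 'k"] by simp
  then show ?thesis by (induction I rule: infinite_finite_induct) (auto simp: field_trace_add)
qed

lemma field_trace_one: "field_trace (1 :: 'k :: number_field) = of_nat (field_degree TYPE('k))"
proof -
  have "(of_rat (field_trace (1 :: 'k)) :: complex) = (\<Sum>\<sigma> :: 'k \<Rightarrow> complex | field_emb \<sigma>. 1)"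
    unfolding field_trace_eq_sum_homs by (intro sum.cong refl) (simp add: field_emb_one)
  also have "\<dots> = of_rat (of_nat (field_degree TYPE('k)))" by (simp add: card_field_embs)
  finally show ?thesis by (simp only: of_rat_eq_iff)
qed

lemma field_trace_int:
  assumes "algebraic_int (x :: 'k :: number_field)"
  obtains m where "field_trace x = of_int m"
proof -
  have "algebraic_int (of_rat (field_trace x) :: complex)"
    unfolding field_trace_eq_sum_homs
    by (intro algebraic_int_sum) (use assms in \<open>auto simp: field_emb_algebraic_int_iff\<close>)
  then have "(of_rat (field_trace x) :: complex) \<in> \<int>"
    by (rule rational_algebraic_int_is_int) simp
  then obtain m where "(of_rat (field_trace x) :: complex) = of_int m" by (auto elim: Ints_cases)
  then have "(of_rat (field_trace x) :: complex) = of_rat (of_int m)" by simp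
  then show ?thesis using that by (simp only: of_rat_eq_iff)
qed

lemma degree_pos: "field_degree TYPE('k :: number_field) > 0"
proof (rule ccontr)
  assume "\<not> ?thesis"
  then have "\<And>\<sigma> :: 'k \<Rightarrow> complex. \<not> field_emb \<sigma>"
    using card_field_embs[where 'k = 'k] finite_field_embs[where 'k = 'k] by auto
  obtain B :: "'k set" where "rat_basis B" using rat_basis_exists by blast
  with \<open>\<not> ?thesis\<close> have "rat_span ({} :: 'k set) = UNIV"
    using rat_basis_finite[of B] by (auto simp: rat_basis_def)
  then have "(UNIV :: 'k set) = {0}" by simp
  then have "(1 :: 'k) = 0" by blast
  then show False by simp
qed

section \<open>Gram determinants of the trace form\<close>

definition gram_det :: "(nat \<Rightarrow> 'k :: number_field) \<Rightarrow> rat" where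
  "gram_det b = detf (field_degree TYPE('k)) (\<lambda>i j. field_trace (b i * b j))"

lemma gram_det_transform:
  fixes b :: "nat \<Rightarrow> 'k :: number_field"
  defines "n \<equiv> field_degree TYPE('k)"
  assumes "\<And>i. i < n \<Longrightarrow> c i = (\<Sum>j<n. of_rat (A i j) * b j)"
  shows "gram_det c = (detf n A) ^ 2 * gram_det b"
proof -
  let ?G = "\<lambda>i j. field_trace (b i * b j)"
  have "gram_det c = detf n (\<lambda>i j. \<Sum>k<n. (\<Sum>l<n. A i l * ?G l k) * A j k)"
    unfolding gram_det_def n_def[symmetric]
  proof (rule detf_cong)
    fix i j assume "i < n" "j < n"
    then have "c i * c j = (\<Sum>l<n. \<Sum>k<n. of_rat (A i l * A j k) * (b l * b k))"
      by (simp add: assms(2) sum_product of_rat_mult mult_ac)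
    then have "field_trace (c i * c j) = (\<Sum>l<n. \<Sum>k<n. A i l * A j k * ?G l k)"
      by (simp add: field_trace_sum field_trace_scale)
    also have "\<dots> = (\<Sum>k<n. (\<Sum>l<n. A i l * ?G l k) * A j k)"
      by (subst sum.swap) (simp add: sum_distrib_left sum_distrib_right mult_ac)
    finally show "field_trace (c i * c j) = (\<Sum>k<n. (\<Sum>l<n. A i l * ?G l k) * A j k)" .
  qed
  also have "\<dots> = detf n A * detf n ?G * detf n A"
    unfolding detf_mult[of n _ "\<lambda>k j. A j k"] detf_mult[of n A ?G] detf_transpose[of n A] ..
  finally show ?thesis by (simp add: gram_det_def n_def power2_eq_square)
qed

lemma gram_det_update:
  fixes b :: "nat \<Rightarrow> 'k :: number_field"
  defines "n \<equiv> field_degree TYPE('k)"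
  assumes "k < n"
  shows "gram_det (b(k := \<Sum>j<n. of_rat (q j) * b j)) = (q k) ^ 2 * gram_det b"
proof -
  let ?I = "\<lambda>i j. if i = j then 1 else 0 :: rat"
  let ?A = "\<lambda>i j. if i = k then \<Sum>l<n. q l * ?I l j else ?I i j"
  have "detf n ?A = q k"
    using detf_replace_row[OF assms(2), of q ?I] by (simp add: detf_one)
  moreover have "gram_det (b(k := \<Sum>j<n. of_rat (q j) * b j)) = (detf n ?A) ^ 2 * gram_det b"
    unfolding n_def
  proof (rule gram_det_transform, unfold n_def[symmetric])
    fix i assume i: "i < n"
    show "(b(k := \<Sum>j<n. of_rat (q j) * b j)) i = (\<Sum>j<n. of_rat (?A i j) * b j)"
    proof (cases "i = k")
      case True
      have "(\<Sum>l<n. q l * ?I l j) = q j" if "j < n" for j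
        using that by (simp add: if_distrib cong: if_cong)
      then show ?thesis using True by (auto intro!: sum.cong)
    next
      case False
      have "(\<Sum>j<n. of_rat (?I i j) * b j) = (\<Sum>j<n. if i = j then b j else 0)"
        by (intro sum.cong) auto
      then show ?thesis using False i by simp
    qed
  qed
  ultimately show ?thesis by simp
qed

lemma gram_independent:
  fixes b :: "nat \<Rightarrow> 'k :: number_field"
  defines "n \<equiv> field_degree TYPE('k)"
  assumes "gram_det b \<noteq> 0" "(\<Sum>i<n. of_rat (c i) * b i) = 0" "k < n"
  shows "c k = 0"
proof -
  let ?G = "\<lambda>i j. field_trace (b i * b j)"
  obtain R where R: "\<And>i j. i < n \<Longrightarrow> j < n \<Longrightarrow> (\<Sum>k<n. ?G i k * R k j) = (if i = j then gram_det b else 0)"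
    unfolding gram_det_def n_def[symmetric] by (rule detf_adjugate[of n ?G]) blast
  have 0: "(\<Sum>i<n. c i * ?G i j) = 0" for j
  proof -
    have "(\<Sum>i<n. c i * ?G i j) = field_trace ((\<Sum>i<n. of_rat (c i) * b i) * b j)"
      by (simp add: sum_distrib_right field_trace_sum field_trace_scale mult.assoc)
    also have "\<dots> = 0" using field_trace_scale[of 0 "0 :: 'k"] by (simp add: assms(3))
    finally show ?thesis .
  qed
  have "0 = (\<Sum>j<n. (\<Sum>i<n. c i * ?G i j) * R j k)" by (simp add: 0)
  also have "\<dots> = (\<Sum>i<n. c i * (\<Sum>j<n. ?G i j * R j k))"
    by (rule sum_assoc_matrix)
  also have "\<dots> = c k * gram_det b" using assms(4) by (simp add: R if_distrib cong: if_cong)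
  finally show ?thesis using assms(2) by simp
qed

lemma detf_zero_kernel:
  fixes A :: "nat \<Rightarrow> nat \<Rightarrow> 'a :: field"
  assumes "detf n A = 0"
  obtains v k where "k < n" "v k \<noteq> 0" "\<And>i. i < n \<Longrightarrow> (\<Sum>j<n. A i j * v j) = 0"
proof -
  let ?A = "Matrix.mat n n (\<lambda>(i, j). A i j)"
  obtain v where v: "v \<in> carrier_vec n" "v \<noteq> 0\<^sub>v n" "?A *\<^sub>v v = 0\<^sub>v n"
    using assms det_0_iff_vec_prod_zero_field[of ?A n] unfolding detf_def by auto
  from v(1,2) obtain k where "k < n" "vec_index v k \<noteq> 0" by force
  moreover have "(\<Sum>j<n. A i j * vec_index v j) = 0" if "i < n" for i
    using arg_cong[OF v(3), of "\<lambda>w. vec_index w i"] that v(1)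
    by (simp add: scalar_prod_def atLeast0LessThan)
  ultimately show ?thesis by (rule that)
qed

text \<open>The vectors of a rational basis become integral after scaling. A kernel vector of the
  Gram matrix would give some y \<noteq> 0 orthogonal to the whole field, but the pairing of y with
  its inverse is the trace of 1, which is the positive degree.\<close>

lemma rational_basis_of_algebraic_ints:
  obtains b :: "nat \<Rightarrow> 'k :: number_field" where "\<And>i. algebraic_int (b i)" "gram_det b \<noteq> 0"
    and "\<And>x. \<exists>c. x = (\<Sum>i<field_degree TYPE('k). of_rat (c i) * b i)"
proof -
  define n where "n = field_degree TYPE('k)"
  obtain B :: "'k set" where B: "rat_basis B" using rat_basis_exists by blast
  have indep: "\<not> rat_dependent B" and span: "\<And>x. x \<in> rat_span B" using B by (auto simp: rat_basis_def)
  note fin = rat_basis_finite[OF B]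
  obtain e where e: "bij_betw e {..<n} B"
    using ex_bij_betw_nat_finite[OF fin(1)] unfolding fin(2) n_def by (auto simp: atLeast0LessThan)
  have "\<exists>m :: int. m > 0 \<and> algebraic_int (of_int m * e i)" for i
    by (rule algebraic_int_multiple[of "e i"]) blast
  then obtain m where m: "\<And>i. m i > 0" "\<And>i. algebraic_int (of_int (m i) * e i)" by metis
  define b where "b i = of_int (m i) * e i" for i
  have expand: "x = (\<Sum>i<n. of_rat (rat_representation B x (e i) / of_int (m i)) * b i)" for x
  proof -
    have "x = (\<Sum>c\<in>B. of_rat (rat_representation B x c) * c)"
      using rat_vs.sum_representation_eq[OF indep span fin(1) order_refl, of x] by simp
    also have "\<dots> = (\<Sum>i<n. of_rat (rat_representation B x (e i)) * e i)"
      by (rule sum.reindex_bij_betw[OF e, symmetric])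
    also have "\<dots> = (\<Sum>i<n. of_rat (rat_representation B x (e i) / of_int (m i)) * b i)"
      using m(1) by (intro sum.cong refl) (simp add: b_def of_rat_divide less_imp_neq[symmetric])
    finally show ?thesis .
  qed
  have "gram_det b \<noteq> 0"
  proof
    assume "gram_det b = 0"
    then obtain v k where v: "k < n" "v k \<noteq> 0" "\<And>i. i < n \<Longrightarrow> (\<Sum>j<n. field_trace (b i * b j) * v j) = 0"
      unfolding gram_det_def n_def by (rule detf_zero_kernel) blast
    define y where "y = (\<Sum>j<n. of_rat (v j) * b j)"
    have y: "y = (\<Sum>j<n. of_rat (v j * of_int (m j)) * e j)" by (simp add: y_def b_def of_rat_mult mult_ac)
    have "y \<noteq> 0"
    proof
      assume "y = 0"
      define u where "u c = v (inv_into {..<n} e c) * of_int (m (inv_into {..<n} e c))" for c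
      have inv: "inv_into {..<n} e (e j) = j" if "j < n" for j
        using e that by (auto simp: bij_betw_def)
      have "(\<Sum>c\<in>B. of_rat (u c) * c) = (\<Sum>j<n. of_rat (u (e j)) * e j)"
        by (rule sum.reindex_bij_betw[OF e, symmetric])
      also have "\<dots> = y" by (simp add: y u_def inv)
      finally have "(\<Sum>c\<in>B. of_rat (u c) * c) = 0" using \<open>y = 0\<close> by simp
      from rat_vs.independentD[OF indep fin(1) order_refl this, of "e k"] v(1) e
      have "u (e k) = 0" by (auto simp: bij_betw_def)
      with v m(1)[of k] show False by (simp add: u_def inv)
    qed
    have z: "field_trace (z * y) = 0" for z
    proof -
      obtain c where c: "z = (\<Sum>i<n. of_rat (c i) * b i)" using expand[of z] by (rule that)
      have "field_trace (z * y) = (\<Sum>i<n. \<Sum>j<n. field_trace (of_rat (c i * v j) * (b i * b j)))"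
        by (simp add: c y_def sum_product field_trace_sum of_rat_mult mult_ac)
      also have "\<dots> = (\<Sum>i<n. c i * (\<Sum>j<n. field_trace (b i * b j) * v j))"
        by (simp only: field_trace_scale sum_distrib_left) (simp add: mult_ac)
      finally show ?thesis by (simp add: v(3))
    qed
    from z[of "inverse y"] \<open>y \<noteq> 0\<close> have "field_trace (1 :: 'k) = 0" by simp
    then show False using field_trace_one[where 'k = 'k] degree_pos[where 'k = 'k] by simp
  qed
  moreover have "algebraic_int (b i)" for i using m(2) by (simp add: b_def)
  moreover have "\<exists>c. x = (\<Sum>i<n. of_rat (c i) * b i)" for x by (rule exI, rule expand)
  ultimately show ?thesis using that[of b] unfolding n_def by blast
qed

lemma gram_det_int:
  assumes "\<And>i. algebraic_int (b i :: 'k :: number_field)"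
  obtains m where "gram_det b = of_int m"
proof -
  have "\<exists>m. field_trace (b i * b j) = of_int m" for i j
    by (rule field_trace_int[of "b i * b j"]) (use assms in \<open>auto intro: algebraic_int_mult\<close>)
  then obtain g where "\<And>i j. field_trace (b i * b j) = of_int (g i j)" by metis
  then have "gram_det b = of_int (detf (field_degree TYPE('k)) g)"
    by (simp add: gram_det_def detf_of_int)
  then show ?thesis using that by blast
qed

text \<open>A rational basis of algebraic integers with minimal \<open>|gram_det|\<close> is an integral basis: a
  fractional coordinate would allow a replacement with smaller Gram determinant.\<close>

lemma integral_basis_exists:
  obtains b :: "nat \<Rightarrow> 'k :: number_field" where "\<And>i. algebraic_int (b i)" "gram_det b \<noteq> 0"
    and "\<And>x. algebraic_int x \<Longrightarrow> \<exists>c. x = (\<Sum>i<field_degree TYPE('k). of_int (c i) * b i)"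
proof -
  define n where "n = field_degree TYPE('k)"
  define P where "P b \<longleftrightarrow> (\<forall>i. algebraic_int (b i)) \<and> gram_det b \<noteq> 0 \<and>
    (\<forall>x. \<exists>c. x = (\<Sum>i<n. of_rat (c i) * b i))" for b :: "nat \<Rightarrow> 'k"
  define \<mu> where "\<mu> b = nat \<bar>\<lfloor>gram_det b\<rfloor>\<bar>" for b :: "nat \<Rightarrow> 'k"
  have \<mu>: "of_nat (\<mu> b) = \<bar>gram_det b\<bar>" if "P b" for b
  proof -
    obtain m where "gram_det b = of_int m" using gram_det_int[of b] \<open>P b\<close> P_def by blast
    then show ?thesis by (simp add: \<mu>_def)
  qed
  obtain b0 where "P b0"
    using rational_basis_of_algebraic_ints[where 'k = 'k] unfolding P_def n_def by metis
  then obtain b where b: "P b" and least: "\<And>c. P c \<Longrightarrow> \<mu> b \<le> \<mu> c"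
    using ex_has_least_nat[of P b0 \<mu>] by blast
  have int: "\<exists>c. x = (\<Sum>i<n. of_int (c i) * b i)" if x: "algebraic_int x" for x
  proof -
    obtain q where q: "x = (\<Sum>i<n. of_rat (q i) * b i)" using b unfolding P_def by blast
    have "q k \<in> \<int>" if k: "k < n" for k
    proof (rule ccontr)
      assume nint: "q k \<notin> \<int>"
      define r where "r = q(k := frac (q k))"
      define y where "y = (\<Sum>i<n. of_rat (r i) * b i)"
      have rk: "r k \<noteq> 0" "0 \<le> r k" "r k < 1"
        using nint by (auto simp: r_def frac_lt_1)
      have "y = x - of_int \<lfloor>q k\<rfloor> * b k"
      proof -
        have "y = of_rat (frac (q k)) * b k + (\<Sum>i\<in>{..<n} - {k}. of_rat (q i) * b i)"
          unfolding y_def using k by (subst sum.remove[of _ k]) (auto simp: r_def)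
        moreover have "x = of_rat (q k) * b k + (\<Sum>i\<in>{..<n} - {k}. of_rat (q i) * b i)"
          unfolding q using k by (subst sum.remove[of _ k]) auto
        ultimately show ?thesis by (simp add: frac_def of_rat_diff left_diff_distrib)
      qed
      then have y: "algebraic_int y"
        using x b unfolding P_def by (auto intro!: algebraic_int_diff algebraic_int_mult)
      define b' where "b' = b(k := y)"
      have det: "gram_det b' = (r k) ^ 2 * gram_det b"
        unfolding b'_def y_def n_def by (rule gram_det_update) (use k n_def in simp)
      have "\<exists>c. z = (\<Sum>i<n. of_rat (c i) * b' i)" for z
      proof -
        obtain c where c: "z = (\<Sum>i<n. of_rat (c i) * b i)" using b unfolding P_def by blast
        \<comment> \<open>The equation y = r k * b k + S r is solved for b k, which turns the
          coordinates c of z into coordinates in the new family.\<close>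
        define s where "s = c k / r k"
        define c' where "c' i = (if i = k then s else c i - s * r i)" for i
        define S where "S f = (\<Sum>i\<in>{..<n} - {k}. of_rat (f i) * b i)" for f
        have split: "(\<Sum>i<n. of_rat (f i) * b i) = of_rat (f k) * b k + S f" for f
          unfolding S_def using k by (subst sum.remove[of _ k]) auto
        have S_diff: "S (\<lambda>i. c i - s * r i) = S c - of_rat s * S r"
          unfolding S_def sum_distrib_left sum_subtractf[symmetric]
          by (intro sum.cong refl) (simp add: of_rat_diff of_rat_mult left_diff_distrib)
        have y_split: "y = of_rat (r k) * b k + S r" unfolding y_def by (rule split)
        have "(\<Sum>i<n. of_rat (c' i) * b' i) = of_rat s * y + S (\<lambda>i. c i - s * r i)"
          using k by (subst sum.remove[of _ k]) (auto simp: c'_def b'_def S_def)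
        also have "\<dots> = of_rat s * (of_rat (r k) * b k + S r) + (S c - of_rat s * S r)"
          by (simp only: S_diff y_split)
        also have "\<dots> = of_rat (s * r k) * b k + S c"
          by (simp add: of_rat_mult algebra_simps)
        also have "s * r k = c k" using rk by (simp add: s_def)
        also have "of_rat (c k) * b k + S c = z"
          unfolding c by (rule split[symmetric])
        finally show ?thesis by metis
      qed
      moreover have "gram_det b' \<noteq> 0" using det rk b by (simp add: P_def)
      ultimately have "P b'" using b y by (simp add: P_def b'_def)
      then have "rat_of_nat (\<mu> b) \<le> of_nat (\<mu> b')" using least by simp
      then have "\<bar>gram_det b\<bar> \<le> (r k) ^ 2 * \<bar>gram_det b\<bar>"
        using \<mu>[OF b] \<mu>[OF \<open>P b'\<close>] by (simp add: det abs_mult)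
      moreover have "(r k) ^ 2 * \<bar>gram_det b\<bar> < 1 * \<bar>gram_det b\<bar>"
        using rk b by (intro mult_strict_right_mono) (auto simp: P_def abs_square_less_1)
      ultimately show False by simp
    qed
    then have "\<forall>k. \<exists>c. k < n \<longrightarrow> q k = of_int c" by (meson Ints_cases)
    from choice[OF this] obtain c where "\<forall>k. k < n \<longrightarrow> q k = of_int (c k)" by blast
    then have "of_rat (q k) = (of_int (c k) :: 'k)" if "k < n" for k
      using that by simp
    then have "(\<Sum>i<n. of_rat (q i) * b i) = (\<Sum>i<n. of_int (c i) * b i)"
      by (intro sum.cong refl) simp
    with q show ?thesis by metis
  qed
  show ?thesis using that[of b] b int unfolding P_def n_def by blast
qed

text \<open>The definite description needs uniqueness over all integral bases. Two of them are
  related by mutually inverse integer matrices A and B, so the base change multiplies the Gram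
  determinant by the square of a unit of \<int>.\<close>

lemma field_discriminant_eq_gram_det:
  fixes b :: "nat \<Rightarrow> 'k :: number_field"
  defines "n \<equiv> field_degree TYPE('k)"
  assumes alg: "\<And>i. algebraic_int (b i)" and det: "gram_det b \<noteq> 0"
    and span: "\<And>x. algebraic_int x \<Longrightarrow> \<exists>c. x = (\<Sum>i<n. of_int (c i) * b i)"
  shows "of_int (field_discriminant TYPE('k)) = gram_det b"
proof -
  obtain d where d: "gram_det b = of_int d" using gram_det_int alg by blast
  have uniq: "c k = c' k" if "(\<Sum>i<n. of_int (c i) * b i) = (\<Sum>i<n. of_int (c' i) * b i)" "k < n" for c c' k
  proof -
    have "(\<Sum>i<n. of_rat (of_int (c i - c' i)) * b i) = 0"
      using that(1) by (simp add: left_diff_distrib sum_subtractf of_rat_diff)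
    from gram_independent[OF det this[unfolded n_def]] that(2) have "of_int (c k - c' k) = (0 :: rat)"
      unfolding n_def by blast
    then show ?thesis by simp
  qed
  define bs where "bs = map b [0..<n]"
  have "integral_basis bs"
    unfolding integral_basis_def
  proof (intro conjI ballI)
    show "set bs \<subseteq> ring_of_integers" using alg by (auto simp: bs_def ring_of_integers_def)
    fix x :: 'k assume "x \<in> ring_of_integers"
    then obtain c where c: "x = (\<Sum>i<n. of_int (c i) * b i)" using span by (auto simp: ring_of_integers_def)
    show "\<exists>!cs :: int list. length cs = length bs \<and> x = (\<Sum>i<length bs. of_int (cs ! i) * bs ! i)"
    proof (intro ex1I[of _ "map c [0..<n]"] conjI)
      show "length (map c [0..<n]) = length bs" by (simp add: bs_def)
      show "x = (\<Sum>i<length bs. of_int (map c [0..<n] ! i) * bs ! i)" by (simp add: bs_def c)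
      fix cs :: "int list" assume cs: "length cs = length bs \<and> x = (\<Sum>i<length bs. of_int (cs ! i) * bs ! i)"
      then have "(\<Sum>i<n. of_int (cs ! i) * b i) = (\<Sum>i<n. of_int (c i) * b i)" by (simp add: bs_def c)
      then have "cs ! i = c i" if "i < n" for i using uniq[of "\<lambda>i. cs ! i" c i] that by blast
      then show "cs = map c [0..<n]" using cs by (intro nth_equalityI) (auto simp: bs_def)
    qed
  qed
  moreover have "of_int d = Determinant.det (Matrix.mat (length bs) (length bs) (\<lambda>(i, j). field_trace (bs ! i * bs ! j)))"
    unfolding d[symmetric] gram_det_def detf_def n_def[symmetric]
    by (intro arg_cong[of _ _ Determinant.det] eq_matI) (auto simp: bs_def)
  ultimately have ex: "\<exists>bs :: 'k list. integral_basis bs \<and>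
      of_int d = Determinant.det (Matrix.mat (length bs) (length bs) (\<lambda>(i, j). field_trace (bs ! i * bs ! j)))" by blast
  have "d' = d" if "integral_basis cs" "of_int d' = Determinant.det (Matrix.mat (length cs) (length cs) (\<lambda>(i, j). field_trace (cs ! i * cs ! j)))"
    for d' and cs :: "'k list"
  proof -
    define m where "m = length cs"
    have cs_int: "algebraic_int (cs ! i)" if "i < m" for i
      using \<open>integral_basis cs\<close> nth_mem[of i cs] that
      unfolding integral_basis_def ring_of_integers_def m_def by blast
    have cs_uniq: "f i = g i" if "(\<Sum>i<m. of_int (f i) * cs ! i) = (\<Sum>i<m. of_int (g i) * cs ! i)" "i < m" for f g i
    proof -
      let ?x = "\<Sum>i<m. of_int (f i) * cs ! i"
      have "?x \<in> ring_of_integers"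
        unfolding ring_of_integers_def using cs_int by (auto intro!: algebraic_int_sum algebraic_int_mult)
      then have ex1: "\<exists>!l :: int list. length l = m \<and> ?x = (\<Sum>i<m. of_int (l ! i) * cs ! i)"
        using \<open>integral_basis cs\<close> unfolding integral_basis_def m_def by blast
      have F: "length (map f [0..<m]) = m \<and> ?x = (\<Sum>i<m. of_int (map f [0..<m] ! i) * cs ! i)" by simp
      have G: "length (map g [0..<m]) = m \<and> ?x = (\<Sum>i<m. of_int (map g [0..<m] ! i) * cs ! i)"
        using that(1) by simp
      from ex1 F G have "map f [0..<m] = map g [0..<m]" by blast
      then show ?thesis using that(2) by auto
    qed
    have "\<exists>c. b i = (\<Sum>j<m. of_int (c j) * cs ! j)" for i
    proof -
      have "b i \<in> ring_of_integers" using alg by (simp add: ring_of_integers_def)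
      then obtain l :: "int list" where "b i = (\<Sum>j<m. of_int (l ! j) * cs ! j)"
        using \<open>integral_basis cs\<close> unfolding integral_basis_def m_def by blast
      then show ?thesis by blast
    qed
    then have "\<forall>i. \<exists>c. b i = (\<Sum>j<m. of_int (c j) * cs ! j)" by blast
    from choice[OF this] obtain A where A: "\<And>i. b i = (\<Sum>j<m. of_int (A i j) * cs ! j)" by blast
    have "\<exists>c. j < m \<longrightarrow> cs ! j = (\<Sum>i<n. of_int (c i) * b i)" for j
      using span cs_int by blast
    then have "\<forall>j. \<exists>c. j < m \<longrightarrow> cs ! j = (\<Sum>i<n. of_int (c i) * b i)" by blast
    from choice[OF this] obtain B where B: "\<And>j. j < m \<Longrightarrow> cs ! j = (\<Sum>i<n. of_int (B j i) * b i)" by blast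
    have AB: "(\<Sum>j<m. A i j * B j k) = (if i = k then 1 else 0)" if "i < n" "k < n" for i k
    proof -
      have "(\<Sum>k<n. of_int (\<Sum>j<m. A i j * B j k) * b k) = (\<Sum>j<m. of_int (A i j) * (\<Sum>k<n. of_int (B j k) * b k))"
        by (simp only: of_int_sum of_int_mult sum_assoc_matrix)
      also have "\<dots> = b i" by (simp only: A[of i]) (intro sum.cong refl, simp add: B)
      also have "\<dots> = (\<Sum>k<n. of_int (if i = k then 1 else 0) * b k)"
        using that(1) by (simp add: if_distrib[of of_int] if_distrib[of "\<lambda>z. z * _"] cong: if_cong)
      finally show ?thesis using uniq[of "\<lambda>k. \<Sum>j<m. A i j * B j k" "\<lambda>k. if i = k then 1 else 0"] that(2) by blast
    qed
    have BA: "(\<Sum>i<n. B j i * A i k) = (if j = k then 1 else 0)" if "j < m" "k < m" for j k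
    proof -
      have "(\<Sum>k<m. of_int (\<Sum>i<n. B j i * A i k) * cs ! k) = (\<Sum>i<n. of_int (B j i) * (\<Sum>k<m. of_int (A i k) * cs ! k))"
        by (simp only: of_int_sum of_int_mult sum_assoc_matrix)
      also have "\<dots> = cs ! j" by (simp add: A[symmetric] B[OF that(1)])
      also have "\<dots> = (\<Sum>k<m. of_int (if j = k then 1 else 0) * cs ! k)"
        using that(1) by (simp add: if_distrib[of of_int] if_distrib[of "\<lambda>z. z * _"] cong: if_cong)
      finally show ?thesis using cs_uniq[of "\<lambda>k. \<Sum>i<n. B j i * A i k" "\<lambda>k. if j = k then 1 else 0"] that(2) by blast
    qed
    \<comment> \<open>The length m of the other basis is not known yet. The traces of A B and of B A
      agree, and they are n and m.\<close>
    have "int n = (\<Sum>i<n. \<Sum>j<m. A i j * B j i)" by (simp add: AB)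
    also have "\<dots> = (\<Sum>j<m. \<Sum>i<n. B j i * A i j)" by (subst sum.swap) (simp add: mult.commute)
    also have "\<dots> = int m" by (simp add: BA)
    finally have m: "m = n" by simp
    have "detf n A * detf n B = detf n (\<lambda>i k. if i = k then 1 else 0)"
      unfolding detf_mult[symmetric] by (rule detf_cong) (use AB m in auto)
    then have "detf n B dvd 1" by (metis detf_one dvd_triv_right)
    then have B1: "(detf n B) ^ 2 = 1" by (auto simp: zdvd1_eq power2_eq_1_iff abs_if split: if_splits)
    have "of_int d' = gram_det (\<lambda>i. cs ! i)"
      using that(2) m unfolding gram_det_def detf_def n_def m_def by simp
    also have "\<dots> = (detf n (\<lambda>i j. of_int (B i j))) ^ 2 * gram_det b"
      unfolding n_def by (rule gram_det_transform) (use B m n_def in auto)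
    also have "\<dots> = of_int ((detf n B) ^ 2) * gram_det b" by (simp add: detf_of_int)
    finally show "d' = d" by (simp add: B1 d)
  qed
  then have "field_discriminant TYPE('k) = d"
    unfolding field_discriminant_def using ex by (intro the_equality) blast+
  then show ?thesis by (simp add: d)
qed

section \<open>Totally real fields\<close>

lemma real_embeddings:
  assumes "totally_real TYPE('k :: number_field)"
  obtains hs :: "nat \<Rightarrow> 'k :: number_field \<Rightarrow> real" where "\<And>i. field_emb (hs i)"
    and "\<And>x. of_rat (field_trace x) = (\<Sum>i<field_degree TYPE('k). hs i x)"
proof -
  define n where "n = field_degree TYPE('k)"
  obtain e where e: "bij_betw e {0..<n} {\<sigma> :: 'k \<Rightarrow> complex. field_emb \<sigma>}"
    using ex_bij_betw_nat_finite[OF finite_field_embs[where 'k = 'k]] unfolding card_field_embs n_def by blast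
  have emb: "field_emb (e i)" if "i < n" for i using e that by (auto simp: bij_betw_def)
  \<comment> \<open>Reducing the index modulo n makes every \<open>hs i\<close> an embedding, so no
    index bound is carried along.\<close>
  define hs where "hs i x = Re (e (i mod n) x)" for i x
  have n: "n > 0" unfolding n_def by (rule degree_pos)
  have re: "of_real (hs i x) = e (i mod n) x" for i x
  proof -
    have "field_emb (e (i mod n))" using emb n by simp
    then have "range (e (i mod n)) \<subseteq> \<real>"
      using assms unfolding totally_real_def field_emb_def by blast
    then have "e (i mod n) x \<in> \<real>" by auto
    then show ?thesis by (auto simp: hs_def elim: Reals_cases)
  qed
  have "field_emb (hs i)" for i
  proof -
    have em: "field_emb (e (i mod n))" using emb n by simp
    have "complex_of_real (hs i 1) = complex_of_real 1"
      "complex_of_real (hs i (x + y)) = complex_of_real (hs i x + hs i y)"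
      "complex_of_real (hs i (x * y)) = complex_of_real (hs i x * hs i y)" for x y
      unfolding of_real_add of_real_mult re
      by (simp_all add: field_emb_one[OF em] field_emb_add[OF em] field_emb_mult[OF em])
    then show ?thesis unfolding field_emb_def of_real_eq_iff by blast
  qed
  moreover have "of_rat (field_trace x) = (\<Sum>i<n. hs i x)" for x :: 'k
  proof -
    have "complex_of_real (of_rat (field_trace x)) = of_rat (field_trace x)"
    proof -
      obtain a b where ab: "quotient_of (field_trace x) = (a, b)" by fastforce
      show ?thesis unfolding quotient_of_div[OF ab] by (simp add: of_rat_divide)
    qed
    also have "\<dots> = (\<Sum>i\<in>{0..<n}. e i x)"
      unfolding field_trace_eq_sum_homs by (rule sum.reindex_bij_betw[OF e, symmetric])
    also have "\<dots> = complex_of_real (\<Sum>i<n. hs i x)"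
      unfolding of_real_sum re atLeast0LessThan by (intro sum.cong) auto
    finally show ?thesis by (simp only: of_real_eq_iff)
  qed
  ultimately show ?thesis using that[of hs] unfolding n_def by blast
qed

text \<open>The families are total, while the sums run over indices below n. Independence of b is
  encoded in its Gram determinant d, which is nonzero because d is squarefree.\<close>

locale totally_real_field =
  fixes hs :: "nat \<Rightarrow> 'k :: number_field \<Rightarrow> real" and b :: "nat \<Rightarrow> 'k" and n :: nat and d :: int
  assumes degree: "n = field_degree TYPE('k)"
    and emb: "field_emb (hs i)"
    and trace_sum: "of_rat (field_trace x) = (\<Sum>i<n. hs i x)"
    and basis_alg: "algebraic_int (b i)"
    and basis_span: "algebraic_int x \<Longrightarrow> \<exists>c. x = (\<Sum>i<n. of_int (c i) * b i)"
    and disc: "of_int d = gram_det b"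
    and squarefree_disc: "squarefree d"
begin

lemmas hs_one = field_emb_one[OF emb]
  and hs_add = field_emb_add[OF emb]
  and hs_mult = field_emb_mult[OF emb]
  and hs_zero = field_emb_zero[OF emb]
  and hs_diff = field_emb_diff[OF emb]
  and hs_sum = field_emb_sum[OF emb]
  and hs_of_int = field_emb_of_int[OF emb]
  and hs_eq_iff = field_emb_eq_iff[OF emb]
  and hs_alg_iff = field_emb_algebraic_int_iff[OF emb]

lemma disc_nonzero: "d \<noteq> 0"
  using squarefree_disc by auto

lemma degree_positive: "n > 0"
  unfolding degree by (rule degree_pos)

text \<open>The floor only changes the type: on algebraic integers the trace is already an
  integer.\<close>

definition tr :: "'k \<Rightarrow> int" where "tr x = \<lfloor>field_trace x\<rfloor>"

lemma of_int_tr: "algebraic_int x \<Longrightarrow> of_int (tr x) = field_trace x"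
  unfolding tr_def by (metis field_trace_int floor_of_int)

lemma real_tr: "algebraic_int x \<Longrightarrow> of_int (tr x) = (\<Sum>i<n. hs i x)"
  unfolding trace_sum[symmetric] of_int_tr[symmetric] by simp

lemma tr_eqI:
  assumes "algebraic_int x" "(\<Sum>i<n. hs i x) = of_int m"
  shows "tr x = m"
  using real_tr[OF assms(1)] assms(2) by simp

lemma tr_add: "algebraic_int x \<Longrightarrow> algebraic_int y \<Longrightarrow> tr (x + y) = tr x + tr y"
  by (rule tr_eqI) (auto simp: algebraic_int_add hs_add sum.distrib real_tr)

lemma tr_scale: "algebraic_int x \<Longrightarrow> tr (of_int m * x) = m * tr x"
  by (rule tr_eqI) (auto simp: algebraic_int_mult hs_mult hs_of_int sum_distrib_left real_tr)

lemma tr_minus: "algebraic_int x \<Longrightarrow> tr (- x) = - tr x"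
  using tr_scale[of x "-1"] by simp

lemma tr_diff: "algebraic_int x \<Longrightarrow> algebraic_int y \<Longrightarrow> tr (x - y) = tr x - tr y"
  using tr_add[of x "- y"] by (auto simp: tr_minus)

lemma tr_sum: "(\<And>i. i \<in> I \<Longrightarrow> algebraic_int (f i)) \<Longrightarrow> tr (sum f I) = (\<Sum>i\<in>I. tr (f i))"
proof (induction I rule: infinite_finite_induct)
  case (insert i I)
  then show ?case by (simp add: tr_add algebraic_int_sum)
qed (auto intro: tr_eqI simp: hs_zero)

lemma tr_one: "tr 1 = int n"
  by (rule tr_eqI) (auto simp: hs_one)

definition gram :: "nat \<Rightarrow> nat \<Rightarrow> int" where "gram i j = tr (b i * b j)"

lemma basis_mult_alg: "algebraic_int (b i * b j)"
  by (intro algebraic_int_mult basis_alg)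

lemma detf_gram: "detf n gram = d"
proof -
  have "of_int (detf n gram) = gram_det b"
    unfolding detf_of_int[symmetric] gram_det_def degree[symmetric]
    by (intro detf_cong) (simp add: gram_def of_int_tr basis_mult_alg)
  then show ?thesis unfolding disc[symmetric] by simp
qed

text \<open>This is d times the inverse Gram matrix. The equations determine its entries below n, as
  the Gram matrix is invertible over \<rat>.\<close>

definition adj :: "nat \<Rightarrow> nat \<Rightarrow> int" where
  "adj = (SOME R. \<forall>i<n. \<forall>j<n. (\<Sum>k<n. R i k * gram k j) = (if i = j then d else 0))"

lemma adj_gram: "i < n \<Longrightarrow> j < n \<Longrightarrow> (\<Sum>k<n. adj i k * gram k j) = (if i = j then d else 0)"
proof -
  obtain R where R: "\<And>i j. i < n \<Longrightarrow> j < n \<Longrightarrow> (\<Sum>k<n. R i k * gram k j) = (if i = j then detf n gram else 0)"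
    by (rule detf_adjugate[of n gram]) blast
  then have "\<exists>R. \<forall>i<n. \<forall>j<n. (\<Sum>k<n. R i k * gram k j) = (if i = j then d else 0)"
    by (intro exI[of _ R]) (simp add: detf_gram)
  from someI_ex[OF this] have "\<forall>i<n. \<forall>j<n. (\<Sum>k<n. adj i k * gram k j) = (if i = j then d else 0)"
    unfolding adj_def .
  then show "i < n \<Longrightarrow> j < n \<Longrightarrow> (\<Sum>k<n. adj i k * gram k j) = (if i = j then d else 0)" by blast
qed

text \<open>\<open>codual k / d\<close> is the dual basis of \<open>b\<close> for the trace form.\<close>

definition codual :: "nat \<Rightarrow> 'k" where
  "codual k = (\<Sum>l<n. of_int (adj k l) * b l)"

lemma codual_alg: "algebraic_int (codual k)"
  unfolding codual_def by (intro algebraic_int_sum algebraic_int_mult basis_alg) simp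

lemma tr_codual_basis: "k < n \<Longrightarrow> j < n \<Longrightarrow> tr (codual k * b j) = (if k = j then d else 0)"
proof -
  assume kj: "k < n" "j < n"
  have "tr (codual k * b j) = (\<Sum>l<n. tr (of_int (adj k l) * (b l * b j)))"
    unfolding codual_def sum_distrib_right mult.assoc
    by (intro tr_sum algebraic_int_mult basis_alg algebraic_int_of_int)
  also have "\<dots> = (\<Sum>l<n. adj k l * gram l j)"
    by (simp add: tr_scale basis_mult_alg gram_def)
  finally show ?thesis using adj_gram[OF kj] by simp
qed

lemma tr_codual_combination:
  assumes "k < n"
  shows "tr (codual k * (\<Sum>l<n. of_int (c l) * b l)) = d * c k"
proof -
  have "tr (codual k * (\<Sum>l<n. of_int (c l) * b l)) = (\<Sum>l<n. tr (of_int (c l) * (codual k * b l)))"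
    unfolding sum_distrib_left mult.left_commute[of "codual k"]
    by (intro tr_sum algebraic_int_mult basis_alg algebraic_int_of_int codual_alg)
  also have "\<dots> = (\<Sum>l<n. c l * (if k = l then d else 0))"
    using assms by (intro sum.cong refl) (simp add: tr_scale algebraic_int_mult basis_alg codual_alg tr_codual_basis)
  also have "\<dots> = d * c k" using assms by (simp add: if_distrib cong: if_cong)
  finally show ?thesis .
qed

text \<open>The division is exact when x is an algebraic integer, by duality of
  \<open>codual\<close> and b.\<close>

definition coord :: "'k \<Rightarrow> nat \<Rightarrow> int" where "coord x k = tr (codual k * x) div d"

lemma
  assumes "algebraic_int x"
  shows basis_expansion: "x = (\<Sum>k<n. of_int (coord x k) * b k)"
    and tr_codual_eq: "k < n \<Longrightarrow> tr (codual k * x) = d * coord x k"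
proof -
  obtain c where c: "x = (\<Sum>k<n. of_int (c k) * b k)" using basis_span[OF assms] by blast
  have "coord x k = c k" if "k < n" for k
    unfolding coord_def c tr_codual_combination[OF that] using disc_nonzero by simp
  then show "x = (\<Sum>k<n. of_int (coord x k) * b k)" "k < n \<Longrightarrow> tr (codual k * x) = d * coord x k"
    using c tr_codual_combination[of k c] by (auto intro!: sum.cong)
qed

lemma coord_combination: "k < n \<Longrightarrow> coord (\<Sum>l<n. of_int (c l) * b l) k = c k"
  unfolding coord_def using disc_nonzero by (simp add: tr_codual_combination)

lemma coord_codual: "l < n \<Longrightarrow> coord (codual k) l = adj k l"
  unfolding codual_def by (rule coord_combination)

text \<open>Multiplied by d, both sides equal \<open>tr (codual i * codual j)\<close>.\<close>

lemma adj_commute: "i < n \<Longrightarrow> j < n \<Longrightarrow> adj i j = adj j i"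
  using tr_codual_eq[OF codual_alg, of i j] tr_codual_eq[OF codual_alg, of j i] disc_nonzero
  by (simp add: coord_codual mult.commute)

lemma coord_linear:
  assumes "algebraic_int x" "algebraic_int y" "k < n"
  shows "coord (x + y) k = coord x k + coord y k" "coord (of_int m * x) k = m * coord x k"
proof -
  have "d * coord (x + y) k = d * (coord x k + coord y k)"
    using assms by (simp add: tr_codual_eq[symmetric] algebraic_int_add distrib_left tr_add algebraic_int_mult codual_alg)
  then show "coord (x + y) k = coord x k + coord y k" using disc_nonzero by simp
  have "d * coord (of_int m * x) k = d * (m * coord x k)"
    using assms tr_scale[of "codual k * x" m]
    by (simp add: tr_codual_eq[symmetric] algebraic_int_mult codual_alg mult.left_commute)
  then show "coord (of_int m * x) k = m * coord x k" using disc_nonzero by simp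
qed

text \<open>Duality says that the matrices of embedding values of b and of \<open>codual / d\<close>
  are inverse to each other in one order, where the sum runs over embeddings. The matrices are
  square, so they are inverse in the other order too, where the sum runs over the basis.\<close>

lemma embedding_orthogonality:
  assumes "s < n" "t < n"
  shows "(\<Sum>k<n. hs s (b k) * hs t (codual k)) = (if s = t then of_int d else 0)"
proof -
  let ?A = "\<lambda>k s. hs s (b k)" and ?B = "\<lambda>s l. hs s (codual l) / of_int d"
  have "(\<Sum>s<n. ?A k s * ?B s l) = (if k = l then 1 else 0)" if "k < n" "l < n" for k l
  proof -
    have "(\<Sum>s<n. ?A k s * ?B s l) = (\<Sum>s<n. hs s (codual l * b k)) / of_int d"
      by (simp add: hs_mult sum_divide_distrib mult.commute)
    also have "\<dots> = of_int (tr (codual l * b k)) / of_int d"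
      by (simp add: real_tr algebraic_int_mult codual_alg basis_alg)
    finally show ?thesis using that disc_nonzero by (simp add: tr_codual_basis)
  qed
  from matrix_left_right_inverse[where A = ?A and B = ?B, OF this assms(2,1)]
  have "(\<Sum>k<n. hs t (codual k) / of_int d * hs s (b k)) = (if t = s then 1 else 0)" .
  moreover have "(\<Sum>k<n. hs t (codual k) / of_int d * hs s (b k)) = (\<Sum>k<n. hs s (b k) * hs t (codual k)) / of_int d"
    by (simp add: sum_divide_distrib mult.commute)
  ultimately show ?thesis using disc_nonzero by (auto simp: divide_eq_eq split: if_splits)
qed

lemma embeddings_separated:
  assumes "s < n" "t < n" "\<And>x. algebraic_int x \<Longrightarrow> hs s x = hs t x"
  shows "s = t"
proof (rule ccontr)
  assume "s \<noteq> t"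
  have "(\<Sum>k<n. hs s (b k) * hs t (codual k)) = (\<Sum>k<n. hs t (b k) * hs t (codual k))"
    by (simp add: assms(3) basis_alg)
  then show False using embedding_orthogonality[OF assms(1,2)] embedding_orthogonality[OF assms(2,2)]
      \<open>s \<noteq> t\<close> disc_nonzero by simp
qed

lemma disc_eq_square: "of_int d = (detf n (\<lambda>s k. hs s (b k))) ^ 2"
proof -
  have "of_int d = detf n (\<lambda>i j. real_of_int (gram i j))" by (simp add: detf_of_int detf_gram)
  also have "\<dots> = detf n (\<lambda>i j. \<Sum>s<n. hs s (b i) * hs s (b j))"
    by (simp add: gram_def real_tr basis_mult_alg hs_mult)
  also have "\<dots> = detf n (\<lambda>i s. hs s (b i)) * detf n (\<lambda>s k. hs s (b k))" by (rule detf_mult)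
  finally show ?thesis by (simp only: detf_transpose[of n "\<lambda>s k. hs s (b k)"] power2_eq_square)
qed

lemma disc_pos: "d > 0"
  using disc_eq_square disc_nonzero by (metis linorder_neqE_linordered_idom not_less of_int_less_0_iff zero_le_power2)

subsection \<open>The ring generated by pure tensors\<close>

text \<open>The image of \<open>O \<otimes> O\<close> in the ring of functions on pairs of embeddings.\<close>

inductive_set tens :: "(nat \<Rightarrow> nat \<Rightarrow> real) set" where
  pure: "algebraic_int a \<Longrightarrow> algebraic_int c \<Longrightarrow> (\<lambda>s t. hs s a * hs t c) \<in> tens"
| add: "B \<in> tens \<Longrightarrow> C \<in> tens \<Longrightarrow> (\<lambda>s t. B s t + C s t) \<in> tens"

lemma tens_scale: "B \<in> tens \<Longrightarrow> (\<lambda>s t. of_int m * B s t) \<in> tens"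
proof (induction rule: tens.induct)
  case (pure a c)
  then have "(\<lambda>s t. hs s (of_int m * a) * hs t c) \<in> tens"
    by (intro tens.pure algebraic_int_mult) auto
  then show ?case by (simp add: hs_mult hs_of_int mult.assoc)
next
  case (add B C)
  then show ?case using tens.add[OF add.IH] by (simp add: distrib_left)
qed

lemma tens_diff:
  assumes "B \<in> tens" "C \<in> tens"
  shows "(\<lambda>s t. B s t - C s t) \<in> tens"
  using tens.add[OF assms(1) tens_scale[OF assms(2), of "-1"]] by simp

lemma tens_sum: "(\<And>i. i \<in> I \<Longrightarrow> B i \<in> tens) \<Longrightarrow> (\<lambda>s t. \<Sum>i\<in>I. B i s t) \<in> tens"
proof (induction I rule: infinite_finite_induct)
  case (insert i I)
  then show ?case using tens.add[of "B i" "\<lambda>s t. \<Sum>i\<in>I. B i s t"] by simp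
qed (use tens.pure[of 0 0] hs_zero in auto)

lemma tens_mult:
  assumes "B \<in> tens" "C \<in> tens"
  shows "(\<lambda>s t. B s t * C s t) \<in> tens"
  using assms(1)
proof (induction rule: tens.induct)
  case (pure a c)
  from assms(2) show ?case
  proof (induction rule: tens.induct)
    case p: (pure a' c')
    have "(\<lambda>s t. hs s (a * a') * hs t (c * c')) \<in> tens"
      using pure p by (intro tens.pure algebraic_int_mult)
    then show ?case by (simp add: hs_mult mult_ac)
  next
    case (add B C)
    then show ?case using tens.add[OF add.IH] by (simp add: distrib_left)
  qed
next
  case (add B C)
  then show ?case using tens.add[OF add.IH] by (simp add: distrib_right)
qed

lemma tens_power: "B \<in> tens \<Longrightarrow> (\<lambda>s t. B s t ^ k) \<in> tens"
proof (induction k)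
  case 0
  then show ?case using tens.pure[of 1 1] by (simp add: hs_one)
next
  case (Suc k)
  then show ?case using tens_mult[of B] by simp
qed

lemma tens_alg: "B \<in> tens \<Longrightarrow> algebraic_int (B s t)"
  by (induction rule: tens.induct) (auto intro: algebraic_int_add algebraic_int_mult simp: hs_alg_iff)

lemma tens_sum_int: "B \<in> tens \<Longrightarrow> \<exists>m. (\<Sum>s<n. \<Sum>t<n. B s t) = of_int m"
proof (induction rule: tens.induct)
  case (pure a c)
  then have "(\<Sum>s<n. \<Sum>t<n. hs s a * hs t c) = of_int (tr a * tr c)"
    by (simp add: real_tr sum_product)
  then show ?case by blast
next
  case (add B C)
  then obtain m m' where "(\<Sum>s<n. \<Sum>t<n. B s t) = of_int m" "(\<Sum>s<n. \<Sum>t<n. C s t) = of_int m'" by blast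
  then show ?case by (intro exI[of _ "m + m'"]) (simp add: sum.distrib)
qed

text \<open>Contracting the first factor of a \<otimes> c with \<open>codual k\<close> reads off d
  times a coordinate of a. Contractions of integral tensors are therefore divisible by d, which is
  the test used to detect denominators.\<close>

lemma tens_contract:
  assumes "B \<in> tens" "k < n"
  shows "\<exists>z. algebraic_int z \<and> (\<forall>t. (\<Sum>s<n. hs s (codual k) * B s t) = of_int d * hs t z)"
  using assms(1)
proof (induction rule: tens.induct)
  case (pure a c)
  have "(\<Sum>s<n. hs s (codual k) * (hs s a * hs t c)) = of_int d * hs t (of_int (coord a k) * c)" for t
  proof -
    have "(\<Sum>s<n. hs s (codual k) * (hs s a * hs t c)) = (\<Sum>s<n. hs s (codual k * a)) * hs t c"
      by (simp add: sum_distrib_right hs_mult mult.assoc)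
    also have "\<dots> = of_int (tr (codual k * a)) * hs t c"
      using pure by (simp add: real_tr algebraic_int_mult codual_alg)
    finally show ?thesis using pure assms(2) by (simp add: tr_codual_eq hs_mult hs_of_int)
  qed
  then show ?case using pure by (intro exI[of _ "of_int (coord a k) * c"]) (auto intro: algebraic_int_mult)
next
  case (add B C)
  then obtain z z' where "algebraic_int z" "algebraic_int z'"
    "\<And>t. (\<Sum>s<n. hs s (codual k) * B s t) = of_int d * hs t z"
    "\<And>t. (\<Sum>s<n. hs s (codual k) * C s t) = of_int d * hs t z'" by blast
  then show ?case
    by (intro exI[of _ "z + z'"]) (simp add: algebraic_int_add distrib_left sum.distrib hs_add)
qed

subsection \<open>The radical of the trace form modulo a ramified prime\<close>

lemma squarefree_cofactor:
  assumes "prime p" "d = p * k"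
  shows "\<not> p dvd k"
proof
  assume "p dvd k"
  then have "p ^ 2 dvd d" unfolding assms(2) power2_eq_square by (rule mult_dvd_mono[OF dvd_refl])
  then have "p dvd 1" using squarefree_disc unfolding squarefree_def by blast
  then show False using assms(1) not_prime_unit by blast
qed

text \<open>If p divided all entries, the quotient matrix A would satisfy A * gram = k * identity.
  Then det A * d is a power of k, so p divides k, against squarefreeness.\<close>

lemma adj_not_zero_mod:
  assumes p: "prime p" "d = p * k"
  shows "\<exists>i j. i < n \<and> j < n \<and> \<not> p dvd adj i j"
proof (rule ccontr)
  assume "\<not> ?thesis"
  then have dvd: "p dvd adj i j" if "i < n" "j < n" for i j using that by blast
  define A where "A i j = adj i j div p" for i j
  have p0: "p \<noteq> 0" using p(1) by auto
  have "(\<Sum>l<n. A i l * gram l j) = (if i = j then k else 0)" if "i < n" "j < n" for i j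
  proof -
    have "p * (\<Sum>l<n. A i l * gram l j) = (\<Sum>l<n. adj i l * gram l j)"
      unfolding sum_distrib_left using that dvd by (intro sum.cong refl) (auto simp: A_def mult.assoc[symmetric])
    then show ?thesis using adj_gram[OF that] p(2) p0 by (auto split: if_splits)
  qed
  then have "detf n (\<lambda>i j. \<Sum>l<n. A i l * gram l j) = detf n (\<lambda>i j. k * (if i = j then 1 else 0))"
    by (intro detf_cong) auto
  then have "detf n A * d = k ^ n" by (simp add: detf_mult detf_scale[of n "\<lambda>_. k"] detf_one detf_gram)
  then have "p dvd k ^ n" using p(2) by (metis dvd_mult dvd_triv_left)
  then have "p dvd k" using p(1) prime_dvd_power by blast
  then show False using squarefree_cofactor[OF p] by simp
qed

text \<open>Two independent elements of the radical would make \<open>p\<^sup>2\<close> divide the discriminant.\<close>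

lemma radical_dependent:
  assumes p: "prime p" "d = p * k"
    and r: "algebraic_int r" "\<And>x. algebraic_int x \<Longrightarrow> p dvd tr (r * x)"
    and w: "algebraic_int w" "\<And>x. algebraic_int x \<Longrightarrow> p dvd tr (w * x)"
    and i: "i < n" "\<not> p dvd coord r i"
  shows "\<exists>z. algebraic_int z \<and> of_int (coord r i) * w - of_int (coord w i) * r = of_int p * z"
proof -
  have p0: "p \<noteq> 0" using p(1) by auto
  \<comment> \<open>The combination of w and r whose i-th coordinate vanishes.\<close>
  define v where "v = of_int (coord r i) * w - of_int (coord w i) * r"
  have v_alg: "algebraic_int v"
    unfolding v_def using r w by (intro algebraic_int_diff algebraic_int_mult) auto
  have v_coord: "coord v l = coord r i * coord w l - coord w i * coord r l" if "l < n" for l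
  proof -
    have "v = of_int (coord r i) * w + of_int (- coord w i) * r" by (simp add: v_def)
    then have "coord v l = coord (of_int (coord r i) * w) l + coord (of_int (- coord w i) * r) l"
      using r w that by (simp only: coord_linear(1) algebraic_int_mult algebraic_int_of_int)
    then show ?thesis
      by (simp only: coord_linear(2)[OF w(1) w(1) that] coord_linear(2)[OF r(1) r(1) that])
  qed
  have v_dvd: "p dvd tr (v * x)" if "algebraic_int x" for x
  proof -
    have "v * x = of_int (coord r i) * (w * x) + of_int (- coord w i) * (r * x)"
      by (simp add: v_def algebra_simps)
    then have "tr (v * x) = coord r i * tr (w * x) + (- coord w i) * tr (r * x)"
      using r w that by (simp only: tr_add tr_scale algebraic_int_mult algebraic_int_of_int)
    then show ?thesis using r(2)[OF that] w(2)[OF that] by simp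
  qed
  have tr_row: "tr (y * b t) = (\<Sum>l<n. coord y l * gram l t)" if "algebraic_int y" for y t
  proof -
    have "y * b t = (\<Sum>l<n. of_int (coord y l) * (b l * b t))"
      by (subst basis_expansion[OF that]) (simp add: sum_distrib_right mult.assoc)
    then show ?thesis
      by (simp add: tr_sum algebraic_int_mult basis_alg tr_scale gram_def)
  qed
  have "p dvd coord v l" if l: "l < n" for l
  proof (cases "l = i")
    case True
    then show ?thesis using v_coord[OF l] by simp
  next
    case False
    \<comment> \<open>Rows i and l of the Gram matrix are replaced by the pairings of the basis with
      r and with v, which are all divisible by p. The determinant becomes
      \<open>coord v l * coord r i * d\<close>, and p divides d only once.\<close>
    define D where "D s t = (if s = i then \<Sum>l<n. coord r l * gram l t else gram s t)" for s t
    define E where "E s t = (if s = l then \<Sum>m<n. coord v m * D m t else D s t)" for s t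
    have detE: "detf n E = coord v l * (coord r i * d)"
      unfolding E_def detf_replace_row[OF l] D_def detf_replace_row[OF i(1)] detf_gram ..
    have vD: "(\<Sum>m<n. coord v m * D m t) = tr (v * b t)" for t
    proof -
      have "coord v i = 0" using v_coord[OF i(1)] by simp
      then show ?thesis unfolding tr_row[OF v_alg] by (intro sum.cong refl) (auto simp: D_def)
    qed
    define c where "c s = (if s = i \<or> s = l then p else 1)" for s
    have "E s t = c s * (E s t div c s)" for s t
    proof -
      have "c s dvd E s t"
      proof -
        have "E l t = tr (v * b t)" unfolding E_def by (simp only: vD) simp
        moreover have "E i t = tr (r * b t)" using False by (simp add: E_def D_def tr_row[OF r(1)])
        ultimately show ?thesis
          using v_dvd[OF basis_alg] r(2)[OF basis_alg] by (auto simp: c_def)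
      qed
      then show ?thesis by simp
    qed
    then have "detf n E = detf n (\<lambda>s t. c s * (E s t div c s))" by (intro detf_cong)
    also have "\<dots> = (\<Prod>s<n. c s) * detf n (\<lambda>s t. E s t div c s)" by (rule detf_scale)
    also have "(\<Prod>s<n. c s) = (\<Prod>s\<in>{i, l}. p)"
      by (rule prod.mono_neutral_cong_right) (use i l in \<open>auto simp: c_def\<close>)
    also have "\<dots> = p * p" using False by simp
    finally have "p * p dvd detf n E" by simp
    then have "p * p dvd p * (coord v l * (coord r i * k))"
      unfolding detE p(2) by (simp only: mult.left_commute)
    then have "p dvd coord v l * (coord r i * k)" using p0 by simp
    then show ?thesis
      using p(1) i(2) squarefree_cofactor[OF p] by (simp add: prime_dvd_mult_iff)
  qed
  then have "v = of_int p * (\<Sum>l<n. of_int (coord v l div p) * b l)"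
    by (subst basis_expansion[OF v_alg]) (auto simp: sum_distrib_left mult.assoc[symmetric] simp flip: of_int_mult intro!: sum.cong)
  moreover have "algebraic_int (\<Sum>l<n. of_int (coord v l div p) * b l)"
    by (intro algebraic_int_sum algebraic_int_mult basis_alg) simp
  ultimately show ?thesis unfolding v_def by blast
qed

lemma codual_in_radical:
  assumes "d = p * k" "i < n" "algebraic_int x"
  shows "p dvd tr (codual i * x)"
  using tr_codual_eq[OF assms(3,2)] dvd_triv_left[of p "k * coord x i"]
  by (simp only: assms(1) mult.assoc)

end

section \<open>Isometries of the trace form\<close>

lemma square_sum_lessThan:
  fixes x :: "nat \<Rightarrow> 'a :: comm_ring_1"
  shows "(\<Sum>i<n. x i) ^ 2 = (\<Sum>i<n. x i ^ 2) + 2 * (\<Sum>j<n. \<Sum>i<j. x i * x j)"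
proof (induction n)
  case (Suc n)
  have "(\<Sum>i<n. x i * x n) = (\<Sum>i<n. x i) * x n" by (simp add: sum_distrib_right)
  then show ?case using Suc by (simp add: power2_eq_square algebra_simps)
qed simp

context totally_real_field
begin

text \<open>Only values at algebraic integers are constrained, so negatives and composites qualify
  as plain functions, without restriction to the ring of integers.\<close>

definition isometry :: "('k \<Rightarrow> 'k) \<Rightarrow> bool" where
  "isometry f \<longleftrightarrow> (\<forall>x. algebraic_int x \<longrightarrow> algebraic_int (f x)) \<and>
    (\<forall>x y. algebraic_int x \<longrightarrow> algebraic_int y \<longrightarrow> f (x + y) = f x + f y) \<and>
    (\<forall>m x. algebraic_int x \<longrightarrow> f (of_int m * x) = of_int m * f x) \<and>
    (\<forall>x y. algebraic_int x \<longrightarrow> algebraic_int y \<longrightarrow> tr (f x * f y) = tr (x * y)) \<and>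
    (\<forall>y. algebraic_int y \<longrightarrow> (\<exists>x. algebraic_int x \<and> f x = y))"

lemma isometryD:
  assumes "isometry f"
  shows isometry_alg: "algebraic_int x \<Longrightarrow> algebraic_int (f x)"
    and isometry_add: "algebraic_int x \<Longrightarrow> algebraic_int y \<Longrightarrow> f (x + y) = f x + f y"
    and isometry_scale: "algebraic_int x \<Longrightarrow> f (of_int m * x) = of_int m * f x"
    and isometry_tr: "algebraic_int x \<Longrightarrow> algebraic_int y \<Longrightarrow> tr (f x * f y) = tr (x * y)"
    and isometry_surj: "algebraic_int y \<Longrightarrow> \<exists>x. algebraic_int x \<and> f x = y"
  using assms by (simp_all add: isometry_def)

lemma isometry_sum:
  assumes "isometry f" "\<And>i. i \<in> I \<Longrightarrow> algebraic_int (g i)"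
  shows "f (\<Sum>i\<in>I. of_int (c i) * g i) = (\<Sum>i\<in>I. of_int (c i) * f (g i))"
proof -
  have "f 0 = 0" using isometry_scale[OF assms(1), of 0 0] by simp
  then show ?thesis using assms(2)
  proof (induction I rule: infinite_finite_induct)
    case (insert i I)
    then show ?case
      by (simp add: isometry_add[OF assms(1)] isometry_scale[OF assms(1)] algebraic_int_sum algebraic_int_mult)
  qed auto
qed

lemma isometry_minus:
  assumes f: "isometry f"
  shows "isometry (\<lambda>x. - f x)"
  unfolding isometry_def
proof (intro conjI allI impI)
  show "\<exists>x. algebraic_int x \<and> - f x = y" if "algebraic_int y" for y
    using isometry_surj[OF f, of "- y"] that by (auto simp: minus_equation_iff)
qed (simp_all add: isometryD(1-4)[OF f])

lemma isometry_compose: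
  assumes f: "isometry f" and g: "isometry g"
  shows "isometry (\<lambda>x. f (g x))"
  unfolding isometry_def
proof (intro conjI allI impI)
  show "\<exists>x. algebraic_int x \<and> f (g x) = y" if "algebraic_int y" for y
    using isometry_surj[OF f that] isometry_surj[OF g] by metis
qed (simp_all add: isometryD(1-4)[OF f] isometryD(1-4)[OF g])

lemma isometry_id: "isometry (\<lambda>x. x)"
  unfolding isometry_def by auto

text \<open>\<open>umat f / d\<close> is the matrix of \<open>f\<close> in the coordinates given by the embeddings.\<close>

definition umat :: "('k \<Rightarrow> 'k) \<Rightarrow> nat \<Rightarrow> nat \<Rightarrow> real" where
  "umat f s t = (\<Sum>k<n. hs s (f (b k)) * hs t (codual k))"

lemma umat_tens:
  assumes f: "isometry f"
  shows "umat f \<in> tens"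
  unfolding umat_def[abs_def] by (intro tens_sum tens.pure isometry_alg[OF f] basis_alg codual_alg)

text \<open>The transpose of \<open>umat f / d\<close> undoes f: the pairing of f (b k) with f x
  equals that of b k with x, and orthogonality of the embeddings then isolates hs t x.\<close>

lemma umat_apply:
  assumes f: "isometry f" and x: "algebraic_int x" and t: "t < n"
  shows "(\<Sum>s<n. umat f s t * hs s (f x)) = of_int d * hs t x"
proof -
  have "(\<Sum>s<n. umat f s t * hs s (f x)) = (\<Sum>s<n. (\<Sum>k<n. hs t (codual k) * hs s (f (b k))) * hs s (f x))"
    by (simp add: umat_def mult.commute)
  also have "\<dots> = (\<Sum>k<n. hs t (codual k) * (\<Sum>s<n. hs s (f (b k)) * hs s (f x)))"
    by (rule sum_assoc_matrix)
  also have "\<dots> = (\<Sum>k<n. hs t (codual k) * (\<Sum>s<n. hs s (b k) * hs s x))"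
  proof -
    have "(\<Sum>s<n. hs s (f (b k)) * hs s (f x)) = (\<Sum>s<n. hs s (b k) * hs s x)" for k
      using isometry_tr[OF f basis_alg x, of k] real_tr[of "f (b k) * f x"] real_tr[of "b k * x"] x
      by (simp add: hs_mult algebraic_int_mult isometry_alg[OF f] basis_alg)
    then show ?thesis by simp
  qed
  also have "\<dots> = (\<Sum>s<n. (\<Sum>k<n. hs t (codual k) * hs s (b k)) * hs s x)"
    by (rule sum_assoc_matrix[symmetric])
  also have "\<dots> = (\<Sum>s<n. (if s = t then of_int d else 0) * hs s x)"
    using t by (intro sum.cong refl) (simp add: embedding_orthogonality mult.commute[of "hs t _"])
  also have "\<dots> = of_int d * hs t x" using t by (simp add: if_distrib if_distribR cong: if_cong)
  finally show ?thesis .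
qed

lemma umat_column_norm:
  assumes f: "isometry f" and t: "t < n"
  shows "(\<Sum>s<n. umat f s t ^ 2) = of_int d ^ 2"
proof -
  have "(\<Sum>s<n. umat f s t ^ 2) = (\<Sum>s<n. \<Sum>k<n. hs t (codual k) * (umat f s t * hs s (f (b k))))"
  proof (intro sum.cong refl)
    fix s
    have "umat f s t ^ 2 = umat f s t * (\<Sum>k<n. hs s (f (b k)) * hs t (codual k))"
      by (simp add: power2_eq_square umat_def)
    then show "umat f s t ^ 2 = (\<Sum>k<n. hs t (codual k) * (umat f s t * hs s (f (b k))))"
      by (simp add: sum_distrib_left mult_ac)
  qed
  also have "\<dots> = (\<Sum>k<n. hs t (codual k) * (\<Sum>s<n. umat f s t * hs s (f (b k))))"
    by (subst sum.swap) (simp add: sum_distrib_left)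
  also have "\<dots> = of_int d * (\<Sum>k<n. hs t (b k) * hs t (codual k))"
    unfolding umat_apply[OF f basis_alg t] sum_distrib_left by (simp only: mult_ac)
  finally show ?thesis using t by (simp add: embedding_orthogonality power2_eq_square)
qed

end

text \<open>The element r spans the radical modulo p, and \<open>tr (r * r)\<close> is divisible by
  p exactly once. The data q and c record that the sum of the tensors b l \<otimes> codual l, whose
  values at pairs of embeddings form d times the identity matrix, is congruent to q * (r \<otimes>
  r) modulo p.\<close>

locale ramified_prime = totally_real_field hs b n d for hs :: "nat \<Rightarrow> 'k :: number_field \<Rightarrow> real" and b n d +
  fixes p k :: int and r :: 'k and q :: int and c :: "nat \<Rightarrow> int"
  assumes p: "prime p" "d = p * k"
    and r_alg: "algebraic_int r"
    and r_radical: "algebraic_int x \<Longrightarrow> p dvd tr (r * x)"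
    and r_norm: "\<not> p * p dvd tr (r * r)"
    and radical: "algebraic_int w \<Longrightarrow> (\<And>x. algebraic_int x \<Longrightarrow> p dvd tr (w * x)) \<Longrightarrow>
      \<exists>e z. algebraic_int z \<and> w = of_int e * r + of_int p * z"
    and c_sum: "(\<Sum>l<n. of_int (c l) * b l) = of_int q * r"
    and codual_mod: "l < n \<Longrightarrow> \<exists>z. algebraic_int z \<and> codual l = of_int (c l) * r + of_int p * z"
begin

lemma p_nonzero: "p \<noteq> 0" and p_pos: "p > 0"
  using p(1) prime_gt_0_int[of p] by auto

text \<open>The radical is stable under multiplication by algebraic integers, so its line consists
  of common eigenvectors modulo p.\<close>

lemma r_eigen:
  assumes "algebraic_int x"
  shows "\<exists>e z. algebraic_int z \<and> x * r = of_int e * r + of_int p * z"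
proof (rule radical)
  show "algebraic_int (x * r)" using assms r_alg by (rule algebraic_int_mult)
  show "p dvd tr (x * r * y)" if "algebraic_int y" for y
    using r_radical[of "x * y"] assms that by (simp add: algebraic_int_mult mult_ac)
qed

lemma tr_eq_sum_coord:
  assumes "algebraic_int x"
  shows "tr x = (\<Sum>l<n. coord (x * b l) l)"
proof -
  have "of_int d * (\<Sum>s<n. hs s x) = (\<Sum>s<n. hs s x * (\<Sum>l<n. hs s (b l) * hs s (codual l)))"
    by (simp add: embedding_orthogonality sum_distrib_left mult.commute)
  also have "\<dots> = (\<Sum>l<n. \<Sum>s<n. hs s (codual l * (x * b l)))"
    by (simp add: sum_distrib_left hs_mult mult_ac) (rule sum.swap)
  also have "\<dots> = (\<Sum>l<n. of_int (tr (codual l * (x * b l))))"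
    using assms by (simp only: real_tr algebraic_int_mult codual_alg basis_alg)
  also have "\<dots> = of_int d * of_int (\<Sum>l<n. coord (x * b l) l)"
    using assms by (simp add: tr_codual_eq algebraic_int_mult basis_alg sum_distrib_left)
  finally show ?thesis using disc_nonzero by (intro tr_eqI assms) simp
qed

text \<open>Multiplication by \<open>r\<close> has rank one modulo \<open>p\<close>, so its trace modulo \<open>p\<close>, which vanishes,
  is the eigenvalue of \<open>r\<close> on \<open>r\<close>.\<close>

lemma r_square: "\<exists>z. algebraic_int z \<and> r * r = of_int p * z"
proof -
  have "\<forall>l. \<exists>e z. algebraic_int z \<and> b l * r = of_int e * r + of_int p * z"
    using r_eigen basis_alg by blast
  from choice[OF this] obtain e where "\<forall>l. \<exists>z. algebraic_int z \<and> b l * r = of_int (e l) * r + of_int p * z"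
    by blast
  from choice[OF this] obtain z where z: "\<And>l. algebraic_int (z l)" "\<And>l. b l * r = of_int (e l) * r + of_int p * z l"
    by blast
  define m where "m = (\<Sum>l<n. coord r l * e l)"
  have "coord (r * b l) l = e l * coord r l + p * coord (z l) l" if "l < n" for l
  proof -
    have "coord (r * b l) l = coord (of_int (e l) * r + of_int p * z l) l" using z(2) by (simp add: mult.commute)
    also have "\<dots> = coord (of_int (e l) * r) l + coord (of_int p * z l) l"
      by (rule coord_linear(1)) (use z(1) r_alg that in \<open>auto intro: algebraic_int_mult\<close>)
    finally show ?thesis
      unfolding coord_linear(2)[OF r_alg r_alg that] coord_linear(2)[OF z(1) z(1) that] .
  qed
  then have "tr r = m + p * (\<Sum>l<n. coord (z l) l)"
    by (simp add: tr_eq_sum_coord[OF r_alg] m_def sum.distrib sum_distrib_left mult.commute[of "e _"])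
  moreover have "p dvd tr r" using r_radical[of 1] by simp
  ultimately have "p dvd m" by (metis dvd_add_left_iff dvd_triv_left)
  then obtain m' where m': "m = p * m'" by blast
  define y where "y = of_int m' * r + (\<Sum>l<n. of_int (coord r l) * z l)"
  have "r * r = (\<Sum>l<n. of_int (coord r l) * b l) * r" using basis_expansion[OF r_alg] by simp
  also have "\<dots> = (\<Sum>l<n. of_int (coord r l) * (of_int (e l) * r + of_int p * z l))"
    by (simp add: sum_distrib_right mult.assoc z(2))
  also have "\<dots> = of_int m * r + of_int p * (\<Sum>l<n. of_int (coord r l) * z l)"
    by (simp add: m_def sum_distrib_left sum_distrib_right distrib_left sum.distrib mult_ac)
  also have "\<dots> = of_int p * y" by (simp add: m' y_def algebra_simps)
  finally have "r * r = of_int p * y" .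
  moreover have "algebraic_int y"
    unfolding y_def using z(1) r_alg by (intro algebraic_int_add algebraic_int_sum algebraic_int_mult) auto
  ultimately show ?thesis by blast
qed

text \<open>The square of this number is hs s z * hs t z, where r * r = p * z.\<close>

lemma r_product_divisible: "algebraic_int (hs s r * hs t r / of_int p)"
proof (rule algebraic_int_power2D)
  obtain z where z: "algebraic_int z" "r * r = of_int p * z" using r_square by blast
  have "hs s r * hs s r = of_int p * hs s z" for s
    using arg_cong[OF z(2), of "hs s"] by (simp add: hs_mult hs_of_int)
  then have "(hs s r * hs t r / of_int p) ^ 2 = hs s z * hs t z"
    using p_nonzero by (simp add: power2_eq_square field_simps)
  then show "algebraic_int ((hs s r * hs t r / of_int p) ^ 2)"
    using z(1) by (simp add: algebraic_int_mult hs_alg_iff)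
qed

text \<open>For p = 2, the square of tr r is tr (r * r) plus twice the sum of the products hs i r *
  hs j r over i < j. These products are 2 times algebraic integers, and their sum is rational, so
  the last term is divisible by 4. Since tr r is even, 4 divides tr (r * r), against
  \<open>r_norm\<close>. The conclusion is the part of Stickelberger's theorem that excludes
  discriminants congruent to 2 modulo 4.\<close>

lemma p_odd: "p \<noteq> 2"
proof
  assume p2: "p = 2"
  define E where "E = (\<Sum>j<n. \<Sum>i<j. hs i r * hs j r / 2)"
  have "algebraic_int E"
    unfolding E_def using r_product_divisible unfolding p2 by (intro algebraic_int_sum) simp
  have "real_of_int (tr r) ^ 2 = (\<Sum>i<n. hs i r ^ 2) + 2 * (\<Sum>j<n. \<Sum>i<j. hs i r * hs j r)"
    unfolding real_tr[OF r_alg] by (rule square_sum_lessThan)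
  also have "(\<Sum>i<n. hs i r ^ 2) = of_int (tr (r * r))"
    by (simp add: real_tr algebraic_int_mult r_alg hs_mult power2_eq_square)
  also have "(\<Sum>j<n. \<Sum>i<j. hs i r * hs j r) = 2 * E"
    by (simp add: E_def sum_distrib_left)
  finally have E: "real_of_int (tr r) ^ 2 = of_int (tr (r * r)) + 4 * E" by simp
  then have "E = of_int (tr r ^ 2 - tr (r * r)) / 4" by simp
  then have "E \<in> \<rat>" by (metis Rats_divide Rats_number_of Rats_of_int)
  with \<open>algebraic_int E\<close> obtain m where "E = of_int m"
    using rational_algebraic_int_is_int by (auto elim: Ints_cases)
  with E have "real_of_int (tr r ^ 2) = of_int (tr (r * r) + 4 * m)" by simp
  then have eq: "tr r ^ 2 = tr (r * r) + 4 * m" by (simp only: of_int_eq_iff)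
  have "2 dvd tr r" using r_radical[of 1] p2 by simp
  then have "2 * 2 dvd tr r ^ 2" unfolding power2_eq_square by (rule mult_dvd_mono) fact
  then have "4 dvd tr (r * r) + 4 * m" unfolding eq[symmetric] by simp
  then have "4 dvd tr (r * r)" by (metis dvd_add_left_iff dvd_triv_left)
  then show False using r_norm p2 by simp
qed

text \<open>As f preserves the radical, f r is congruent to e * r modulo p. The norms of both sides
  agree modulo p * p, because the cross term pairs with the radical; tr (r * r) is p times a unit
  modulo p, so e * e is 1 modulo p.\<close>

lemma isometry_r:
  assumes f: "isometry f"
  obtains e z where "e = 1 \<or> e = -1" "algebraic_int z" "f r = of_int e * r + of_int p * z"
proof -
  have "\<exists>e z. algebraic_int z \<and> f r = of_int e * r + of_int p * z"
  proof (rule radical)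
    show "algebraic_int (f r)" by (rule isometry_alg[OF f r_alg])
    show "p dvd tr (f r * y)" if y: "algebraic_int y" for y
    proof -
      obtain x where "algebraic_int x" "f x = y" using isometry_surj[OF f y] by blast
      then show ?thesis using isometry_tr[OF f r_alg, of x] r_radical[of x] by simp
    qed
  qed
  then obtain e z where z: "algebraic_int z" "f r = of_int e * r + of_int p * z" by blast
  have "(a * r + P * z) * (a * r + P * z) = a * a * (r * r) + (2 * a * P * (r * z) + P * P * (z * z))" for a P :: 'k
    by (simp add: algebra_simps)
  then have "f r * f r = of_int (e * e) * (r * r) + (of_int (2 * e * p) * (r * z) + of_int (p * p) * (z * z))"
    unfolding z(2) by simp
  then have "tr (f r * f r) = e * e * tr (r * r) + (2 * e * p * tr (r * z) + p * p * tr (z * z))"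
    using r_alg z(1) by (simp only: tr_add tr_scale algebraic_int_mult algebraic_int_add algebraic_int_of_int)
  moreover obtain m where m: "tr (r * z) = p * m" using r_radical[OF z(1)] by blast
  ultimately have "tr (r * r) - e * e * tr (r * r) = p * p * (2 * e * m + tr (z * z))"
    unfolding isometry_tr[OF f r_alg r_alg] by (simp add: algebra_simps)
  moreover obtain l where l: "tr (r * r) = p * l" using r_radical[OF r_alg] by blast
  ultimately have "p * ((1 - e * e) * l) = p * (p * (2 * e * m + tr (z * z)))" by (simp add: algebra_simps)
  then have "p dvd (1 - e * e) * l" using p_nonzero by (metis dvd_triv_left mult_cancel_left)
  moreover have "\<not> p dvd l" using r_norm unfolding l by (simp add: p_nonzero)
  ultimately have "p dvd 1 - e * e" using p(1) prime_dvd_mult_iff by blast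
  also have "1 - e * e = (1 - e) * (1 + e)" by (simp add: algebra_simps)
  finally have "p dvd (1 - e) * (1 + e)" .
  then have "p dvd 1 - e \<or> p dvd 1 + e" using p(1) by (simp add: prime_dvd_mult_iff)
  then have "\<exists>e' m. (e' = 1 \<or> e' = -1) \<and> e = e' + p * m"
  proof
    assume "p dvd 1 - e"
    then obtain m where "1 - e = p * m" by blast
    then show ?thesis by (intro exI[of _ 1] exI[of _ "- m"]) simp
  next
    assume "p dvd 1 + e"
    then obtain m where "1 + e = p * m" by blast
    then show ?thesis by (intro exI[of _ "-1"] exI[of _ m]) simp
  qed
  then obtain e' m where e': "e' = 1 \<or> e' = -1" "e = e' + p * m" by blast
  show ?thesis
  proof (rule that[OF e'(1)])
    show "algebraic_int (of_int m * r + z)" using r_alg z(1) by (intro algebraic_int_add algebraic_int_mult) auto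
    show "f r = of_int e' * r + of_int p * (of_int m * r + z)" unfolding z(2) e'(2) by (simp add: algebra_simps)
  qed
qed

text \<open>Modulo p the second factors \<open>codual l\<close> become c l * r. By linearity the
  first factors then combine to f applied to q * r, and f r is e * r modulo p.\<close>

lemma umat_mod:
  assumes f: "isometry f" and fr: "f r = of_int e * r + of_int p * z" and z: "algebraic_int z"
  obtains B where "B \<in> tens" "\<And>s t. umat f s t = of_int (q * e) * (hs s r * hs t r) + of_int p * B s t"
proof -
  have "\<forall>l. \<exists>z. l < n \<longrightarrow> algebraic_int z \<and> codual l = of_int (c l) * r + of_int p * z"
    using codual_mod by blast
  from choice[OF this] obtain y where y: "\<And>l. l < n \<Longrightarrow> algebraic_int (y l)"
    "\<And>l. l < n \<Longrightarrow> codual l = of_int (c l) * r + of_int p * y l" by blast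
  define B where "B s t = of_int q * (hs s z * hs t r) + (\<Sum>l<n. hs s (f (b l)) * hs t (y l))" for s t
  have "B \<in> tens"
    unfolding B_def[abs_def] using y(1)
    by (intro tens.add tens_scale tens_sum tens.pure z r_alg isometry_alg[OF f] basis_alg) auto
  moreover have "umat f s t = of_int (q * e) * (hs s r * hs t r) + of_int p * B s t" for s t
  proof -
    have "umat f s t = (\<Sum>l<n. of_int (c l) * hs s (f (b l)) * hs t r + of_int p * (hs s (f (b l)) * hs t (y l)))"
      unfolding umat_def by (intro sum.cong refl) (simp add: y(2) hs_add hs_mult hs_of_int algebra_simps)
    also have "\<dots> = hs s (\<Sum>l<n. of_int (c l) * f (b l)) * hs t r + of_int p * (\<Sum>l<n. hs s (f (b l)) * hs t (y l))"
      by (simp add: sum.distrib hs_sum hs_mult hs_of_int sum_distrib_left sum_distrib_right)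
    also have "(\<Sum>l<n. of_int (c l) * f (b l)) = f (of_int q * r)"
      unfolding c_sum[symmetric] by (rule isometry_sum[OF f, symmetric]) (rule basis_alg)
    also have "\<dots> = of_int q * (of_int e * r + of_int p * z)"
      unfolding isometry_scale[OF f r_alg] fr ..
    finally have "umat f s t = of_int q * (of_int e * hs s r + of_int p * hs s z) * hs t r +
        of_int p * (\<Sum>l<n. hs s (f (b l)) * hs t (y l))"
      unfolding hs_mult hs_add hs_of_int .
    moreover have "u * (v * R + P * Z) * T + P * Y = u * v * (R * T) + P * (u * (Z * T) + Y)"
      for u v R P Z T Y :: real by (simp add: algebra_simps)
    ultimately show ?thesis by (simp only: B_def of_int_mult)
  qed
  ultimately show ?thesis by (rule that)
qed

lemma umat_divisible:
  assumes f: "isometry f"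
  shows "algebraic_int (umat f s t / of_int p)"
proof -
  obtain e z where ez: "algebraic_int z" "f r = of_int e * r + of_int p * z" by (rule isometry_r[OF f])
  obtain B where B: "B \<in> tens" "umat f s t = of_int (q * e) * (hs s r * hs t r) + of_int p * B s t"
    using umat_mod[OF f ez(2,1)] by metis
  have "umat f s t / of_int p = of_int (q * e) * (hs s r * hs t r / of_int p) + B s t"
    unfolding B(2) using p_nonzero by (simp add: add_divide_distrib)
  also have "algebraic_int \<dots>"
    by (intro algebraic_int_add algebraic_int_mult[OF algebraic_int_of_int] r_product_divisible tens_alg[OF B(1)])
  finally show ?thesis .
qed

end

section \<open>From congruences at each prime to permutations of the embeddings\<close>

context totally_real_field
begin

text \<open>The element r is some \<open>codual j\<close> with p not dividing
  \<open>adj j j\<close>. Such a diagonal entry exists because \<open>adj\<close> has rank one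
  modulo p, so the square of an entry that is nonzero modulo p is congruent to a product of two
  diagonal entries.\<close>

lemma ramified_prime_exists:
  assumes p: "prime p" "d = p * k"
  shows "\<exists>r q c. ramified_prime hs b n d p k r q c"
proof -
  have p0: "p \<noteq> 0" using p(1) by auto
  note rad = codual_in_radical[OF p(2)]
  obtain i j where ij: "i < n" "j < n" "\<not> p dvd adj i j" using adj_not_zero_mod[OF p] by blast
  have "\<exists>z. algebraic_int z \<and> of_int (adj i j) * codual j - of_int (adj j j) * codual i = of_int p * z"
    using radical_dependent[OF p codual_alg rad[OF ij(1)] codual_alg rad[OF ij(2)] ij(2)] ij
    by (simp add: coord_codual)
  then obtain z where z: "algebraic_int z" "of_int (adj i j) * codual j - of_int (adj j j) * codual i = of_int p * z" by blast
  have "of_int (adj i j) * codual j = of_int (adj j j) * codual i + of_int p * z"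
    using z(2) by (simp add: algebra_simps)
  then have "coord (of_int (adj i j) * codual j) i = coord (of_int (adj j j) * codual i + of_int p * z) i" by simp
  also have "\<dots> = coord (of_int (adj j j) * codual i) i + coord (of_int p * z) i"
    by (rule coord_linear(1)) (use z(1) codual_alg ij in \<open>auto intro: algebraic_int_mult\<close>)
  finally have "adj i j * adj j i = adj j j * adj i i + p * coord z i"
    unfolding coord_linear(2)[OF codual_alg codual_alg ij(1)] coord_linear(2)[OF z(1) z(1) ij(1)] coord_codual[OF ij(1)] .
  then have "adj i j * adj i j = adj j j * adj i i + p * coord z i"
    using adj_commute[OF ij(1,2)] by simp
  then have nz: "\<not> p dvd adj j j"
    using ij(3) p(1) by (metis dvd_add dvd_mult2 dvd_triv_left prime_dvd_mult_iff)
  define r where "r = codual j"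
  \<comment> \<open>The inverse u of \<open>adj j j\<close> modulo p normalises the coefficient: an
    element w of the radical is u * coord w j times r modulo p. For w = \<open>codual l\<close> this
    gives c l = u * adj l j, and by symmetry of \<open>adj\<close> these coefficients sum b to u *
    r, hence q = u.\<close>
  have "coprime (adj j j) p" using nz p(1) by (metis coprime_commute prime_imp_coprime)
  then obtain u v where "u * adj j j + v * p = 1" using bezout_int[of "adj j j" p] by auto
  then have v: "1 = adj j j * u + p * v" by (simp add: mult.commute)
  have gen: "\<exists>z. algebraic_int z \<and> w = of_int (u * coord w j) * r + of_int p * z"
    if w: "algebraic_int w" "\<And>x. algebraic_int x \<Longrightarrow> p dvd tr (w * x)" for w
  proof -
    obtain z where z: "algebraic_int z" "of_int (adj j j) * w - of_int (coord w j) * r = of_int p * z"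
      using radical_dependent[OF p codual_alg rad[OF ij(2)] w ij(2)] nz ij unfolding r_def by (auto simp: coord_codual)
    have "w = of_int (adj j j * u + p * v) * w" by (simp flip: v)
    also have "\<dots> = of_int u * (of_int (adj j j) * w) + of_int p * (of_int v * w)" by (simp add: algebra_simps)
    also have "of_int (adj j j) * w = of_int (coord w j) * r + of_int p * z" using z(2) by (simp add: algebra_simps)
    finally have "w = of_int (u * coord w j) * r + of_int p * (of_int u * z + of_int v * w)" by (simp add: algebra_simps)
    then show ?thesis using z(1) w(1) by (intro exI[of _ "of_int u * z + of_int v * w"]) (auto intro!: algebraic_int_add algebraic_int_mult)
  qed
  have "ramified_prime hs b n d p k r u (\<lambda>l. u * adj l j)"
  proof
    show "prime p" "d = p * k" by (fact p)+
    show "algebraic_int r" by (simp add: r_def codual_alg)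
    show "p dvd tr (r * x)" if "algebraic_int x" for x unfolding r_def by (rule rad[OF ij(2) that])
    have "tr (r * r) = p * (k * adj j j)"
      unfolding r_def tr_codual_eq[OF codual_alg ij(2)] coord_codual[OF ij(2)]
      using p(2) by (metis mult.assoc)
    then show "\<not> p * p dvd tr (r * r)"
      using p(1) nz squarefree_cofactor[OF p] p0 by (simp add: prime_dvd_mult_iff)
    show "\<exists>e z. algebraic_int z \<and> w = of_int e * r + of_int p * z"
      if "algebraic_int w" "\<And>x. algebraic_int x \<Longrightarrow> p dvd tr (w * x)" for w
      using gen[OF that] by blast
    show "(\<Sum>l<n. of_int (u * adj l j) * b l) = of_int u * r"
      unfolding r_def codual_def sum_distrib_left
    proof (intro sum.cong refl)
      fix l assume "l \<in> {..<n}"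
      then have "adj l j = adj j l" using adj_commute ij(2) by blast
      then show "of_int (u * adj l j) * b l = of_int u * (of_int (adj j l) * b l)" by simp
    qed
    show "\<exists>z. algebraic_int z \<and> codual l = of_int (u * adj l j) * r + of_int p * z" if "l < n" for l
      using gen[OF codual_alg rad[OF that]] ij(2) by (simp add: coord_codual)
  qed
  then show ?thesis by blast
qed

text \<open>For d = p * k the number k * (umat / d) is umat / p, so integrality at each single prime
  is all that has to be glued.\<close>

lemma umat_alg:
  assumes f: "isometry f"
  shows "algebraic_int (umat f s t / of_int d)"
proof -
  have "umat f s t / of_int d \<in> {x :: real. algebraic_int x}"
  proof (rule squarefree_quotients_generate[OF squarefree_disc])
    show "of_int d * (umat f s t / of_int d) \<in> {x. algebraic_int x}"
      using tens_alg[OF umat_tens[OF f], of s t] disc_nonzero by simp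
    fix p k :: int assume pk: "prime p" "d = p * k"
    then obtain r q c where "ramified_prime hs b n d p k r q c" using ramified_prime_exists by blast
    then interpret ramified_prime hs b n d p k r q c .
    have "of_int k * (umat f s t / of_int d) = umat f s t / of_int p"
      using disc_nonzero pk(2) by simp
    then show "of_int k * (umat f s t / of_int d) \<in> {x. algebraic_int x}"
      using umat_divisible[OF f] by simp
  qed (auto intro: algebraic_int_add algebraic_int_mult)
  then show ?thesis by simp
qed

lemma decreasing_integers_stabilise:
  fixes S :: "nat \<Rightarrow> real"
  assumes "\<And>m. \<exists>k. S m = of_int k" "\<And>m. S m \<ge> 0" "\<And>m. S (Suc m) \<le> S m"
  obtains m where "S (Suc m) = S m"
proof (rule ccontr)
  assume "\<not> thesis"
  then have ne: "S (Suc m) \<noteq> S m" for m using that by blast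
  have "S m \<le> S 0 - of_nat m" for m
  proof (induction m)
    case (Suc m)
    obtain k k' where k: "S m = of_int k" "S (Suc m) = of_int k'" using assms(1) by metis
    have "S (Suc m) < S m" using assms(3)[of m] ne[of m] by simp
    then have "k' \<le> k - 1" unfolding k by simp
    then have "real_of_int k' \<le> real_of_int (k - 1)" by (simp only: of_int_le_iff)
    then have "S (Suc m) \<le> S m - 1" unfolding k by simp
    then show ?case using Suc by simp
  qed simp
  from this[of "nat \<lceil>S 0\<rceil> + 1"] assms(2)[of "nat \<lceil>S 0\<rceil> + 1"] show False by linarith
qed

text \<open>The entries of \<open>umat f / d\<close> are algebraic integers bounded by 1 in absolute value. The sum of
  their \<open>2 m\<close>-th powers is a rational integer that decreases with \<open>m\<close>.\<close>

lemma umat_entries: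
  assumes f: "isometry f" and st: "s < n" "t < n"
  shows "umat f s t = 0 \<or> (umat f s t / of_int d) ^ 2 = 1"
proof -
  define u where "u s t = umat f s t / of_int d" for s t
  have col: "(\<Sum>s<n. u s t ^ 2) = 1" if "t < n" for t
    using umat_column_norm[OF f that] disc_nonzero
    by (simp add: u_def power_divide flip: sum_divide_distrib)
  have u1: "u s t ^ 2 \<le> 1" if "s < n" "t < n" for s t
  proof -
    have "u s t ^ 2 \<le> (\<Sum>s<n. u s t ^ 2)" using that by (intro member_le_sum) auto
    then show ?thesis using col that by simp
  qed
  define S where "S m = (\<Sum>s<n. \<Sum>t<n. (u s t ^ 2) ^ m)" for m
  obtain m where m: "S (Suc m) = S m"
  proof (rule decreasing_integers_stabilise[of S])
    fix m
    have "algebraic_int (S m)"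
      unfolding S_def u_def using umat_alg[OF f] by (intro algebraic_int_sum algebraic_int_power)
    moreover have "S m \<in> \<rat>"
    proof -
      obtain l where l: "(\<Sum>s<n. \<Sum>t<n. umat f s t ^ (2 * m)) = of_int l"
        using tens_sum_int[OF tens_power[OF umat_tens[OF f]]] by blast
      have "S m = (\<Sum>s<n. \<Sum>t<n. umat f s t ^ (2 * m)) / of_int d ^ (2 * m)"
        by (simp add: S_def u_def sum_divide_distrib power_divide flip: power_mult)
      then show ?thesis unfolding l by simp
    qed
    ultimately show "\<exists>k. S m = of_int k"
      using rational_algebraic_int_is_int by (auto elim: Ints_cases)
    show "S m \<ge> 0" unfolding S_def by (intro sum_nonneg) auto
    show "S (Suc m) \<le> S m"
      unfolding S_def by (intro sum_mono power_decreasing) (auto simp: u1)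
  qed
  have "(\<Sum>s<n. \<Sum>t<n. (u s t ^ 2) ^ m - (u s t ^ 2) ^ Suc m) = 0"
    using m by (simp add: S_def sum_subtractf)
  moreover have nonneg: "(u s t ^ 2) ^ m - (u s t ^ 2) ^ Suc m \<ge> 0" if "s < n" "t < n" for s t
    using power_decreasing[of m "Suc m" "u s t ^ 2"] u1[OF that] by simp
  ultimately have "(\<Sum>t<n. (u s t ^ 2) ^ m - (u s t ^ 2) ^ Suc m) = 0"
    using st by (subst (asm) sum_nonneg_eq_0_iff) (auto intro!: sum_nonneg)
  then have "(u s t ^ 2) ^ m - (u s t ^ 2) ^ Suc m = 0"
    using st nonneg by (subst (asm) sum_nonneg_eq_0_iff) auto
  then have "(u s t ^ 2) ^ m * (1 - u s t ^ 2) = 0" by (simp add: algebra_simps)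
  then have "u s t = 0 \<or> u s t ^ 2 = 1" by auto
  then show ?thesis using disc_nonzero by (auto simp: u_def)
qed

text \<open>The squares in a column of \<open>umat f\<close> are 0 or the square of d and sum to the
  square of d, so exactly one entry of the column survives.\<close>

lemma isometry_signed_permutation:
  assumes f: "isometry f" and t: "t < n"
  shows "\<exists>s<n. umat f s t ^ 2 = of_int d ^ 2 \<and> (\<forall>s'<n. s' \<noteq> s \<longrightarrow> umat f s' t = 0) \<and>
    (\<forall>x. algebraic_int x \<longrightarrow> of_int d * hs t x = umat f s t * hs s (f x))"
proof -
  have ent: "umat f s t = 0 \<or> umat f s t ^ 2 = of_int d ^ 2" if "s < n" for s
    using umat_entries[OF f that t] disc_nonzero by (auto simp: power_divide)
  have "\<exists>s<n. umat f s t \<noteq> 0"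
  proof (rule ccontr)
    assume "\<not> ?thesis"
    then have "(\<Sum>s<n. umat f s t ^ 2) = 0" by simp
    then show False using umat_column_norm[OF f t] disc_nonzero by simp
  qed
  then obtain s where s: "s < n" "umat f s t \<noteq> 0" by blast
  then have s2: "umat f s t ^ 2 = of_int d ^ 2" using ent by blast
  have rest: "(\<Sum>s'\<in>{..<n} - {s}. umat f s' t ^ 2) = 0"
    using umat_column_norm[OF f t] s by (simp add: sum.remove[of _ s] s2)
  have zero: "umat f s' t = 0" if "s' < n" "s' \<noteq> s" for s'
    using rest that by (subst (asm) sum_nonneg_eq_0_iff) auto
  have "of_int d * hs t x = umat f s t * hs s (f x)" if "algebraic_int x" for x
  proof -
    have "of_int d * hs t x = (\<Sum>s'<n. umat f s' t * hs s' (f x))" using umat_apply[OF f that t] by simp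
    also have "\<dots> = (\<Sum>s'\<in>{s}. umat f s' t * hs s' (f x))"
      by (rule sum.mono_neutral_right) (use s zero in auto)
    finally show ?thesis by simp
  qed
  then show ?thesis using s(1) s2 zero by blast
qed

text \<open>The signed permutation shows that one embedding of f 1 has square 1, and embeddings are
  injective.\<close>

lemma isometry_one:
  assumes f: "isometry f"
  shows "f 1 = 1 \<or> f 1 = -1"
proof -
  obtain s where "of_int d * hs 0 1 = umat f s 0 * hs s (f 1)" "umat f s 0 ^ 2 = of_int d ^ 2"
    using isometry_signed_permutation[OF f degree_positive] algebraic_int_of_int[of 1] by auto
  then have "of_int d ^ 2 = of_int d ^ 2 * hs s (f 1) ^ 2" by (metis hs_one mult.right_neutral power_mult_distrib)
  then have "hs s (f 1 * f 1) = hs s 1" using disc_nonzero by (simp add: hs_mult hs_one power2_eq_square)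
  then have "f 1 * f 1 = 1" by (simp only: hs_eq_iff)
  then show ?thesis by (simp add: square_eq_1_iff)
qed

text \<open>An isometry that fixes 1 permutes the embeddings, hence it is multiplicative.\<close>

definition induces :: "('k \<Rightarrow> 'k) \<Rightarrow> (nat \<Rightarrow> nat) \<Rightarrow> bool" where
  "induces f \<sigma> \<longleftrightarrow> (\<forall>t<n. \<sigma> t < n \<and> (\<forall>x. algebraic_int x \<longrightarrow> hs t x = hs (\<sigma> t) (f x)) \<and>
    (\<forall>s<n. umat f s t = (if s = \<sigma> t then of_int d else 0)))"

lemma inducesD:
  assumes "induces f \<sigma>" "t < n"
  shows "\<sigma> t < n" "algebraic_int x \<Longrightarrow> hs t x = hs (\<sigma> t) (f x)"
    and "s < n \<Longrightarrow> umat f s t = (if s = \<sigma> t then of_int d else 0)"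
  using assms by (simp_all add: induces_def)

lemma isometry_permutation:
  assumes f: "isometry f" and one: "f 1 = 1"
  shows "\<exists>\<sigma>. induces f \<sigma>"
proof -
  have "\<exists>s<n. (\<forall>x. algebraic_int x \<longrightarrow> hs t x = hs s (f x)) \<and> (\<forall>s'<n. umat f s' t = (if s' = s then of_int d else 0))"
    if "t < n" for t
  proof -
    obtain s where s: "s < n" "\<And>s'. s' < n \<Longrightarrow> s' \<noteq> s \<Longrightarrow> umat f s' t = 0"
      "\<And>x. algebraic_int x \<Longrightarrow> of_int d * hs t x = umat f s t * hs s (f x)"
      using isometry_signed_permutation[OF f \<open>t < n\<close>] by blast
    \<comment> \<open>Evaluation at 1, which f fixes, determines the sign of the entry.\<close>
    from s(3)[of 1] have u: "umat f s t = of_int d" using one algebraic_int_of_int[of 1] by (simp add: hs_one)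
    then show ?thesis using s disc_nonzero by (intro exI[of _ s]) auto
  qed
  then have "\<forall>t. \<exists>s. t < n \<longrightarrow> s < n \<and> (\<forall>x. algebraic_int x \<longrightarrow> hs t x = hs s (f x)) \<and>
      (\<forall>s'<n. umat f s' t = (if s' = s then of_int d else 0))" by blast
  from choice[OF this] show ?thesis unfolding induces_def by blast
qed

lemma isometry_mult:
  assumes f: "isometry f" and one: "f 1 = 1" and xy: "algebraic_int x" "algebraic_int y"
  shows "f (x * y) = f x * f y"
proof -
  obtain \<sigma> where ind: "induces f \<sigma>" using isometry_permutation[OF f one] by blast
  note \<sigma> = inducesD(2)[OF ind degree_positive]
  have "hs (\<sigma> 0) (f (x * y)) = hs (\<sigma> 0) (f x * f y)"
    using xy by (simp only: \<sigma>[symmetric] algebraic_int_mult hs_mult)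
  then show ?thesis by (simp only: hs_eq_iff)
qed

lemma isometry_fixed_embedding:
  assumes "\<And>x. algebraic_int x \<Longrightarrow> hs t x = hs t (f x)" "algebraic_int x"
  shows "f x = x"
  using assms(1)[OF assms(2)] by (simp only: hs_eq_iff)

end

context ramified_prime
begin

text \<open>The idempotents \<open>umat f / d\<close> and \<open>umat id / d\<close> of \<open>K \<otimes> K\<close> are orthogonal if \<open>f\<close> is not the
  identity. If \<open>f\<close> fixes \<open>r\<close> modulo \<open>p\<close>, then \<open>k\<close> times their difference is integral, and so is
  \<open>2 * k\<^sup>2\<close> times the idempotent of the identity, whose denominator is divisible by the odd prime \<open>p\<close>.\<close>

lemma isometry_trivial_if_fixes_r:
  assumes f: "isometry f" and one: "f 1 = 1"
    and fr: "f r = r + of_int p * z" and z: "algebraic_int z"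
  shows "algebraic_int x \<Longrightarrow> f x = x"
proof (rule ccontr)
  assume x: "algebraic_int x" "f x \<noteq> x"
  obtain \<sigma> where ind: "induces f \<sigma>" using isometry_permutation[OF f one] by blast
  have fixfree: "\<sigma> t \<noteq> t" if "t < n" for t
    using isometry_fixed_embedding[of t f x] inducesD(2)[OF ind that] x by auto
  have id: "umat (\<lambda>x. x) s t = (if s = t then of_int d else 0)" if "s < n" "t < n" for s t
    using embedding_orthogonality[OF that] by (simp add: umat_def)
  obtain B where B: "B \<in> tens" "\<And>s t. umat f s t = of_int (q * 1) * (hs s r * hs t r) + of_int p * B s t"
    using umat_mod[OF f, of 1 z] fr z by auto
  obtain C where C: "C \<in> tens" "\<And>s t. umat (\<lambda>x. x) s t = of_int (q * 1) * (hs s r * hs t r) + of_int p * C s t"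
    using umat_mod[OF isometry_id, of 1 0] by auto
  define D where "D s t = B s t - C s t" for s t
  have D: "D s t = of_int k * ((if s = \<sigma> t then 1 else 0) - (if s = t then 1 else 0))" if "s < n" "t < n" for s t
  proof -
    have "of_int p * D s t = umat f s t - umat (\<lambda>x. x) s t"
      unfolding D_def B(2) C(2) by (simp add: algebra_simps)
    also have "\<dots> = of_int p * (of_int k * ((if s = \<sigma> t then 1 else 0) - (if s = t then 1 else 0)))"
      unfolding inducesD(3)[OF ind that(2,1)] id[OF that] using p(2) by simp
    finally show ?thesis using p_nonzero by simp
  qed
  \<comment> \<open>D is k * (P - I) for the permutation matrix P of \<sigma>, whose support is
    disjoint from the diagonal. The entrywise square is k * k * (P + I), so subtracting k * D
    removes P and leaves 2 * k * k * I.\<close>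
  define M where "M s t = D s t * D s t - of_int k * D s t" for s t
  have "D \<in> tens" unfolding D_def[abs_def] by (rule tens_diff[OF B(1) C(1)])
  then have "M \<in> tens" unfolding M_def[abs_def] by (intro tens_diff tens_mult tens_scale)
  have M: "M s t = (if s = t then of_int (2 * k * k) else 0)" if "s < n" "t < n" for s t
    using fixfree[OF that(2)] by (auto simp: M_def D[OF that])
  \<comment> \<open>Contracting M with \<open>codual j\<close> gives 2 * k * k * codual j = d * y.
    After cancelling k this reads 2 * k * codual j = p * y, so p divides every entry of
    \<open>adj\<close>, as it divides neither 2 nor k.\<close>
  have dvd: "p dvd adj j l" if jl: "j < n" "l < n" for j l
  proof -
    obtain y where y: "algebraic_int y" "\<And>t. (\<Sum>s<n. hs s (codual j) * M s t) = of_int d * hs t y"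
      using tens_contract[OF \<open>M \<in> tens\<close> jl(1)] by blast
    have "(\<Sum>s<n. hs s (codual j) * M s 0) = of_int (2 * k * k) * hs 0 (codual j)"
      using degree_positive by (simp add: M if_distrib cong: if_cong)
    then have "of_int (2 * k * k) * hs 0 (codual j) = of_int (p * k) * hs 0 y"
      using y(2)[of 0] p(2) by simp
    moreover have "of_int (2 * k * k) * u = of_int k * (of_int (2 * k) * u)"
      "of_int (p * k) * u = of_int k * (of_int p * u)" for u :: real by simp_all
    ultimately have "of_int k * (of_int (2 * k) * hs 0 (codual j)) = of_int k * (of_int p * hs 0 y)"
      by metis
    moreover have "k \<noteq> 0" using disc_nonzero p(2) by auto
    ultimately have "of_int (2 * k) * hs 0 (codual j) = of_int p * hs 0 y" by simp
    then have "hs 0 (of_int (2 * k) * codual j) = hs 0 (of_int p * y)"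
      by (simp only: hs_mult hs_of_int)
    then have "of_int (2 * k) * codual j = of_int p * y" by (simp only: hs_eq_iff)
    then have "coord (of_int (2 * k) * codual j) l = coord (of_int p * y) l" by simp
    then have "2 * k * adj j l = p * coord y l"
      unfolding coord_linear(2)[OF codual_alg codual_alg jl(2)] coord_linear(2)[OF y(1) y(1) jl(2)] coord_codual[OF jl(2)] .
    then have "p dvd 2 * k * adj j l" by simp
    moreover have "\<not> p dvd 2" using p_odd prime_gt_1_int[OF p(1)] zdvd_imp_le[of p 2] by fastforce
    ultimately show ?thesis
      using p(1) squarefree_cofactor[OF p] by (simp add: prime_dvd_mult_iff)
  qed
  then show False using adj_not_zero_mod[OF p] by blast
qed

text \<open>The sign of f on the line of r squares to 1, so f composed with itself fixes r modulo
  p.\<close>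

lemma isometry_involution:
  assumes f: "isometry f" and one: "f 1 = 1" and x: "algebraic_int x"
  shows "f (f x) = x"
proof -
  obtain e z where ez: "e = 1 \<or> e = -1" "algebraic_int z" "f r = of_int e * r + of_int p * z" by (rule isometry_r[OF f])
  have "f (f r) = f (of_int e * r + of_int p * z)" using ez(3) by simp
  also have "\<dots> = of_int e * f r + of_int p * f z"
    using r_alg ez(2) by (simp only: isometry_add[OF f] isometry_scale[OF f] algebraic_int_mult algebraic_int_of_int)
  also have "\<dots> = r + of_int p * (of_int e * z + f z)"
    unfolding ez(3) using ez(1) by (auto simp: algebra_simps)
  finally have "f (f r) = r + of_int p * (of_int e * z + f z)" .
  moreover have "algebraic_int (of_int e * z + f z)"
    using ez(2) isometry_alg[OF f] by (intro algebraic_int_add algebraic_int_mult) auto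
  ultimately show ?thesis
    using isometry_trivial_if_fixes_r[OF isometry_compose[OF f f], of "of_int e * z + f z" x] one x by simp
qed

text \<open>Modulo p, x multiplies r by an integer m. Applying the multiplicative map f to this
  congruence and cancelling the sign of f r shows that f x multiplies r by the same m: f acts like
  an element of an inertia group.\<close>

lemma isometry_difference_r:
  assumes f: "isometry f" and one: "f 1 = 1" and x: "algebraic_int x"
  shows "\<exists>z. algebraic_int z \<and> (f x - x) * r = of_int p * z"
proof -
  obtain e z where ez: "e = 1 \<or> e = -1" "algebraic_int z" "f r = of_int e * r + of_int p * z" by (rule isometry_r[OF f])
  obtain m y where y: "algebraic_int y" "x * r = of_int m * r + of_int p * y" using r_eigen[OF x] by blast
  have "f x * f r = of_int m * f r + of_int p * f y"
    unfolding isometry_mult[OF f one x r_alg, symmetric] y(2) using r_alg y(1)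
    by (simp only: isometry_add[OF f] isometry_scale[OF f] algebraic_int_mult algebraic_int_of_int)
  then have "of_int e * (f x * r) = of_int e * (of_int m * r) + of_int p * (of_int m * z + f y - f x * z)"
    unfolding ez(3) by (simp add: algebra_simps)
  then have "of_int e * (of_int e * (f x * r)) = of_int e * (of_int e * (of_int m * r) + of_int p * (of_int m * z + f y - f x * z))"
    by simp
  moreover have ee: "of_int e * (of_int e * w) = (w :: 'k)" for w using ez(1) by auto
  ultimately have fxr: "f x * r = of_int m * r + of_int p * (of_int e * (of_int m * z + f y - f x * z))"
    by (simp only: distrib_left ee mult.left_commute[of "of_int e" "of_int p"])
  have "(f x - x) * r = f x * r - x * r" by (rule left_diff_distrib)
  also have "\<dots> = of_int p * (of_int e * (of_int m * z + f y - f x * z) - y)"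
    unfolding y(2) fxr right_diff_distrib[of "of_int p"] by simp
  finally have "(f x - x) * r = of_int p * (of_int e * (of_int m * z + f y - f x * z) - y)" .
  moreover have "algebraic_int (of_int e * (of_int m * z + f y - f x * z) - y)"
    using ez(2) y(1) x isometry_alg[OF f] by (intro algebraic_int_diff algebraic_int_add algebraic_int_mult) auto
  ultimately show ?thesis by blast
qed

end

section \<open>Membership in the different and divisibility of norms\<close>

context totally_real_field
begin

text \<open>In classical terms f x - x lies in the different: it multiplies the dual lattice,
  spanned by the elements \<open>codual l / d\<close>, into the ring of integers. At a prime p this
  holds because \<open>codual l\<close> is a multiple of r modulo p.\<close>

lemma isometry_difference_different:
  assumes f: "isometry f" and one: "f 1 = 1" and x: "algebraic_int x" and l: "l < n"
  shows "algebraic_int ((f x - x) * codual l / of_int d)"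
proof -
  have "(f x - x) * codual l / of_int d \<in> {x. algebraic_int x}"
  proof (rule squarefree_quotients_generate[OF squarefree_disc])
    have "algebraic_int ((f x - x) * codual l)"
      using x isometry_alg[OF f x] by (intro algebraic_int_mult algebraic_int_diff codual_alg)
    then show "of_int d * ((f x - x) * codual l / of_int d) \<in> {x. algebraic_int x}"
      using disc_nonzero by simp
    fix p k :: int assume pk: "prime p" "d = p * k"
    then obtain r q c where "ramified_prime hs b n d p k r q c" using ramified_prime_exists by blast
    then interpret ramified_prime hs b n d p k r q c .
    obtain z where z: "algebraic_int z" "(f x - x) * r = of_int p * z"
      using isometry_difference_r[OF f one x] by blast
    obtain y where y: "algebraic_int y" "codual l = of_int (c l) * r + of_int p * y" using codual_mod[OF l] by blast
    have "(f x - x) * codual l = of_int (c l) * ((f x - x) * r) + of_int p * ((f x - x) * y)"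
      unfolding y(2) by (simp add: algebra_simps)
    also have "\<dots> = of_int p * (of_int (c l) * z + (f x - x) * y)"
      unfolding z(2) by (simp add: algebra_simps)
    finally have "of_int k * ((f x - x) * codual l / of_int d) = of_int (c l) * z + (f x - x) * y"
      using disc_nonzero pk(2) by simp
    moreover have "algebraic_int \<dots>"
      using z(1) y(1) x isometry_alg[OF f x] by (intro algebraic_int_add algebraic_int_mult algebraic_int_diff) auto
    ultimately show "of_int k * ((f x - x) * codual l / of_int d) \<in> {x. algebraic_int x}" by simp
  qed (auto intro: algebraic_int_add algebraic_int_mult)
  then show ?thesis by simp
qed

lemma detf_embeddings_nonzero: "detf n (\<lambda>s k. hs s (b k)) \<noteq> 0"
  using disc_eq_square disc_nonzero by auto

text \<open>The product is the determinant of multiplication by x in the basis b. The matrix of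
  embedding values diagonalises this multiplication and cancels from the determinants.\<close>

lemma norm_int:
  assumes "algebraic_int x"
  obtains m where "(\<Prod>s<n. hs s x) = of_int m"
proof -
  let ?W = "\<lambda>s k. hs s (b k)"
  have alg: "algebraic_int (x * b l)" for l using assms basis_alg by (rule algebraic_int_mult)
  have "(\<Prod>s<n. hs s x) * detf n ?W = detf n (\<lambda>s l. hs s x * ?W s l)" by (rule detf_scale[symmetric])
  also have "\<dots> = detf n (\<lambda>s l. \<Sum>m<n. ?W s m * of_int (coord (x * b l) m))"
  proof (rule detf_cong)
    fix s l
    have "hs s x * hs s (b l) = hs s (\<Sum>m<n. of_int (coord (x * b l) m) * b m)"
      unfolding basis_expansion[OF alg, symmetric] by (simp add: hs_mult)
    then show "hs s x * hs s (b l) = (\<Sum>m<n. ?W s m * of_int (coord (x * b l) m))"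
      by (simp add: hs_sum hs_mult hs_of_int mult.commute)
  qed
  also have "\<dots> = detf n ?W * of_int (detf n (\<lambda>m l. coord (x * b l) m))"
    unfolding detf_mult detf_of_int ..
  finally show ?thesis using that detf_embeddings_nonzero by simp
qed

text \<open>With W and V the embedding matrices of the basis and of the dual basis, the hypothesis
  gives norm * det V = det W * integer. Multiplying by det W yields the claim, since det W * det V =
  1 and the square of det W is d.\<close>

lemma norm_divisible:
  assumes "\<And>l. l < n \<Longrightarrow> algebraic_int (y * codual l / of_int d)"
  obtains m where "(\<Prod>s<n. hs s y) = of_int (d * m)"
proof -
  let ?W = "\<lambda>s k. hs s (b k)" and ?V = "\<lambda>s k. hs s (codual k) / of_int d"
  let ?a = "\<lambda>m l. coord (y * codual l / of_int d) m"
  have "detf n ?W * detf n ?V = detf n (\<lambda>s t. \<Sum>k<n. ?W s k * ?V t k)"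
    unfolding detf_mult[of n ?W "\<lambda>k t. ?V t k"] by (simp only: detf_transpose[of n ?V])
  also have "\<dots> = detf n (\<lambda>s t. if s = t then 1 else 0)"
  proof (rule detf_cong)
    fix s t assume "s < n" "t < n"
    then show "(\<Sum>k<n. ?W s k * ?V t k) = (if s = t then 1 else 0)"
      using embedding_orthogonality[of s t] disc_nonzero by (simp flip: sum_divide_distrib)
  qed
  finally have WV: "detf n ?W * detf n ?V = 1" by (simp add: detf_one)
  have "(\<Prod>s<n. hs s y) * detf n ?V = detf n (\<lambda>s l. hs s y * ?V s l)" by (rule detf_scale[symmetric])
  also have "\<dots> = detf n (\<lambda>s l. \<Sum>m<n. ?W s m * of_int (?a m l))"
  proof (rule detf_cong)
    fix s l assume "l < n"
    have "hs s y * ?V s l * of_int d = hs s (of_int d * (y * codual l / of_int d))"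
      using disc_nonzero by (simp add: hs_mult)
    then have "hs s y * ?V s l = hs s (y * codual l / of_int d)"
      using disc_nonzero by (simp only: hs_mult hs_of_int) (simp add: mult.commute)
    also have "\<dots> = hs s (\<Sum>m<n. of_int (?a m l) * b m)"
      unfolding basis_expansion[OF assms[OF \<open>l < n\<close>], symmetric] ..
    finally show "hs s y * ?V s l = (\<Sum>m<n. ?W s m * of_int (?a m l))"
      by (simp add: hs_sum hs_mult hs_of_int mult.commute)
  qed
  also have "\<dots> = detf n ?W * of_int (detf n ?a)"
    unfolding detf_mult detf_of_int ..
  finally have "(\<Prod>s<n. hs s y) * (detf n ?W * detf n ?V) = (detf n ?W) ^ 2 * of_int (detf n ?a)"
    by (simp add: power2_eq_square mult_ac)
  then show ?thesis using that[of "detf n ?a"] unfolding WV disc_eq_square[symmetric] by simp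
qed

end

section \<open>Minkowski's theorem on linear forms\<close>

text \<open>Lebesgue measure lives on vectors indexed by a finite type, while n is a number;
  conjugating permutations by e matches the two Leibniz sums.\<close>

lemma det_reindex:
  fixes e :: "'n :: finite \<Rightarrow> nat" and A :: "nat \<Rightarrow> nat \<Rightarrow> 'a :: comm_ring_1"
  assumes e: "bij_betw e UNIV {..<n}"
  shows "Determinants.det (\<chi> i j. A (e i) (e j)) = detf n A"
proof -
  let ?f = "inv_into UNIV e"
  have e': "bij_betw ?f {..<n} UNIV" using e by (rule bij_betw_inv_into)
  have inv: "?f (e x) = x" for x using e by (simp add: bij_betw_def)
  have inv': "e (?f i) = i" if "i < n" for i using e that by (intro f_inv_into_f) (auto simp: bij_betw_def)
  have inj: "inj_on e UNIV" "inj_on ?f {..<n}" using e e' by (auto simp: bij_betw_def)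
  show ?thesis
    unfolding Determinants.det_def detf_eq_sum
  proof (rule sum.reindex_bij_witness[of _ "map_permutation {..<n} ?f" "map_permutation UNIV e"])
    fix p :: "'n \<Rightarrow> 'n" assume "p \<in> {p. p permutes UNIV}"
    then have p: "p permutes UNIV" by simp
    show "map_permutation {..<n} ?f (map_permutation UNIV e p) = p"
      by (rule map_permutation_compose_inv[OF e p]) (simp add: inv)
    have pe: "map_permutation UNIV e p permutes {..<n}" by (rule map_permutation_permutes[OF e p])
    then show "map_permutation UNIV e p \<in> {p. p permutes {..<n}}" by simp
    have "(\<Prod>i<n. A i (map_permutation UNIV e p i)) = (\<Prod>x\<in>UNIV. A (e x) (map_permutation UNIV e p (e x)))"
      by (rule prod.reindex_bij_betw[OF e, symmetric])
    also have "\<dots> = (\<Prod>x\<in>UNIV. A (e x) (e (p x)))" by (simp add: map_permutation_apply[OF inj(1)])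
    finally show "of_int (sign (map_permutation UNIV e p)) * (\<Prod>i<n. A i (map_permutation UNIV e p i)) =
        of_int (sign p) * (\<Prod>i\<in>UNIV. vec_nth (vec_nth (\<chi> i j. A (e i) (e j)) i) (p i))"
      by (simp add: sign_map_permutation[OF inj(1) p])
  next
    fix p assume "p \<in> {p. p permutes {..<n}}"
    then have p: "p permutes {..<n}" by simp
    show "map_permutation UNIV e (map_permutation {..<n} ?f p) = p"
      by (rule map_permutation_compose_inv[OF e' p]) (simp add: inv')
    show "map_permutation {..<n} ?f p \<in> {p. p permutes UNIV}"
      using map_permutation_permutes[OF e' p] by simp
  qed
qed

definition int_vec :: "('n :: finite \<Rightarrow> int) \<Rightarrow> real ^ 'n" where
  "int_vec v = (\<chi> j. of_int (v j))"

lemma int_vec_diff: "int_vec v - int_vec w = int_vec (\<lambda>j. v j - w j)"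
  by (simp add: int_vec_def vec_eq_iff)

text \<open>Otherwise the translates of the box B by all lattice points A v are disjoint. The
  translates with coordinates of v in {0..<N} fit into the image under A of a cube of side N + 2 *
  K; comparing volumes and letting N grow gives prod c \<le> |det A|.\<close>

lemma minkowski_strict:
  fixes A :: "real ^ 'n :: {finite, wellorder} ^ 'n :: {finite, wellorder}" and c :: "'n :: {finite, wellorder} \<Rightarrow> real"
  assumes det: "Determinants.det A \<noteq> 0" and c: "\<And>i. c i > 0" and vol: "(\<Prod>i\<in>UNIV. c i) > \<bar>Determinants.det A\<bar>"
  shows "\<exists>v. v \<noteq> (\<lambda>_. 0) \<and> (\<forall>i. \<bar>vec_nth (A *v int_vec v) i\<bar> < c i)"
proof (rule ccontr)
  assume none: "\<not> ?thesis"
  \<comment> \<open>A box with one corner at 0: differences of its points are bounded by c i, and no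
    power of 2 enters the volume condition.\<close>
  define B where "B = box 0 (\<chi> i. c i)"
  have mB: "measure lebesgue B = (\<Prod>i\<in>UNIV. c i)"
  proof -
    have "measure lebesgue B = measure lborel (cbox 0 (\<chi> i. c i))"
      unfolding B_def by (simp add: measure_lborel_box_eq measure_lborel_cbox_eq)
    also have "\<dots> = (\<Prod>i\<in>UNIV. c i)"
      using c by (subst content_cbox_cart) (auto simp: interval_ne_empty_cart less_imp_le)
    finally show ?thesis .
  qed
  obtain A' where A': "A ** A' = Finite_Cartesian_Product.mat 1" "A' ** A = Finite_Cartesian_Product.mat 1"
    using det by (metis invertible_det_nz invertible_def)
  have "bounded ((*v) A' ` B)"
    unfolding B_def by (intro bounded_linear_image bounded_box matrix_vector_mul_bounded_linear)
  then obtain K where K: "\<And>x. x \<in> B \<Longrightarrow> norm (A' *v x) \<le> K" by (auto simp: bounded_iff)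
  have K': "\<bar>vec_nth (A' *v x) i\<bar> \<le> \<bar>K\<bar>" if "x \<in> B" for x i
    using component_le_norm_cart[of "A' *v x" i] K[OF that] by linarith
  have disj: "disjnt ((+) (A *v int_vec v) ` B) ((+) (A *v int_vec w) ` B)" if "v \<noteq> w" for v w
  proof (rule ccontr)
    assume "\<not> ?thesis"
    then obtain x y where xy: "x \<in> B" "y \<in> B" "A *v int_vec v + x = A *v int_vec w + y"
      by (auto simp: disjnt_def)
    then have "A *v int_vec (\<lambda>j. v j - w j) = y - x"
      by (simp add: int_vec_diff[symmetric] matrix_vector_mult_diff_distrib algebra_simps)
    then have "\<forall>i. \<bar>vec_nth (A *v int_vec (\<lambda>j. v j - w j)) i\<bar> < c i"
      using xy(1,2) by (auto simp: B_def mem_box_cart abs_if) (smt (verit))+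
    moreover have "(\<lambda>j. v j - w j) \<noteq> (\<lambda>_. 0)" using that by (auto simp: fun_eq_iff)
    ultimately show False using none by blast
  qed
  have le: "(\<Prod>i\<in>UNIV. c i) \<le> \<bar>Determinants.det A\<bar> * (1 + 2 * \<bar>K\<bar> / real N) ^ CARD('n)" if N: "N > 0" for N
  proof -
    define V where "V = (UNIV :: 'n set) \<rightarrow>\<^sub>E {0..<int N}"
    have V: "finite V" "card V = N ^ CARD('n)"
      unfolding V_def by (auto simp: card_PiE intro!: finite_PiE)
    define U where "U = (\<Union>v\<in>V. (+) (A *v int_vec v) ` B)"
    define C where "C = cbox (\<chi> i :: 'n. - \<bar>K\<bar>) (\<chi> i. real N + \<bar>K\<bar>)"
    have Bm: "B \<in> lmeasurable" by (simp add: B_def)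
    have tm: "(+) a ` B \<in> lmeasurable" for a by (rule measurable_translation[OF Bm])
    have "measure lebesgue U = (\<Sum>v\<in>V. measure lebesgue ((+) (A *v int_vec v) ` B))"
      unfolding U_def
    proof (rule measure_UNION'[OF V(1)])
      show "pairwise (\<lambda>v w. disjnt ((+) (A *v int_vec v) ` B) ((+) (A *v int_vec w) ` B)) V"
        using disj by (auto simp: pairwise_def)
    qed (rule tm)
    also have "\<dots> = real (N ^ CARD('n)) * (\<Prod>i\<in>UNIV. c i)"
      by (simp add: measure_translation mB V)
    finally have mU: "measure lebesgue U = real N ^ CARD('n) * (\<Prod>i\<in>UNIV. c i)" by simp
    have "U \<subseteq> (*v) A ` C"
    proof
      fix y assume "y \<in> U"
      then obtain v x where vx: "v \<in> V" "x \<in> B" "y = A *v int_vec v + x" by (auto simp: U_def)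
      have "y = A *v (int_vec v + A' *v x)"
        by (simp add: vx(3) matrix_vector_right_distrib matrix_vector_mul_assoc A')
      moreover have "int_vec v + A' *v x \<in> C"
      proof -
        have "- \<bar>K\<bar> \<le> vec_nth (int_vec v + A' *v x) i \<and> vec_nth (int_vec v + A' *v x) i \<le> real N + \<bar>K\<bar>" for i
        proof -
          have "v i \<in> {0..<int N}" using vx(1) by (auto simp: V_def)
          then have "0 \<le> v i" "v i \<le> int N" by auto
          then have "real_of_int 0 \<le> real_of_int (v i)" "real_of_int (v i) \<le> real_of_int (int N)"
            by (simp_all only: of_int_le_iff)
          then have "0 \<le> real_of_int (v i)" "real_of_int (v i) \<le> real N" by simp_all
          then show ?thesis using K'[OF vx(2), of i] by (auto simp: int_vec_def)
        qed
        then show ?thesis by (simp add: C_def mem_box_cart)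
      qed
      ultimately show "y \<in> (*v) A ` C" by blast
    qed
    moreover have lin: "linear ((*v) A)" by (rule matrix_vector_mul_linear)
    moreover have "U \<in> lmeasurable" unfolding U_def by (intro fmeasurable.finite_UN V(1) tm)
    moreover have "(*v) A ` C \<in> lmeasurable" unfolding C_def by (rule measurable_linear_image[OF lin lmeasurable_cbox])
    ultimately have "measure lebesgue U \<le> measure lebesgue ((*v) A ` C)"
      by (intro measure_mono_fmeasurable) auto
    also have "\<dots> = \<bar>Determinants.det A\<bar> * measure lebesgue C"
      unfolding C_def using measure_linear_image[OF lin lmeasurable_cbox] by simp
    also have "measure lebesgue C = (real N + 2 * \<bar>K\<bar>) ^ CARD('n)"
    proof -
      have "measure lebesgue C = measure lborel C" by (simp add: C_def)
      also have "\<dots> = (\<Prod>i\<in>(UNIV :: 'n set). (real N + \<bar>K\<bar>) - (- \<bar>K\<bar>))"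
        unfolding C_def by (subst content_cbox_cart) (auto simp: interval_ne_empty_cart)
      finally show ?thesis by (simp add: algebra_simps)
    qed
    also have "real N + 2 * \<bar>K\<bar> = real N * (1 + 2 * \<bar>K\<bar> / real N)" using N by (simp add: field_simps)
    finally have "real N ^ CARD('n) * (\<Prod>i\<in>UNIV. c i) \<le>
        real N ^ CARD('n) * (\<bar>Determinants.det A\<bar> * (1 + 2 * \<bar>K\<bar> / real N) ^ CARD('n))"
      unfolding mU by (simp add: power_mult_distrib mult_ac)
    then show ?thesis using N by simp
  qed
  have "(\<lambda>N. \<bar>Determinants.det A\<bar> * (1 + 2 * \<bar>K\<bar> / real N) ^ CARD('n)) \<longlonglongrightarrow> \<bar>Determinants.det A\<bar> * (1 + 0) ^ CARD('n)"
    by (intro tendsto_intros lim_const_over_n)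
  then have "(\<Prod>i\<in>UNIV. c i) \<le> \<bar>Determinants.det A\<bar> * (1 + 0) ^ CARD('n)"
    by (rule LIMSEQ_le_const) (use le in \<open>auto intro!: exI[of _ 1]\<close>)
  then show False using vol by simp
qed

text \<open>Only finitely many lattice points lie in a bounded box, so one of the bounds may be attained.\<close>

lemma minkowski_weak:
  fixes A :: "real ^ 'n :: {finite, wellorder} ^ 'n :: {finite, wellorder}" and c :: "'n :: {finite, wellorder} \<Rightarrow> real"
  assumes det: "Determinants.det A \<noteq> 0" and c: "\<And>i. c i > 0" and vol: "(\<Prod>i\<in>UNIV. c i) \<ge> \<bar>Determinants.det A\<bar>"
  shows "\<exists>v. v \<noteq> (\<lambda>_. 0) \<and> \<bar>vec_nth (A *v int_vec v) i0\<bar> \<le> c i0 \<and> (\<forall>i. i \<noteq> i0 \<longrightarrow> \<bar>vec_nth (A *v int_vec v) i\<bar> < c i)"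
proof -
  \<comment> \<open>Relaxing one bound by 1 / (m + 1) makes the volume inequality strict. A vector
    that occurs for infinitely many m obeys the original bound at i0.\<close>
  define c' where "c' m = c(i0 := c i0 + 1 / real (Suc m))" for m
  have c': "c' m i > 0" for m i using c[of i] by (auto simp: c'_def intro!: add_pos_pos)
  have "\<exists>v. v \<noteq> (\<lambda>_. 0) \<and> (\<forall>i. \<bar>vec_nth (A *v int_vec v) i\<bar> < c' m i)" for m
  proof (rule minkowski_strict[OF det c'])
    have "(\<Prod>i\<in>UNIV. c i) = c i0 * (\<Prod>i\<in>UNIV - {i0}. c i)" by (simp add: prod.remove)
    also have "\<dots> < (c i0 + 1 / real (Suc m)) * (\<Prod>i\<in>UNIV - {i0}. c i)"
      using c by (intro mult_strict_right_mono prod_pos) auto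
    also have "(\<Prod>i\<in>UNIV - {i0}. c i) = (\<Prod>i\<in>UNIV - {i0}. c' m i)" by (intro prod.cong) (auto simp: c'_def)
    also have "(c i0 + 1 / real (Suc m)) * \<dots> = (\<Prod>i\<in>UNIV. c' m i)"
      by (subst (2) prod.remove[of _ i0]) (auto simp: c'_def)
    finally show "\<bar>Determinants.det A\<bar> < (\<Prod>i\<in>UNIV. c' m i)" using vol by linarith
  qed
  then have "\<forall>m. \<exists>v. v \<noteq> (\<lambda>_. 0) \<and> (\<forall>i. \<bar>vec_nth (A *v int_vec v) i\<bar> < c' m i)" by blast
  from choice[OF this] obtain v where v: "\<And>m. v m \<noteq> (\<lambda>_. 0)" "\<And>m i. \<bar>vec_nth (A *v int_vec (v m)) i\<bar> < c' m i" by blast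
  obtain A' where A': "A ** A' = Finite_Cartesian_Product.mat 1" "A' ** A = Finite_Cartesian_Product.mat 1"
    using det by (metis invertible_det_nz invertible_def)
  define C where "C = cbox (\<chi> i. - c i - 1) (\<chi> i. c i + 1)"
  have "bounded ((*v) A' ` C)"
    unfolding C_def by (intro bounded_linear_image bounded_cbox matrix_vector_mul_bounded_linear)
  then obtain K where K: "\<And>x. x \<in> C \<Longrightarrow> norm (A' *v x) \<le> K" by (auto simp: bounded_iff)
  have "v m \<in> UNIV \<rightarrow>\<^sub>E {- \<lceil>K\<rceil>..\<lceil>K\<rceil>}" for m
  proof -
    have "c' m i \<le> c i + 1" for i by (simp add: c'_def field_simps)
    then have "\<bar>vec_nth (A *v int_vec (v m)) i\<bar> \<le> c i + 1" for i using v(2)[of m i] by (smt (verit))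
    then have "- c i - 1 \<le> vec_nth (A *v int_vec (v m)) i \<and> vec_nth (A *v int_vec (v m)) i \<le> c i + 1" for i
      by (smt (verit))
    then have "A *v int_vec (v m) \<in> C" by (simp add: C_def mem_box_cart)
    then have "norm (A' *v (A *v int_vec (v m))) \<le> K" by (rule K)
    then have "norm (int_vec (v m)) \<le> K" by (simp add: matrix_vector_mul_assoc A')
    then have "\<bar>real_of_int (v m j)\<bar> \<le> K" for j
      using component_le_norm_cart[of "int_vec (v m)" j] by (simp add: int_vec_def)
    then have "v m j \<in> {- \<lceil>K\<rceil>..\<lceil>K\<rceil>}" for j
      by (smt (verit) atLeastAtMost_iff le_of_int_ceiling of_int_le_iff of_int_minus)
    then show ?thesis by auto
  qed
  then have "range v \<subseteq> UNIV \<rightarrow>\<^sub>E {- \<lceil>K\<rceil>..\<lceil>K\<rceil>}" by auto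
  moreover have "finite ((UNIV :: 'n set) \<rightarrow>\<^sub>E {- \<lceil>K\<rceil>..\<lceil>K\<rceil>})" by (intro finite_PiE) auto
  ultimately have "finite (range v)" by (rule finite_subset)
  then obtain m0 where m0: "infinite {m \<in> UNIV. v m = v m0}"
    using pigeonhole_infinite[of UNIV v] by auto
  let ?L = "\<lambda>i. \<bar>vec_nth (A *v int_vec (v m0)) i\<bar>"
  have "?L i0 \<le> c i0"
  proof (rule ccontr)
    assume "\<not> ?thesis"
    then have "?L i0 - c i0 > 0" by simp
    then obtain M where M: "1 / real (Suc M) < ?L i0 - c i0" using nat_approx_posE by metis
    obtain m where m: "m \<ge> M" "v m = v m0" using m0 unfolding infinite_nat_iff_unbounded_le by blast
    have "?L i0 < c i0 + 1 / real (Suc m)" using v(2)[of m i0] m(2) by (simp add: c'_def)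
    moreover have "1 / real (Suc m) \<le> 1 / real (Suc M)" using m(1) by (intro divide_left_mono) auto
    ultimately show False using M by linarith
  qed
  moreover have "?L i < c i" if "i \<noteq> i0" for i using v(2)[of m0 i] that by (simp add: c'_def)
  ultimately show ?thesis using v(1)[of m0] by blast
qed

lemma minkowski_linear_forms:
  fixes A :: "nat \<Rightarrow> nat \<Rightarrow> real" and e :: "'n :: {finite, wellorder} \<Rightarrow> nat"
  assumes e: "bij_betw e UNIV {..<n}" and n: "n > 0" and det: "detf n A \<noteq> 0"
    and c: "\<And>i. i < n \<Longrightarrow> c i > 0" and vol: "(\<Prod>i<n. c i) \<ge> \<bar>detf n A\<bar>"
  obtains v :: "nat \<Rightarrow> int" and k where "k < n" "v k \<noteq> 0" "\<bar>\<Sum>j<n. A 0 j * of_int (v j)\<bar> \<le> c 0"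
    and "\<And>i. i < n \<Longrightarrow> i \<noteq> 0 \<Longrightarrow> \<bar>\<Sum>j<n. A i j * of_int (v j)\<bar> < c i"
proof -
  let ?M = "\<chi> i j. A (e i) (e j)"
  have e_lt: "e x < n" for x using e by (auto simp: bij_betw_def)
  obtain i0 where i0: "e i0 = 0" using e n by (metis bij_betw_iff_bijections lessThan_iff)
  have D: "Determinants.det ?M = detf n A" by (rule det_reindex[OF e])
  have "(\<Prod>i\<in>UNIV. c (e i)) = (\<Prod>i<n. c i)" by (rule prod.reindex_bij_betw[OF e])
  then obtain v where v: "v \<noteq> (\<lambda>_. 0)" "\<bar>vec_nth (?M *v int_vec v) i0\<bar> \<le> c (e i0)"
    "\<And>i. i \<noteq> i0 \<Longrightarrow> \<bar>vec_nth (?M *v int_vec v) i\<bar> < c (e i)"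
    using minkowski_weak[of ?M "\<lambda>i. c (e i)" i0] det vol c e_lt unfolding D by auto
  define w where "w j = v (inv_into UNIV e j)" for j
  have we: "w (e x) = v x" for x using e by (simp add: w_def bij_betw_def)
  have form: "vec_nth (?M *v int_vec v) x = (\<Sum>j<n. A (e x) j * of_int (w j))" for x
  proof -
    have "vec_nth (?M *v int_vec v) x = (\<Sum>y\<in>UNIV. A (e x) (e y) * of_int (w (e y)))"
      by (simp add: matrix_vector_mult_def int_vec_def we)
    also have "\<dots> = (\<Sum>j<n. A (e x) j * of_int (w j))" by (rule sum.reindex_bij_betw[OF e])
    finally show ?thesis .
  qed
  obtain x where "v x \<noteq> 0" using v(1) by (auto simp: fun_eq_iff)
  then have "w (e x) \<noteq> 0" by (simp add: we)
  moreover have "\<bar>\<Sum>j<n. A i j * of_int (w j)\<bar> < c i" if i: "i < n" "i \<noteq> 0" for i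
  proof -
    obtain y where y: "e y = i" using e i(1) by (metis bij_betw_iff_bijections lessThan_iff)
    then have "y \<noteq> i0" using i0 i(2) by auto
    from v(3)[OF this] show ?thesis unfolding form y .
  qed
  ultimately show ?thesis using that[of "e x" w] e_lt v(2) unfolding form i0 by blast
qed

text \<open>An index type of size \<open>field_degree\<close> for the vectors in Minkowski's
  theorem. Its order serves the formula for the measure of a linear image, whose index types are
  well ordered.\<close>

typedef (overloaded) ('k :: number_field) embedding_index = "{..<field_degree TYPE('k)}"
  by (rule exI[of _ 0]) (simp add: degree_pos)

instance embedding_index :: (number_field) finite
proof
  have "(UNIV :: 'a embedding_index set) = Abs_embedding_index ` {..<field_degree TYPE('a)}"
    using type_definition.Abs_image[OF type_definition_embedding_index] by metis
  moreover have "finite (Abs_embedding_index ` {..<field_degree TYPE('a)} :: 'a embedding_index set)" by simp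
  ultimately show "finite (UNIV :: 'a embedding_index set)" by metis
qed

instantiation embedding_index :: (number_field) wellorder
begin

definition less_eq_embedding_index :: "'a embedding_index \<Rightarrow> 'a embedding_index \<Rightarrow> bool" where
  "less_eq_embedding_index x y \<longleftrightarrow> Rep_embedding_index x \<le> Rep_embedding_index y"

definition less_embedding_index :: "'a embedding_index \<Rightarrow> 'a embedding_index \<Rightarrow> bool" where
  "less_embedding_index x y \<longleftrightarrow> Rep_embedding_index x < Rep_embedding_index y"

instance
proof
  fix P :: "'a embedding_index \<Rightarrow> bool" and a :: "'a embedding_index"
  assume *: "\<And>x. (\<And>y. y < x \<Longrightarrow> P y) \<Longrightarrow> P x"
  show "P a"
    by (induction a rule: measure_induct_rule[of Rep_embedding_index]) (auto simp: less_embedding_index_def intro: *)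
qed (auto simp: less_eq_embedding_index_def less_embedding_index_def Rep_embedding_index_inject)

end

lemma bij_Rep_embedding_index:
  "bij_betw Rep_embedding_index (UNIV :: 'k :: number_field embedding_index set) {..<field_degree TYPE('k)}"
  unfolding bij_betw_def
  using type_definition.Rep_range[OF type_definition_embedding_index]
  by (auto simp: inj_on_def Rep_embedding_index_inject)

section \<open>Automorphisms\<close>

lemma prod_less_one:
  fixes a :: "'i \<Rightarrow> real"
  assumes "finite I" "j \<in> I" "a j < 1" "\<And>i. i \<in> I \<Longrightarrow> 0 \<le> a i" "\<And>i. i \<in> I \<Longrightarrow> a i \<le> 1"
  shows "prod a I < 1"
proof -
  have "prod a I = a j * prod a (I - {j})" using assms(1,2) by (rule prod.remove)
  also have "\<dots> \<le> a j * 1" using assms by (intro mult_left_mono prod_le_1) auto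
  finally show ?thesis using assms(3) by simp
qed

context totally_real_field
begin

lemma small_norm_zero:
  assumes "algebraic_int x" "\<bar>\<Prod>s<n. hs s x\<bar> < 1"
  shows "x = 0"
proof -
  obtain m where m: "(\<Prod>s<n. hs s x) = of_int m" by (rule norm_int[OF assms(1)])
  then have "m = 0" using assms(2) by auto
  then obtain s where "hs s x = 0" using m by auto
  then show ?thesis using hs_eq_iff[of s x 0] by (simp add: hs_zero)
qed

text \<open>The embeddings map the ring of integers to a lattice of covolume sqrt d, and passing to
  combinations E of determinant 1 preserves the covolume.\<close>

lemma minkowski_integers:
  fixes E :: "nat \<Rightarrow> nat \<Rightarrow> real"
  assumes E: "detf n E = 1" and c: "\<And>i. i < n \<Longrightarrow> c i > 0" and vol: "(\<Prod>i<n. c i) = sqrt (of_int d)"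
  obtains x where "algebraic_int x" "x \<noteq> 0" "\<bar>\<Sum>s<n. E 0 s * hs s x\<bar> \<le> c 0"
    and "\<And>i. i < n \<Longrightarrow> i \<noteq> 0 \<Longrightarrow> \<bar>\<Sum>s<n. E i s * hs s x\<bar> < c i"
proof -
  define A where "A i j = (\<Sum>s<n. E i s * hs s (b j))" for i j
  have detA: "detf n A = detf n (\<lambda>s k. hs s (b k))" unfolding A_def detf_mult E by simp
  have bound: "\<bar>detf n A\<bar> = sqrt (of_int d)" unfolding detA disc_eq_square by simp
  have nz: "detf n A \<noteq> 0" unfolding detA by (rule detf_embeddings_nonzero)
  have e: "bij_betw Rep_embedding_index (UNIV :: 'k embedding_index set) {..<n}"
    unfolding degree by (rule bij_Rep_embedding_index)
  show ?thesis
  proof (rule minkowski_linear_forms[OF e degree_positive nz c])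
    show "\<bar>detf n A\<bar> \<le> (\<Prod>i<n. c i)" unfolding bound vol by simp
    fix v :: "nat \<Rightarrow> int" and k
    assume v: "k < n" "v k \<noteq> 0" "\<bar>\<Sum>j<n. A 0 j * of_int (v j)\<bar> \<le> c 0"
      "\<And>i. i < n \<Longrightarrow> i \<noteq> 0 \<Longrightarrow> \<bar>\<Sum>j<n. A i j * of_int (v j)\<bar> < c i"
    define x where "x = (\<Sum>j<n. of_int (v j) * b j)"
    have form: "(\<Sum>j<n. A i j * of_int (v j)) = (\<Sum>s<n. E i s * hs s x)" for i
      unfolding A_def sum_assoc_matrix x_def hs_sum hs_mult hs_of_int by (simp add: mult.commute)
    show thesis
    proof (rule that[of x])
      show "algebraic_int x" unfolding x_def by (intro algebraic_int_sum algebraic_int_mult basis_alg) simp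
      have "coord x k = v k" unfolding x_def by (rule coord_combination[OF v(1)])
      moreover have "coord 0 k = 0" using tr_sum[of "{}"] by (simp add: coord_def)
      ultimately show "x \<noteq> 0" using v(2) by metis
    qed (use v(3,4) in \<open>simp_all add: form\<close>)
  qed
qed

text \<open>With all bounds equal to 1, only the form of index 0 may attain its bound. For n > 1 the
  strict bound at index 1 pushes the norm of a nonzero integer below 1.\<close>

lemma degree_one_if_unimodular:
  assumes "d = 1"
  shows "n = 1"
proof (rule ccontr)
  assume "n \<noteq> 1"
  then have n: "1 < n" using degree_positive by simp
  let ?E = "\<lambda>i s. if i = s then 1 else 0 :: real"
  obtain x where x: "algebraic_int x" "x \<noteq> 0" "\<bar>\<Sum>s<n. ?E 0 s * hs s x\<bar> \<le> 1"
    "\<And>i. i < n \<Longrightarrow> i \<noteq> 0 \<Longrightarrow> \<bar>\<Sum>s<n. ?E i s * hs s x\<bar> < 1"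
    by (rule minkowski_integers[of ?E "\<lambda>_. 1"]) (auto simp: detf_one assms)
  have E: "(\<Sum>s<n. ?E i s * hs s x) = hs i x" if "i < n" for i
    using that by (simp add: if_distribR if_distrib cong: if_cong)
  have le: "\<bar>hs i x\<bar> \<le> 1" if "i < n" for i
    using x(3) x(4)[OF that] E[OF that] by (cases "i = 0") auto
  have "(\<Prod>s<n. \<bar>hs s x\<bar>) < 1"
    using x(4)[OF n] E[OF n] n le by (intro prod_less_one[of _ 1]) auto
  then have "x = 0" using x(1) by (intro small_norm_zero) (auto simp: abs_prod)
  then show False using x(2) by simp
qed

text \<open>Minkowski's theorem for the forms \<open>hs i\<close> with \<open>i < \<sigma> i\<close> and \<open>hs i - hs (\<sigma> i)\<close> with
  \<open>\<sigma> i < i\<close>. The norm of \<open>f x - x\<close> is a multiple of \<open>d\<close> and less than \<open>d\<close>, so \<open>x\<close> is fixed by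
  \<open>f\<close>, and then the norm of \<open>x\<close> is less than 1 unless \<open>{0, \<sigma> 0}\<close> are all the embeddings.\<close>

lemma involution_degree_two:
  assumes f: "isometry f" and one: "f 1 = 1"
    and inv: "\<And>x. algebraic_int x \<Longrightarrow> f (f x) = x"
    and nontrivial: "algebraic_int w" "f w \<noteq> w"
  shows "n = 2"
proof (rule ccontr)
  assume n2: "n \<noteq> 2"
  obtain \<sigma> where ind: "induces f \<sigma>" using isometry_permutation[OF f one] by blast
  note \<sigma> = inducesD(1,2)[OF ind]
  have \<sigma>f: "hs t (f x) = hs (\<sigma> t) x" if "t < n" "algebraic_int x" for t x
    using \<sigma>(2)[OF that(1) isometry_alg[OF f that(2)]] inv[OF that(2)] by simp
  have \<sigma>\<sigma>: "\<sigma> (\<sigma> t) = t" if t: "t < n" for t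
  proof (rule embeddings_separated[OF \<sigma>(1)[OF \<sigma>(1)[OF t]] t])
    fix x :: 'k assume x: "algebraic_int x"
    show "hs (\<sigma> (\<sigma> t)) x = hs t x"
      using \<sigma>f[OF \<sigma>(1)[OF t] x] \<sigma>(2)[OF t x] by simp
  qed
  have fixfree: "\<sigma> t \<noteq> t" if "t < n" for t
    using isometry_fixed_embedding[of t f w] \<sigma>(2)[OF that] nontrivial by auto
  note n0 = degree_positive
  \<comment> \<open>A difference involves only the smaller index \<sigma> i besides i, so the matrix
    is lower unitriangular.\<close>
  define E where "E i s = (if s = i then 1 else if \<sigma> i < i \<and> s = \<sigma> i then -1 else 0 :: real)" for i s
  \<comment> \<open>The form at \<sigma> 0 is a difference, as 0 < \<sigma> 0. It absorbs the whole
    covolume, so all other bounds can be 1.\<close>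
  define c where "c i = (if i = \<sigma> 0 then sqrt (of_int d) else 1)" for i
  \<comment> \<open>Bounds for f x - x, whose values at i and \<sigma> i differ only in sign: sqrt d
    occurs at both 0 and \<sigma> 0, and the product of all bounds is d.\<close>
  define C where "C i = (if i = 0 \<or> i = \<sigma> 0 then sqrt (of_int d) else 1)" for i
  have detE: "detf n E = 1" by (rule detf_lower_unitriangular) (auto simp: E_def)
  have cpos: "c i > 0" for i using disc_pos by (simp add: c_def)
  have cprod: "(\<Prod>i<n. c i) = sqrt (of_int d)"
  proof -
    have "(\<Prod>i<n. c i) = (\<Prod>i\<in>{\<sigma> 0}. sqrt (of_int d))"
      by (rule prod.mono_neutral_cong_right) (use \<sigma>(1)[OF n0] in \<open>auto simp: c_def\<close>)
    then show ?thesis by simp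
  qed
  obtain x where x: "algebraic_int x" "x \<noteq> 0" "\<bar>\<Sum>s<n. E 0 s * hs s x\<bar> \<le> c 0"
    "\<And>i. i < n \<Longrightarrow> i \<noteq> 0 \<Longrightarrow> \<bar>\<Sum>s<n. E i s * hs s x\<bar> < c i"
    by (rule minkowski_integers[OF detE cpos cprod]) blast
  have E: "(\<Sum>s<n. E i s * hs s x) = hs i x - (if \<sigma> i < i then hs (\<sigma> i) x else 0)" if i: "i < n" for i
  proof -
    have "(\<Sum>s<n. E i s * hs s x) = (\<Sum>s<n. (if s = i then hs s x else 0) - (if s = \<sigma> i then if \<sigma> i < i then hs s x else 0 else 0))"
      using fixfree[OF i] by (intro sum.cong refl) (auto simp: E_def)
    then show ?thesis using i \<sigma>(1)[OF i] by (simp add: sum_subtractf)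
  qed
  have small: "\<bar>hs i x\<bar> < 1" if "i < n" "i \<noteq> 0" "i < \<sigma> i" for i
  proof -
    have "i \<noteq> \<sigma> 0" using that \<sigma>\<sigma>[OF n0] by auto
    then show ?thesis using x(4)[OF that(1,2)] E[OF that(1)] that(3) by (simp add: c_def)
  qed
  have zero: "\<bar>hs 0 x\<bar> \<le> 1"
    using x(3) E[OF n0] fixfree[OF n0] by (simp add: c_def)
  have diff: "\<bar>hs i x - hs (\<sigma> i) x\<bar> < c i" if "i < n" "\<sigma> i < i" for i
    using x(4)[OF that(1)] E[OF that(1)] that(2) by simp
  define y where "y = f x - x"
  have y: "algebraic_int y" unfolding y_def using x(1) isometry_alg[OF f] by (intro algebraic_int_diff) auto
  have hsy: "\<bar>hs i y\<bar> = \<bar>hs i x - hs (\<sigma> i) x\<bar>" if "i < n" for i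
    by (simp add: y_def hs_diff \<sigma>f[OF that x(1)] abs_minus_commute)
  have yC: "\<bar>hs i y\<bar> < C i" if i: "i < n" for i
  proof (cases "\<sigma> i < i")
    case True
    then have "\<bar>hs i y\<bar> < c i" using diff[OF i] hsy[OF i] by simp
    moreover have "c i = C i" using True by (auto simp: c_def C_def)
    ultimately show ?thesis by simp
  next
    case False
    then have lt: "i < \<sigma> i" using fixfree[OF i] by simp
    then have "\<bar>hs (\<sigma> i) x - hs i x\<bar> < c (\<sigma> i)" using diff[OF \<sigma>(1)[OF i]] \<sigma>\<sigma>[OF i] by simp
    then have "\<bar>hs i y\<bar> < c (\<sigma> i)" using hsy[OF i] by (simp add: abs_minus_commute)
    moreover have "c (\<sigma> i) = C i"
      using \<sigma>\<sigma>[OF i] \<sigma>\<sigma>[OF n0] lt by (auto simp: c_def C_def)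
    ultimately show ?thesis by simp
  qed
  have "(\<Prod>i<n. \<bar>hs i y\<bar>) < (\<Prod>i<n. C i)"
  proof (rule prod_mono_strict[of 0])
    show "0 \<le> \<bar>hs i y\<bar> \<and> \<bar>hs i y\<bar> \<le> C i" if "i \<in> {..<n}" for i using yC[of i] that by simp
    show "0 < C i" if "i \<in> {..<n}" for i using disc_pos by (simp add: C_def)
  qed (use yC[OF n0] n0 in auto)
  also have "(\<Prod>i<n. C i) = (\<Prod>i\<in>{0, \<sigma> 0}. sqrt (of_int d))"
    by (rule prod.mono_neutral_cong_right) (use \<sigma>(1)[OF n0] n0 in \<open>auto simp: C_def\<close>)
  also have "\<dots> = of_int d" using fixfree[OF n0] disc_pos by simp
  finally have lt: "\<bar>\<Prod>i<n. hs i y\<bar> < of_int d" by (simp add: abs_prod)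
  have y_cod: "algebraic_int (y * codual l / of_int d)" if "l < n" for l
    unfolding y_def by (rule isometry_difference_different[OF f one x(1) that])
  obtain m where m: "(\<Prod>i<n. hs i y) = of_int (d * m)" by (rule norm_divisible[OF y_cod])
  have "\<bar>d * m\<bar> < d" using lt unfolding m by (simp only: of_int_abs[symmetric] of_int_less_iff)
  then have "m = 0" using disc_pos by (auto simp: abs_mult)
  then have "\<bar>\<Prod>i<n. hs i y\<bar> < 1" unfolding m by simp
  then have "y = 0" by (rule small_norm_zero[OF y])
  then have fx: "f x = x" by (simp add: y_def)
  then have \<sigma>x: "hs (\<sigma> i) x = hs i x" if "i < n" for i using \<sigma>f[OF that x(1)] by simp
  have lt1: "\<bar>hs i x\<bar> < 1" if "i < n" "i \<noteq> 0" "i \<noteq> \<sigma> 0" for i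
  proof (cases "i < \<sigma> i")
    case True
    then show ?thesis using small that by blast
  next
    case False
    then have "\<sigma> i < \<sigma> (\<sigma> i)" using fixfree[OF that(1)] \<sigma>\<sigma>[OF that(1)] by simp
    moreover have "\<sigma> i \<noteq> 0" using that(3) \<sigma>\<sigma>[OF that(1)] by metis
    ultimately have "\<bar>hs (\<sigma> i) x\<bar> < 1" using small \<sigma>(1)[OF that(1)] by blast
    then show ?thesis using \<sigma>x[OF that(1)] by simp
  qed
  \<comment> \<open>At \<sigma> 0 the value is that at 0, because f fixes x.\<close>
  have le1: "\<bar>hs i x\<bar> \<le> 1" if "i < n" for i
    using lt1[OF that] zero \<sigma>x[OF n0] by (cases "i = 0"; cases "i = \<sigma> 0") auto
  have "\<not> {..<n} \<subseteq> {0, \<sigma> 0}"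
  proof
    assume "{..<n} \<subseteq> {0, \<sigma> 0}"
    then have "card {..<n} \<le> card {0, \<sigma> 0}" by (intro card_mono) auto
    then have "n \<le> 2" using fixfree[OF n0] by simp
    then show False using n2 n0 \<sigma>(1)[OF n0] fixfree[OF n0] by (cases "n = 1") auto
  qed
  then obtain j where j: "j < n" "j \<noteq> 0" "j \<noteq> \<sigma> 0" by auto
  have "(\<Prod>i<n. \<bar>hs i x\<bar>) < 1"
    using j lt1 le1 by (intro prod_less_one[of _ j]) auto
  then have "x = 0" using x(1) by (intro small_norm_zero) (auto simp: abs_prod)
  then show False using x(2) by simp
qed

lemma isometry_trivial:
  assumes n2: "n \<noteq> 2" and f: "isometry f" and one: "f 1 = 1" and x: "algebraic_int x"
  shows "f x = x"
proof (cases "d = 1")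
  case True
  then have n1: "n = 1" by (rule degree_one_if_unimodular)
  obtain \<sigma> where ind: "induces f \<sigma>" using isometry_permutation[OF f one] by blast
  then have "hs 0 x = hs 0 (f x)" using n1 inducesD(1,2)[OF ind, of 0] x by simp
  then show ?thesis by (simp only: hs_eq_iff)
next
  case False
  then have "\<not> is_unit d" using disc_pos by simp
  then obtain p where p: "prime p" "p dvd d"
    using prime_divisor_exists[of d] disc_nonzero by blast
  then obtain k where k: "d = p * k" by blast
  obtain r q c where "ramified_prime hs b n d p k r q c" using ramified_prime_exists[OF p(1) k] by blast
  then interpret ramified_prime hs b n d p k r q c .
  show ?thesis
    using involution_degree_two[OF f one isometry_involution[OF f one] x] n2 by blast
qed

text \<open>In degree two this is Galois conjugation, expressed by the trace so that no square root
  has to be chosen.\<close>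

abbreviation conj :: "'k \<Rightarrow> 'k" where "conj x \<equiv> of_int (tr x) - x"

text \<open>The permutation of the two embeddings is trivial or a swap. In the case of a swap, f x
  is determined by hs 1 (f x) = hs 0 x and by its trace, which is that of x because the trace is the
  pairing with 1.\<close>

lemma isometry_degree_two:
  assumes n2: "n = 2" and f: "isometry f" and one: "f 1 = 1"
  shows "(\<forall>x. algebraic_int x \<longrightarrow> f x = x) \<or> (\<forall>x. algebraic_int x \<longrightarrow> f x = conj x)"
proof -
  obtain \<sigma> where ind: "induces f \<sigma>" using isometry_permutation[OF f one] by blast
  note \<sigma> = inducesD(1,2)[OF ind degree_positive]
  show ?thesis
  proof (cases "\<sigma> 0 = 0")
    case True
    then have "f x = x" if "algebraic_int x" for x using isometry_fixed_embedding[of 0 f x] \<sigma>(2) that by simp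
    then show ?thesis by blast
  next
    case False
    then have \<sigma>1: "\<sigma> 0 = 1" using \<sigma>(1) n2 by simp
    have "f x = conj x" if x: "algebraic_int x" for x
    proof -
      have "tr (f x) = tr x" using isometry_tr[OF f x, of 1] one algebraic_int_of_int[of 1] by simp
      then have "hs 0 (f x) + hs 1 (f x) = of_int (tr x)"
        using real_tr[OF isometry_alg[OF f x]] n2 by (simp add: eval_nat_numeral)
      then have "hs 0 (f x) = hs 0 (conj x)" using \<sigma>(2)[OF x] \<sigma>1 by (simp add: hs_diff hs_of_int)
      then show ?thesis by (simp only: hs_eq_iff)
    qed
    then show ?thesis by blast
  qed
qed

lemma tr_of_int: "tr (of_int m) = m * int n"
  using tr_scale[of 1 m] algebraic_int_of_int[of 1] by (simp add: tr_one)

lemma conj_alg: "algebraic_int x \<Longrightarrow> algebraic_int (conj x)"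
  by (intro algebraic_int_diff) auto

lemma tr_conj: "n = 2 \<Longrightarrow> algebraic_int x \<Longrightarrow> tr (conj x) = tr x"
  by (simp add: tr_diff tr_of_int)

lemma conj_isometry:
  assumes n2: "n = 2"
  shows "isometry conj"
  unfolding isometry_def
proof (intro conjI allI impI)
  show "algebraic_int (conj x)" if "algebraic_int x" for x using that by (rule conj_alg)
  show "conj (x + y) = conj x + conj y" if "algebraic_int x" "algebraic_int y" for x y
    using that by (simp add: tr_add)
  show "conj (of_int m * x) = of_int m * conj x" if "algebraic_int x" for m x
    using that by (simp add: tr_scale right_diff_distrib)
  show "tr (conj x * conj y) = tr (x * y)" if xy: "algebraic_int x" "algebraic_int y" for x y
  proof (rule tr_eqI)
    show "algebraic_int (conj x * conj y)" using xy by (intro algebraic_int_mult conj_alg)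
    have *: "(\<Sum>s<n. g s) = g 0 + g 1" for g :: "nat \<Rightarrow> real" by (simp add: n2 eval_nat_numeral)
    have trace: "real_of_int (tr z) = hs 0 z + hs 1 z" if "algebraic_int z" for z
      using real_tr[OF that] by (simp add: *)
    have "(\<Sum>s<n. hs s (conj x * conj y)) =
        (of_int (tr x) - hs 0 x) * (of_int (tr y) - hs 0 y) + (of_int (tr x) - hs 1 x) * (of_int (tr y) - hs 1 y)"
      by (simp only: * hs_mult hs_diff hs_of_int)
    also have "\<dots> = hs 0 (x * y) + hs 1 (x * y)"
      unfolding trace[OF xy(1)] trace[OF xy(2)] hs_mult by (simp add: mult.commute)
    also have "\<dots> = of_int (tr (x * y))" using xy by (simp only: trace algebraic_int_mult)
    finally show "(\<Sum>s<n. hs s (conj x * conj y)) = of_int (tr (x * y))" .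
  qed
  show "\<exists>x. algebraic_int x \<and> conj x = y" if "algebraic_int y" for y
    using that conj_alg[OF that] tr_conj[OF n2 that] by (intro exI[of _ "conj y"]) simp
qed

text \<open>If conjugation were trivial, both embeddings of x would be half its trace, and they
  would not be distinct.\<close>

lemma conj_nontrivial:
  assumes n2: "n = 2"
  obtains w where "algebraic_int w" "conj w \<noteq> w"
proof (rule ccontr)
  assume "\<not> thesis"
  then have eq: "conj x = x" if "algebraic_int x" for x using that \<open>\<not> thesis\<close> by (meson \<open>\<And>w. algebraic_int w \<Longrightarrow> conj w \<noteq> w \<Longrightarrow> thesis\<close>)
  have "hs 0 x = hs 1 x" if "algebraic_int x" for x
  proof -
    have "of_int (tr x) - hs s x = hs s x" for s
      using arg_cong[OF eq[OF that], of "hs s"] by (simp add: hs_diff hs_of_int)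
    from this[of 0] this[of 1] show ?thesis by linarith
  qed
  from embeddings_separated[of 0 1, OF _ _ this] n2 show False by simp
qed

text \<open>The Booleans s and c stand for the two factors \<int>/2\<int>: sign and conjugation.
  Composition is exclusive or, written as \<noteq>.\<close>

definition signed_conj :: "bool \<Rightarrow> bool \<Rightarrow> 'k \<Rightarrow> 'k" where
  "signed_conj s c x = (if s then - (if c then conj x else x) else (if c then conj x else x))"

lemma signed_conj_isometry: "n = 2 \<or> \<not> c \<Longrightarrow> isometry (signed_conj s c)"
  using isometry_id isometry_minus[OF isometry_id] conj_isometry isometry_minus[OF conj_isometry]
  by (cases s; cases c) (simp_all add: signed_conj_def[abs_def])

lemma signed_conj_compose:
  assumes "n = 2 \<or> \<not> c \<and> \<not> c'" "algebraic_int x"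
  shows "signed_conj s c (signed_conj s' c' x) = signed_conj (s \<noteq> s') (c \<noteq> c') x"
proof -
  have "tr (x - of_int (tr x)) = - tr x" if "n = 2" using that assms(2) by (simp add: tr_diff tr_of_int)
  then show ?thesis
    using assms by (cases c; cases c'; cases s; cases s') (auto simp: signed_conj_def tr_conj tr_minus conj_alg)
qed

lemma isometry_classification:
  assumes f: "isometry f"
  shows "\<exists>s c. (n = 2 \<or> \<not> c) \<and> (\<forall>x. algebraic_int x \<longrightarrow> f x = signed_conj s c x)"
proof -
  have *: "\<exists>c. (n = 2 \<or> \<not> c) \<and> (\<forall>x. algebraic_int x \<longrightarrow> g x = (if c then conj x else x))"
    if g: "isometry g" "g 1 = 1" for g
  proof (cases "n = 2")
    case True
    from isometry_degree_two[OF this g] show ?thesis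
    proof
      assume "\<forall>x. algebraic_int x \<longrightarrow> g x = x"
      then show ?thesis by (intro exI[of _ False]) simp
    next
      assume "\<forall>x. algebraic_int x \<longrightarrow> g x = conj x"
      then show ?thesis using True by (intro exI[of _ True]) simp
    qed
  next
    case False
    then show ?thesis using isometry_trivial[OF False g] by (intro exI[of _ False]) simp
  qed
  from isometry_one[OF f] show ?thesis
  proof
    assume "f 1 = 1"
    from *[OF f this] obtain c where "(n = 2 \<or> \<not> c)" "\<forall>x. algebraic_int x \<longrightarrow> f x = (if c then conj x else x)" by blast
    then show ?thesis by (intro exI[of _ False] exI[of _ c]) (simp add: signed_conj_def)
  next
    assume "f 1 = - 1"
    then have "(\<lambda>x. - f x) 1 = 1" by simp
    from *[OF isometry_minus[OF f] this] obtain c where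
      c: "(n = 2 \<or> \<not> c)" "\<forall>x. algebraic_int x \<longrightarrow> - f x = (if c then conj x else x)" by blast
    have "f x = signed_conj True c x" if "algebraic_int x" for x
    proof -
      have "f x = - (- f x)" by simp
      also have "- f x = (if c then conj x else x)" using c(2) that by blast
      finally show ?thesis by (simp add: signed_conj_def)
    qed
    then show ?thesis using c(1) by blast
  qed
qed

section \<open>The automorphism group of the lattice\<close>

abbreviation OK :: "'k set" where "OK \<equiv> ring_of_integers"

lemma signed_conj_in_aut:
  assumes c: "n = 2 \<or> \<not> c"
  shows "restrict (signed_conj s c) OK \<in> carrier (lattice_aut OK trace_form)"
proof -
  note f = signed_conj_isometry[OF c, of s]
  have involution: "signed_conj s c (signed_conj s c x) = x" if "algebraic_int x" for x
    using c that signed_conj_compose[of c c x s s] by (auto simp: signed_conj_def)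
  have alg: "x \<in> OK \<longleftrightarrow> algebraic_int x" for x :: 'k by (simp add: ring_of_integers_def)
  have "bij_betw (restrict (signed_conj s c) OK) OK OK"
    by (rule bij_betw_byWitness[where f' = "signed_conj s c"])
       (auto simp: alg involution isometry_alg[OF f])
  then have "restrict (signed_conj s c) OK \<in> Bij OK" by (simp add: Bij_def)
  moreover have "field_trace (signed_conj s c x * signed_conj s c y) = field_trace (x * y)"
    if "algebraic_int x" "algebraic_int y" for x y
    using that isometry_tr[OF f that]
    by (simp add: of_int_tr[symmetric] algebraic_int_mult isometry_alg[OF f])
  ultimately show ?thesis
    by (simp add: lattice_aut_def alg trace_form_def isometryD(1-3)[OF f] algebraic_int_add algebraic_int_mult)
qed

lemma lattice_aut_isometry:
  assumes "f \<in> carrier (lattice_aut OK trace_form)"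
  shows "isometry f"
proof -
  have alg: "x \<in> OK \<longleftrightarrow> algebraic_int x" for x :: 'k by (simp add: ring_of_integers_def)
  from assms have f: "bij_betw f OK OK" "\<And>x y. x \<in> OK \<Longrightarrow> y \<in> OK \<Longrightarrow> f (x + y) = f x + f y"
    "\<And>m x. x \<in> OK \<Longrightarrow> f (of_int m * x) = of_int m * f x"
    "\<And>x y. x \<in> OK \<Longrightarrow> y \<in> OK \<Longrightarrow> field_trace (f x * f y) = field_trace (x * y)"
    by (auto simp: lattice_aut_def Bij_def trace_form_def)
  have fO: "f x \<in> OK" if "x \<in> OK" for x using f(1) that by (auto simp: bij_betw_def)
  show ?thesis
    unfolding isometry_def
  proof (intro conjI allI impI)
    show "\<exists>x. algebraic_int x \<and> f x = y" if "algebraic_int y" for y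
      using f(1) that unfolding bij_betw_def alg[symmetric] by (metis imageE)
    show "tr (f x * f y) = tr (x * y)" if "algebraic_int x" "algebraic_int y" for x y
      using that f(4)[of x y] by (simp add: tr_def alg)
  qed (use f(2,3) fO alg in auto)
qed

lemma carrier_lattice_aut:
  "carrier (lattice_aut OK trace_form) = {restrict (signed_conj s c) OK | s c. n = 2 \<or> \<not> c}"
proof (intro equalityI subsetI)
  fix f assume f: "f \<in> carrier (lattice_aut OK trace_form)"
  obtain s c where sc: "n = 2 \<or> \<not> c" "\<forall>x. algebraic_int x \<longrightarrow> f x = signed_conj s c x"
    using isometry_classification[OF lattice_aut_isometry[OF f]] by blast
  have "f \<in> extensional OK" using f by (simp add: lattice_aut_def Bij_def)
  then have "f = restrict (signed_conj s c) OK"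
    using sc(2) by (intro extensionalityI[of f OK]) (auto simp: ring_of_integers_def)
  then show "f \<in> {restrict (signed_conj s c) OK | s c. n = 2 \<or> \<not> c}" using sc(1) by blast
qed (auto intro: signed_conj_in_aut)

lemma lattice_aut_mult:
  assumes "n = 2 \<or> \<not> c \<and> \<not> c'"
  shows "restrict (signed_conj s c) OK \<otimes>\<^bsub>lattice_aut OK trace_form\<^esub> restrict (signed_conj s' c') OK =
    restrict (signed_conj (s \<noteq> s') (c \<noteq> c')) OK"
proof -
  have c: "n = 2 \<or> \<not> c" and c': "n = 2 \<or> \<not> c'" using assms by auto
  have "restrict (signed_conj s c) OK \<in> Bij OK" "restrict (signed_conj s' c') OK \<in> Bij OK"
    using signed_conj_in_aut[OF c, of s] signed_conj_in_aut[OF c', of s'] by (auto simp: lattice_aut_def)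
  then have "restrict (signed_conj s c) OK \<otimes>\<^bsub>lattice_aut OK trace_form\<^esub> restrict (signed_conj s' c') OK =
      compose OK (restrict (signed_conj s c) OK) (restrict (signed_conj s' c') OK)"
    by (simp add: lattice_aut_def BijGroup_def)
  also have "\<dots> = restrict (signed_conj (s \<noteq> s') (c \<noteq> c')) OK"
  proof (rule extensionalityI[of _ OK])
    fix x :: 'k assume "x \<in> OK"
    then have x: "algebraic_int x" by (simp add: ring_of_integers_def)
    then show "compose OK (restrict (signed_conj s c) OK) (restrict (signed_conj s' c') OK) x =
        restrict (signed_conj (s \<noteq> s') (c \<noteq> c')) OK x"
      using isometry_alg[OF signed_conj_isometry[OF c'] x]
      by (simp add: compose_def ring_of_integers_def signed_conj_compose[OF assms])
  qed auto
  finally show ?thesis .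
qed

lemma restrict_signed_conj_inject:
  assumes eq: "restrict (signed_conj s c) OK = restrict (signed_conj s' c') OK" and n: "n = 2 \<or> \<not> c \<and> \<not> c'"
  shows "s = s'" "c = c'"
proof -
  have val: "signed_conj s c x = signed_conj s' c' x" if "algebraic_int x" for x
    using fun_cong[OF eq, of x] that by (simp add: ring_of_integers_def)
  have "(if s then -1 else 1) = signed_conj s c 1" using n by (auto simp: signed_conj_def tr_one)
  also have "\<dots> = signed_conj s' c' 1" by (rule val) (use algebraic_int_of_int[of 1] in simp)
  also have "\<dots> = (if s' then -1 else 1)" using n by (auto simp: signed_conj_def tr_one)
  finally show s: "s = s'" by (cases s; cases s') auto
  show "c = c'"
  proof (rule ccontr)
    assume "c \<noteq> c'"
    then have n2: "n = 2" using n by auto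
    obtain w where "algebraic_int w" "conj w \<noteq> w" by (rule conj_nontrivial[OF n2])
    then show False using val[of w] \<open>c \<noteq> c'\<close> s by (auto simp: signed_conj_def split: if_splits)
  qed
qed

text \<open>Common to both degrees: the condition on (s, c) leaves four pairs if n = 2 and two pairs
  otherwise. The isomorphism is built starting from G, since inverting it relies on the group laws
  of G.\<close>

lemma lattice_aut_iso:
  assumes "group G" and \<phi>: "bij_betw \<phi> (carrier G) {(s, c). n = 2 \<or> \<not> c}"
    and mult: "\<And>u v. u \<in> carrier G \<Longrightarrow> v \<in> carrier G \<Longrightarrow>
      \<phi> (u \<otimes>\<^bsub>G\<^esub> v) = (fst (\<phi> u) \<noteq> fst (\<phi> v), snd (\<phi> u) \<noteq> snd (\<phi> v))"
  shows "lattice_aut OK trace_form \<cong> G"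
proof (rule group.iso_sym[OF assms(1)])
  define \<psi> where "\<psi> = (\<lambda>(s, c). restrict (signed_conj s c) OK)"
  have \<phi>_in: "n = 2 \<or> \<not> snd (\<phi> u)" if "u \<in> carrier G" for u
    using \<phi> that unfolding bij_betw_def by (metis (mono_tags, lifting) case_prodE image_eqI mem_Collect_eq snd_conv)
  have "inj_on \<psi> {(s, c). n = 2 \<or> \<not> c}"
    by (rule inj_onI) (auto simp: \<psi>_def dest: restrict_signed_conj_inject)
  then have "bij_betw \<psi> {(s, c). n = 2 \<or> \<not> c} (carrier (lattice_aut OK trace_form))"
    unfolding carrier_lattice_aut by (auto simp: bij_betw_def \<psi>_def image_iff)
  then have "bij_betw (\<psi> \<circ> \<phi>) (carrier G) (carrier (lattice_aut OK trace_form))"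
    using \<phi> by (rule bij_betw_trans[rotated])
  moreover have "\<psi> (\<phi> (u \<otimes>\<^bsub>G\<^esub> v)) = \<psi> (\<phi> u) \<otimes>\<^bsub>lattice_aut OK trace_form\<^esub> \<psi> (\<phi> v)"
    if "u \<in> carrier G" "v \<in> carrier G" for u v
  proof -
    have "n = 2 \<or> \<not> snd (\<phi> u) \<and> \<not> snd (\<phi> v)" using \<phi>_in[OF that(1)] \<phi>_in[OF that(2)] by blast
    then show ?thesis unfolding mult[OF that] by (simp add: \<psi>_def case_prod_beta lattice_aut_mult)
  qed
  ultimately have "\<psi> \<circ> \<phi> \<in> iso G (lattice_aut OK trace_form)"
    by (intro isoI homI) (auto simp: bij_betw_def)
  then show "G \<cong> lattice_aut OK trace_form" by (rule is_isoI)
qed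

lemma lattice_aut_degree_two:
  assumes "n = 2"
  shows "lattice_aut OK trace_form \<cong> integer_mod_group 2 \<times>\<times> integer_mod_group 2"
proof (rule lattice_aut_iso[where \<phi> = "\<lambda>(a, e). (a = 1, e = 1)"])
  show "group (integer_mod_group 2 \<times>\<times> integer_mod_group 2)" by (intro DirProd_group group_integer_mod_group)
  have G: "carrier (integer_mod_group 2 \<times>\<times> integer_mod_group 2) = {0, 1} \<times> {0, 1}"
    by (auto simp: carrier_integer_mod_group DirProd_def)
  show "bij_betw (\<lambda>(a, e). (a = 1, e = 1)) (carrier (integer_mod_group 2 \<times>\<times> integer_mod_group 2)) {(s, c). n = 2 \<or> \<not> c}"
    unfolding G by (rule bij_betw_byWitness[where f' = "\<lambda>(s, c). (of_bool s, of_bool c)"]) (auto simp: assms)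
qed (auto simp: carrier_integer_mod_group mult_integer_mod_group DirProd_def)

lemma lattice_aut_degree_not_two:
  assumes "n \<noteq> 2"
  shows "lattice_aut OK trace_form \<cong> integer_mod_group 2"
proof (rule lattice_aut_iso[where \<phi> = "\<lambda>a. (a = 1, False)"])
  have G: "carrier (integer_mod_group 2) = {0, 1}" by (auto simp: carrier_integer_mod_group)
  show "bij_betw (\<lambda>a. (a = 1, False)) (carrier (integer_mod_group 2)) {(s, c). n = 2 \<or> \<not> c}"
    unfolding G by (rule bij_betw_byWitness[where f' = "\<lambda>(s, c). of_bool s"]) (auto simp: assms)
qed (auto simp: carrier_integer_mod_group mult_integer_mod_group group_integer_mod_group)

end

theorem theorem5p4:
  assumes "totally_real TYPE('k :: number_field)"
    and "squarefree (field_discriminant TYPE('k))"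
  shows "if field_degree TYPE('k) = 2
    then lattice_aut (ring_of_integers :: 'k set) trace_form
           \<cong> integer_mod_group 2 \<times>\<times> integer_mod_group 2
    else lattice_aut (ring_of_integers :: 'k set) trace_form \<cong> integer_mod_group 2"
proof -
  obtain hs :: "nat \<Rightarrow> 'k \<Rightarrow> real" where hs: "\<And>i. field_emb (hs i)"
    "\<And>x. of_rat (field_trace x) = (\<Sum>i<field_degree TYPE('k). hs i x)"
    by (rule real_embeddings[OF assms(1)]) blast
  obtain b :: "nat \<Rightarrow> 'k" where b: "\<And>i. algebraic_int (b i)" "gram_det b \<noteq> 0"
    "\<And>x. algebraic_int x \<Longrightarrow> \<exists>c. x = (\<Sum>i<field_degree TYPE('k). of_int (c i) * b i)"
    by (rule integral_basis_exists[where 'k = 'k]) blast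
  have disc: "of_int (field_discriminant TYPE('k)) = gram_det b"
    by (rule field_discriminant_eq_gram_det[OF b(1,2)]) (rule b(3))
  interpret totally_real_field hs b "field_degree TYPE('k)" "field_discriminant TYPE('k)"
    by unfold_locales (rule refl | fact hs b assms(2) disc)+
  show ?thesis using lattice_aut_degree_two lattice_aut_degree_not_two by simp
qed

end
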